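(* Let $\mathcal M$ be a finite factor with normalized trace $\tau$, let $A\in\mathcal M$ be self-adjoint, and let $\mathcal O_A$ be the norm closure of the unitary orbit $\{UAU^*: U\text{ unitary in }\mathcal M\}$. Then $\mathcal O_A$ is closed in the strong operator topology, and $\mathcal O_A$ consists exactly of all self-adjoint operators $B\in\mathcal M$ with $m_B=m_A$.
   Context: For a self-adjoint operator $A$ in $\mathcal M$, the spectral distribution $m_A$ is the unique probability measure on the Borel subsets of $\mathbb R$ with $\int\lambda^n\,dm_A(\lambda)=\tau(A^n)$ for $n=0,1,2,\dots$. *)

theory Defs
  imports "HOL-Analysis.Analysis" "HOL-Probability.Probability"
begin

text \<open>
  Complex Hilbert spaces are modelled as real Hilbert spaces (type class
  real_inner + complete_space) equipped with a complex structure J, i.e. a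
  real-orthogonal bounded operator with J o J = -id; multiplication by the
  imaginary unit is J.  The complex inner product is
  inner x y + i * inner x (J y); complex-linear bounded operators are the
  bounded real-linear operators commuting with J.  For such operators the
  complex Hilbert space adjoint coincides with the real adjoint.
\<close>

definition complex_structure :: "('h::{real_inner,complete_space} \<Rightarrow>\<^sub>L 'h) \<Rightarrow> bool" where
  "complex_structure J \<longleftrightarrow>
     J o\<^sub>L J = - id_blinfun \<and> (\<forall>x y. inner (J x) (J y) = inner x y)"

definition cops :: "('h::{real_inner,complete_space} \<Rightarrow>\<^sub>L 'h) \<Rightarrow> ('h \<Rightarrow>\<^sub>L 'h) set" where
  "cops J = {T. T o\<^sub>L J = J o\<^sub>L T}"

definition cscale :: "('h::{real_inner,complete_space} \<Rightarrow>\<^sub>L 'h) \<Rightarrow> complex \<Rightarrow> ('h \<Rightarrow>\<^sub>L 'h) \<Rightarrow> ('h \<Rightarrow>\<^sub>L 'h)" where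
  "cscale J c T = Re c *\<^sub>R T + Im c *\<^sub>R (J o\<^sub>L T)"

definition adj :: "('h::{real_inner,complete_space} \<Rightarrow>\<^sub>L 'h) \<Rightarrow> ('h \<Rightarrow>\<^sub>L 'h)" where
  "adj T = (THE S::'h \<Rightarrow>\<^sub>L 'h. \<forall>x y. inner (T x) y = inner x (S y))"

definition selfadjoint_op :: "('h::{real_inner,complete_space} \<Rightarrow>\<^sub>L 'h) \<Rightarrow> bool" where
  "selfadjoint_op T \<longleftrightarrow> (\<forall>x y. inner (T x) y = inner x (T y))"

definition unitary_op :: "('h::{real_inner,complete_space} \<Rightarrow>\<^sub>L 'h) \<Rightarrow> bool" where
  "unitary_op U \<longleftrightarrow> adj U o\<^sub>L U = id_blinfun \<and> U o\<^sub>L adj U = id_blinfun"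

definition opow :: "('h::{real_inner,complete_space} \<Rightarrow>\<^sub>L 'h) \<Rightarrow> nat \<Rightarrow> ('h \<Rightarrow>\<^sub>L 'h)" where
  "opow A n = ((\<lambda>B. A o\<^sub>L B) ^^ n) id_blinfun"

definition commutant :: "('h::{real_inner,complete_space} \<Rightarrow>\<^sub>L 'h) \<Rightarrow> ('h \<Rightarrow>\<^sub>L 'h) set \<Rightarrow> ('h \<Rightarrow>\<^sub>L 'h) set" where
  "commutant J S = {T \<in> cops J. \<forall>A\<in>S. T o\<^sub>L A = A o\<^sub>L T}"

definition von_neumann_algebra :: "('h::{real_inner,complete_space} \<Rightarrow>\<^sub>L 'h) \<Rightarrow> ('h \<Rightarrow>\<^sub>L 'h) set \<Rightarrow> bool" where
  "von_neumann_algebra J M \<longleftrightarrow>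
     complex_structure J \<and> M \<subseteq> cops J \<and> (\<forall>A\<in>M. adj A \<in> M) \<and>
     commutant J (commutant J M) = M"

definition factor :: "('h::{real_inner,complete_space} \<Rightarrow>\<^sub>L 'h) \<Rightarrow> ('h \<Rightarrow>\<^sub>L 'h) set \<Rightarrow> bool" where
  "factor J M \<longleftrightarrow> von_neumann_algebra J M \<and>
     M \<inter> commutant J M = {cscale J c id_blinfun | c. True}"

text \<open>Faithful normal tracial state on M (normality: strong-operator continuity
  on the unit ball of M).\<close>
definition faithful_normal_tracial_state ::
  "('h::{real_inner,complete_space} \<Rightarrow>\<^sub>L 'h) \<Rightarrow> ('h \<Rightarrow>\<^sub>L 'h) set \<Rightarrow> (('h \<Rightarrow>\<^sub>L 'h) \<Rightarrow> complex) \<Rightarrow> bool" where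
  "faithful_normal_tracial_state J M \<tau> \<longleftrightarrow>
     (\<forall>A\<in>M. \<forall>B\<in>M. \<tau> (A + B) = \<tau> A + \<tau> B) \<and>
     (\<forall>A\<in>M. \<forall>c. \<tau> (cscale J c A) = c * \<tau> A) \<and>
     (\<forall>A\<in>M. Im (\<tau> (adj A o\<^sub>L A)) = 0 \<and> Re (\<tau> (adj A o\<^sub>L A)) \<ge> 0) \<and>
     \<tau> id_blinfun = 1 \<and>
     (\<forall>A\<in>M. \<forall>B\<in>M. \<tau> (A o\<^sub>L B) = \<tau> (B o\<^sub>L A)) \<and>
     (\<forall>A\<in>M. \<tau> (adj A o\<^sub>L A) = 0 \<longrightarrow> A = 0) \<and>
     continuous_map (subtopology strong_operator_topology {A \<in> M. norm A \<le> 1}) euclidean \<tau>"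

definition finite_factor_with_trace ::
  "('h::{real_inner,complete_space} \<Rightarrow>\<^sub>L 'h) \<Rightarrow> ('h \<Rightarrow>\<^sub>L 'h) set \<Rightarrow> (('h \<Rightarrow>\<^sub>L 'h) \<Rightarrow> complex) \<Rightarrow> bool" where
  "finite_factor_with_trace J M \<tau> \<longleftrightarrow> factor J M \<and> faithful_normal_tracial_state J M \<tau>"

definition spectral_distribution ::
  "(('h::{real_inner,complete_space} \<Rightarrow>\<^sub>L 'h) \<Rightarrow> complex) \<Rightarrow> ('h \<Rightarrow>\<^sub>L 'h) \<Rightarrow> real measure" where
  "spectral_distribution \<tau> A =
     (THE m. sets m = sets borel \<and> prob_space m \<and>
        (\<forall>n. integrable m (\<lambda>x. x ^ n) \<and>
             complex_of_real (integral\<^sup>L m (\<lambda>x. x ^ n)) = \<tau> (opow A n)))"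

definition unitary_orbit ::
  "('h::{real_inner,complete_space} \<Rightarrow>\<^sub>L 'h) set \<Rightarrow> ('h \<Rightarrow>\<^sub>L 'h) \<Rightarrow> ('h \<Rightarrow>\<^sub>L 'h) set" where
  "unitary_orbit M A = {U o\<^sub>L A o\<^sub>L adj U | U. U \<in> M \<and> unitary_op U}"

end

theory Submission
  imports Defs
begin

text \<open>
  The trace is continuous, so the moments \<open>\<tau> (A\<^sup>n)\<close> pass to norm limits of the orbit and, on bounded sets, to
  strong limits; this gives one inclusion and, once the other is known, the strong closedness.
  Conversely let \<open>A\<close> and \<open>B\<close> have the same moments. The spectral projections of \<open>A\<close> and \<open>B\<close> arise
  from the two operators by the same polynomial operations and strong limits, so corresponding ones
  have the same trace. In a factor, projections of equal trace are equivalent: a partial isometry of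
  maximal trace from \<open>P\<close> to \<open>Q\<close> exists by exhaustion, and polar decomposition would extend it if it were
  not onto. Gluing the partial isometries belonging to a fine partition of the spectrum gives
  a unitary \<open>U\<close> with \<open>U A U\<^sup>*\<close> close to \<open>B\<close> in norm. Finally \<open>m\<^sub>A\<close> exists as a weak limit of the discrete
  distributions of step approximations of \<open>A\<close>, and it is unique because the geometric growth of the
  moments makes the characteristic function a power series in them.
\<close>

section \<open>Adjoints and orthogonal projections\<close>

text \<open>The obstacle is to carry equality of moments from polynomials to spectral projections of
  two different operators. The trace identity can follow only linear combinations, multiplication by
  the operators themselves and bounded strong limits. So no continuous or Borel functional calculus
  is set up: square roots, absolute values, kernel projections and approximate inverses are explicit
  polynomial sequences with strong limits, and the same closure argument yields membership in the
  algebra and commutation relations. Two features of the strong topology shape the rest. Products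
  are jointly continuous, and the trace is assumed continuous, only on bounded sets; hence
  boundedness is part of every sequential limit, and a norm bound accompanies the moments in the set
  shown to be closed. The adjoint is not strongly continuous; hence limits of adjoints are produced
  separately or replaced by limits of inner products. In the comparison of projections progress is
  measured by the real number \<open>Re (\<tau> (adj V o\<^sub>L V))\<close>, so countable chains
  suffice and all limits there are limits of sequences.\<close>

lemma linear_coeff_eq_0:
  fixes a c :: real
  assumes "\<And>t. 0 \<le> t\<^sup>2 * a + 2 * t * c" "a \<ge> 0"
  shows "c = 0"
proof (cases "a = 0")
  case True
  with assms(1)[of "- c"] show ?thesis by (auto simp: zero_le_mult_iff mult_le_0_iff)
next
  case False
  with assms(1)[of "- c / a"] assms(2) have "c * c / a \<le> 0"
    by (simp add: power2_eq_square)
  with False assms(2) show ?thesis by (auto simp: divide_le_0_iff mult_le_0_iff)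
qed

text \<open>Direct method: the representing vector is the minimiser of \<open>g\<close> over
  \<open>K\<close>. Working on a subspace lets one argument yield both adjoints
  (\<open>K = UNIV\<close>) and orthogonal projections (\<open>f = inner x\<close>).\<close>

lemma riesz_on_closed_subspace:
  fixes K :: "'h::{real_inner,complete_space} set" and f :: "'h \<Rightarrow> real"
  assumes K: "subspace K" "closed K" and f: "bounded_linear f"
  shows "\<exists>z\<in>K. \<forall>y\<in>K. f y = inner z y"
proof -
  interpret f: bounded_linear f by fact
  define g where "g x = (norm x)\<^sup>2 - 2 * f x" for x
  obtain B where B: "\<And>x. norm (f x) \<le> norm x * B" using f.bounded by blast
  have bdd: "bdd_below (g ` K)"
  proof (rule bdd_belowI2)
    fix x
    have "2 * f x \<le> 2 * (norm x * B)" using B[of x] by simp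
    moreover have "(norm x - B)\<^sup>2 \<ge> 0" by simp
    ultimately show "- B\<^sup>2 \<le> g x" by (simp add: g_def power2_eq_square algebra_simps)
  qed
  define m where "m = Inf (g ` K)"
  have m_le: "m \<le> g x" if "x \<in> K" for x using bdd that by (simp add: m_def cINF_lower)
  \<comment> \<open>The linear part of \<open>g\<close> cancels, which leaves the parallelogram law.
    As \<open>g\<close> is at least \<open>m\<close> at the midpoint, two almost minimal points must
    be close.\<close>
  have par: "g x + g y - 2 * g ((1/2) *\<^sub>R (x + y)) = (norm (x - y))\<^sup>2 / 2" for x y
  proof -
    have "(norm ((1/2) *\<^sub>R (x + y)))\<^sup>2 = (inner x x + 2 * inner x y + inner y y) / 4"
      unfolding power2_norm_eq_inner
      by (simp add: inner_add_left inner_add_right inner_commute[of y x]) argo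
    moreover have "(norm (x - y))\<^sup>2 = inner x x - 2 * inner x y + inner y y"
      by (simp add: power2_norm_eq_inner inner_diff_left inner_diff_right inner_commute[of y x])
    moreover have "f ((1/2) *\<^sub>R (x + y)) = (f x + f y) / 2" by (simp add: f.scaleR f.add)
    ultimately show ?thesis
      by (simp only: g_def power2_norm_eq_inner[of x] power2_norm_eq_inner[of y]) argo
  qed
  have "\<exists>x\<in>K. g x < m + 1 / real (Suc n)" for n
  proof -
    have "Inf (g ` K) < m + 1 / real (Suc n)" by (simp add: m_def)
    moreover have "g ` K \<noteq> {}" using subspace_0[OF K(1)] by auto
    ultimately show ?thesis using cInf_lessD[of "g ` K"] by auto
  qed
  then obtain x where xK: "\<And>n. x n \<in> K" and xg: "\<And>n. g (x n) < m + 1 / real (Suc n)"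
    by metis
  have dist: "(norm (x n - x k))\<^sup>2 \<le> 2 * (1 / real (Suc n)) + 2 * (1 / real (Suc k))" for n k
  proof -
    have "(1/2) *\<^sub>R (x n + x k) \<in> K" using K(1) xK by (simp add: subspace_add subspace_scale)
    from m_le[OF this] par[of "x n" "x k"] xg[of n] xg[of k] show ?thesis by argo
  qed
  have "Cauchy x"
  proof (rule metric_CauchyI)
    fix e :: real assume e: "e > 0"
    then obtain N where N: "4 / e\<^sup>2 < real (Suc N)"
      by (metis reals_Archimedean2 less_Suc_eq of_nat_less_iff order_less_trans)
    have "dist (x n) (x k) < e" if "n \<ge> N" "k \<ge> N" for n k
    proof -
      have "2 / real (Suc n) \<le> 2 / real (Suc N)" "2 / real (Suc k) \<le> 2 / real (Suc N)"
        using that by (auto intro!: divide_left_mono)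
      with dist[of n k] have "(norm (x n - x k))\<^sup>2 \<le> 4 / real (Suc N)" by simp
      also have "\<dots> < e\<^sup>2" using N e by (simp add: field_simps)
      finally show ?thesis using e by (simp add: dist_norm power2_less_imp_less)
    qed
    then show "\<exists>N. \<forall>n\<ge>N. \<forall>k\<ge>N. dist (x n) (x k) < e" by blast
  qed
  then obtain z where z: "x \<longlonglongrightarrow> z" using Cauchy_convergent_iff convergentD by blast
  have zK: "z \<in> K" using closed_sequentially[OF K(2)] xK z by blast
  have "(\<lambda>n. g (x n)) \<longlonglongrightarrow> g z"
    unfolding g_def by (intro tendsto_intros z f.tendsto)
  moreover have "(\<lambda>n. m + 1 / real (Suc n)) \<longlonglongrightarrow> m + 0"
    by (intro tendsto_intros LIMSEQ_Suc[OF lim_1_over_n])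
  ultimately have gz: "g z \<le> m" using xg by (intro LIMSEQ_le[of _ "g z" _ m]) (auto intro: less_imp_le)
  have "f y = inner z y" if y: "y \<in> K" for y
  proof -
    \<comment> \<open>Half the derivative of \<open>g\<close> at \<open>z\<close> in direction
      \<open>y\<close>; minimality along the line through \<open>z\<close> forces it to
      vanish.\<close>
    define c where "c = inner z y - f y"
    have "0 \<le> t\<^sup>2 * (norm y)\<^sup>2 + 2 * t * c" for t
    proof -
      have "z + t *\<^sub>R y \<in> K" using K(1) zK y by (simp add: subspace_add subspace_scale)
      from m_le[OF this] gz have "g z \<le> g (z + t *\<^sub>R y)" by simp
      then show ?thesis
        unfolding g_def c_def f.scaleR f.add power2_norm_eq_inner
        by (simp add: inner_add_left inner_add_right inner_commute[of y z] power2_eq_square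
          right_diff_distrib distrib_left mult_ac)
    qed
    then have "c = 0" by (intro linear_coeff_eq_0) auto
    then show ?thesis by (simp add: c_def)
  qed
  with zK show ?thesis by blast
qed

lemma adjoint_exists:
  fixes T :: "'h::{real_inner,complete_space} \<Rightarrow>\<^sub>L 'h"
  shows "\<exists>S::'h \<Rightarrow>\<^sub>L 'h. \<forall>x y. inner (T x) y = inner x (S y)"
proof -
  have "\<exists>z. \<forall>x. inner (T x) y = inner z x" for y
    using riesz_on_closed_subspace[of UNIV "\<lambda>x. inner (T x) y",
        OF _ _ bounded_linear_inner_left_comp[OF blinfun.bounded_linear_right]] by auto
  then obtain S where S: "\<And>x y. inner (T x) y = inner (S y) x" by metis
  have "bounded_linear S"
  proof (rule bounded_linear_intro[where K = "norm T"])
    fix x y :: 'h and r :: real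
    show "S (x + y) = S x + S y"
      by (rule vector_eq_rdot[THEN iffD1]) (simp add: inner_add_left inner_add_right S[symmetric])
    show "S (r *\<^sub>R x) = r *\<^sub>R S x"
      by (rule vector_eq_rdot[THEN iffD1]) (simp add: S[symmetric])
    have "(norm (S x))\<^sup>2 = inner (T (S x)) x" by (simp add: S power2_norm_eq_inner)
    also have "\<dots> \<le> norm (T (S x)) * norm x" by (rule norm_cauchy_schwarz)
    also have "\<dots> \<le> norm T * norm (S x) * norm x"
      by (intro mult_right_mono norm_blinfun norm_ge_zero)
    finally have "norm (S x) * norm (S x) \<le> norm (S x) * (norm x * norm T)"
      by (simp add: power2_eq_square mult_ac)
    then show "norm (S x) \<le> norm x * norm T"
      by (cases "norm (S x) = 0") (auto simp: mult_le_cancel_left)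
  qed
  then show ?thesis
    by (intro exI[of _ "Blinfun S"]) (metis bounded_linear_Blinfun_apply S inner_commute)
qed

lemma adj_eqI:
  fixes S T :: "'h::{real_inner,complete_space} \<Rightarrow>\<^sub>L 'h"
  assumes "\<And>x y. inner (T x) y = inner x (S y)"
  shows "adj T = S"
  unfolding adj_def
proof (rule the_equality)
  fix S' :: "'h \<Rightarrow>\<^sub>L 'h" assume "\<forall>x y. inner (T x) y = inner x (S' y)"
  then show "S' = S" using assms by (intro blinfun_eqI) (metis vector_eq_ldot)
qed (use assms in blast)

lemma inner_adj:
  fixes T :: "'h::{real_inner,complete_space} \<Rightarrow>\<^sub>L 'h"
  shows "inner (T x) y = inner x (adj T y)"
  using adjoint_exists[of T] adj_eqI[of T] by metis

lemma inner_adj':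
  fixes T :: "'h::{real_inner,complete_space} \<Rightarrow>\<^sub>L 'h"
  shows "inner x (T y) = inner (adj T x) y"
  by (metis inner_adj inner_commute)

lemma adj_adj [simp]: "adj (adj T) = T"
  by (rule adj_eqI) (simp add: inner_adj')

lemma adj_compose: "adj (S o\<^sub>L T) = adj T o\<^sub>L adj S"
  by (rule adj_eqI) (simp add: inner_adj)

lemma adj_add: "adj (S + T) = adj S + adj T"
  by (rule adj_eqI) (simp add: inner_adj blinfun.bilinear_simps inner_add_left inner_add_right)

lemma adj_diff: "adj (S - T) = adj S - adj T"
  by (rule adj_eqI) (simp add: inner_adj blinfun.bilinear_simps inner_diff_left inner_diff_right)

lemma adj_scaleR: "adj (c *\<^sub>R T) = c *\<^sub>R adj T"
  by (rule adj_eqI) (simp add: inner_adj blinfun.bilinear_simps)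

lemma adj_id [simp]: "adj id_blinfun = id_blinfun"
  by (rule adj_eqI) simp

lemma adj_zero [simp]: "adj 0 = 0"
  by (rule adj_eqI) (simp add: blinfun.bilinear_simps)

lemma adj_sum: "adj (sum f I) = (\<Sum>i\<in>I. adj (f i))"
  by (induction I rule: infinite_finite_induct) (simp_all add: adj_add)

lemma norm_adj: "norm (adj T) = norm T"
proof -
  have le: "norm (adj T) \<le> norm T" for T :: "'a \<Rightarrow>\<^sub>L 'a"
  proof (rule norm_blinfun_bound)
    fix x
    have "(norm (adj T x))\<^sup>2 = inner (T (adj T x)) x" by (simp add: inner_adj power2_norm_eq_inner)
    also have "\<dots> \<le> norm (T (adj T x)) * norm x" by (rule norm_cauchy_schwarz)
    also have "\<dots> \<le> norm T * norm (adj T x) * norm x"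
      by (intro mult_right_mono norm_blinfun norm_ge_zero)
    finally have "norm (adj T x) * norm (adj T x) \<le> norm (adj T x) * (norm T * norm x)"
      by (simp add: power2_eq_square mult_ac)
    then show "norm (adj T x) \<le> norm T * norm x"
      by (cases "norm (adj T x) = 0") (auto simp: mult_le_cancel_left)
  qed simp
  from le[of T] le[of "adj T"] show ?thesis by simp
qed

lemma selfadjoint_op_iff: "selfadjoint_op T \<longleftrightarrow> adj T = T"
  unfolding selfadjoint_op_def using adj_eqI[of T T] inner_adj[of T] by metis

lemma adj_compose_self_eq_0: "adj T o\<^sub>L T = 0 \<longleftrightarrow> T = 0"
proof
  assume "adj T o\<^sub>L T = 0"
  then have "inner x (adj T (T x)) = 0" for x
    by (metis blinfun_apply_blinfun_compose zero_blinfun.rep_eq inner_zero_right)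
  then have "T x = 0" for x by (simp add: inner_adj[symmetric])
  then show "T = 0" by (intro blinfun_eqI) simp
qed simp

lemma orthogonal_projection_exists:
  fixes K :: "'h::{real_inner,complete_space} set"
  assumes K: "subspace K" "closed K"
  shows "\<exists>P::'h \<Rightarrow>\<^sub>L 'h. (\<forall>x. P x \<in> K) \<and> (\<forall>x\<in>K. P x = x) \<and> (\<forall>x. \<forall>y\<in>K. inner (x - P x) y = 0)"
proof -
  have "\<exists>z\<in>K. \<forall>y\<in>K. inner x y = inner z y" for x
    using riesz_on_closed_subspace[OF K bounded_linear_inner_right] .
  then obtain P where PK: "\<And>x. P x \<in> K" and P: "\<And>x y. y \<in> K \<Longrightarrow> inner x y = inner (P x) y"
    by metis
  have uniq: "P x = z" if "z \<in> K" "\<And>y. y \<in> K \<Longrightarrow> inner x y = inner z y" for x z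
  proof -
    have "P x - z \<in> K" using PK that(1) K(1) subspace_diff by blast
    then have "inner (P x - z) (P x - z) = 0"
      using P that(2) by (metis inner_diff_left right_minus_eq)
    then show ?thesis by simp
  qed
  have bl: "bounded_linear P"
  proof (rule bounded_linear_intro[where K = 1])
    fix x y :: 'h and r :: real
    show "P (x + y) = P x + P y"
      by (rule uniq) (simp_all add: PK K(1) subspace_add inner_add_left P[symmetric])
    show "P (r *\<^sub>R x) = r *\<^sub>R P x"
      by (rule uniq) (simp_all add: PK K(1) subspace_scale P[symmetric])
    have "norm (P x) * norm (P x) \<le> norm x * norm (P x)"
      using P[OF PK, of x x] norm_cauchy_schwarz[of x "P x"]
      by (metis power2_eq_square power2_norm_eq_inner)
    then show "norm (P x) \<le> norm x * 1"
      by (cases "norm (P x) = 0") (auto simp: mult_le_cancel_right)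
  qed
  have "P x = x" if "x \<in> K" for x using uniq[OF that] by simp
  moreover have "inner (x - P x) y = 0" if "y \<in> K" for x y
    using P[OF that, of x] by (simp add: inner_diff_left)
  ultimately show ?thesis using PK bounded_linear_Blinfun_apply[OF bl] by metis
qed

section \<open>Strong limits and strongly closed algebras\<close>

text \<open>The uniform bound is part of the notion because it makes composition jointly continuous
  and matches the normality assumption, which gives continuity of the trace on the unit
  ball.\<close>

definition strong_lim :: "(nat \<Rightarrow> 'a::real_normed_vector \<Rightarrow>\<^sub>L 'b::real_normed_vector) \<Rightarrow> ('a \<Rightarrow>\<^sub>L 'b) \<Rightarrow> bool" where
  "strong_lim X L \<longleftrightarrow> (\<exists>K. \<forall>n. norm (X n) \<le> K) \<and> (\<forall>x. (\<lambda>n. X n x) \<longlonglongrightarrow> L x)"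

lemma strong_limI: "(\<And>n. norm (X n) \<le> K) \<Longrightarrow> (\<And>x. (\<lambda>n. blinfun_apply (X n) x) \<longlonglongrightarrow> blinfun_apply L x) \<Longrightarrow> strong_lim X L"
  unfolding strong_lim_def by blast

lemma strong_limD: "strong_lim X L \<Longrightarrow> (\<lambda>n. blinfun_apply (X n) x) \<longlonglongrightarrow> blinfun_apply L x"
  unfolding strong_lim_def by blast

lemma strong_lim_unique: "strong_lim X L \<Longrightarrow> strong_lim X L' \<Longrightarrow> L = L'"
  by (metis LIMSEQ_unique blinfun_eqI strong_limD)

lemma strong_lim_const: "strong_lim (\<lambda>n. L) L"
  by (rule strong_limI[where K = "norm L"]) auto

lemma strong_lim_add:
  assumes "strong_lim X L" "strong_lim Y M"
  shows "strong_lim (\<lambda>n. X n + Y n) (L + M)"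
proof -
  obtain K K' where "\<And>n. norm (X n) \<le> K" "\<And>n. norm (Y n) \<le> K'"
    using assms unfolding strong_lim_def by blast
  then have "norm (X n + Y n) \<le> K + K'" for n by (meson add_mono norm_triangle_le)
  moreover have "(\<lambda>n. (X n + Y n) x) \<longlonglongrightarrow> (L + M) x" for x
    using tendsto_add[OF assms[THEN strong_limD]] by (simp add: blinfun.add_left)
  ultimately show ?thesis by (rule strong_limI)
qed

lemma strong_lim_scaleR:
  assumes "strong_lim X L"
  shows "strong_lim (\<lambda>n. c *\<^sub>R X n) (c *\<^sub>R L)"
proof -
  obtain K where "\<And>n. norm (X n) \<le> K" using assms unfolding strong_lim_def by blast
  then have "norm (c *\<^sub>R X n) \<le> \<bar>c\<bar> * K" for n by (simp add: mult_left_mono)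
  moreover have "(\<lambda>n. (c *\<^sub>R X n) x) \<longlonglongrightarrow> (c *\<^sub>R L) x" for x
    using tendsto_scaleR[OF tendsto_const strong_limD[OF assms]] by (simp add: blinfun.scaleR_left)
  ultimately show ?thesis by (rule strong_limI)
qed

lemma strong_lim_diff:
  assumes "strong_lim X L" "strong_lim Y M"
  shows "strong_lim (\<lambda>n. X n - Y n) (L - M)"
  using strong_lim_add[OF assms(1) strong_lim_scaleR[OF assms(2), of "-1"]] by simp

text \<open>Stated for arbitrary filters: besides sequences it serves the neighbourhood filters of
  the strong operator topology when powers are shown to be continuous on balls.\<close>

lemma bounded_strong_tendsto_apply:
  fixes X :: "'c \<Rightarrow> 'a::real_normed_vector \<Rightarrow>\<^sub>L 'b::real_normed_vector"
  assumes K: "\<forall>\<^sub>F n in F. norm (X n) \<le> K" and X: "\<And>x. ((\<lambda>n. X n x) \<longlongrightarrow> L x) F" and x: "(x \<longlongrightarrow> l) F"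
  shows "((\<lambda>n. X n (x n)) \<longlongrightarrow> L l) F"
proof -
  have "((\<lambda>n. X n (x n - l)) \<longlongrightarrow> 0) F"
  proof (rule Lim_null_comparison)
    show "\<forall>\<^sub>F n in F. norm (X n (x n - l)) \<le> K * norm (x n - l)"
      using K by eventually_elim (intro order.trans[OF norm_blinfun] mult_right_mono, auto)
    have "((\<lambda>n. K * norm (x n - l)) \<longlongrightarrow> K * norm (l - l)) F" by (intro tendsto_intros x)
    then show "((\<lambda>n. K * norm (x n - l)) \<longlongrightarrow> 0) F" by simp
  qed
  from tendsto_add[OF this X[of l]] show ?thesis by (simp add: blinfun.diff_right)
qed

lemma strong_lim_compose:
  assumes "strong_lim X L" "strong_lim Y M"
  shows "strong_lim (\<lambda>n. X n o\<^sub>L Y n) (L o\<^sub>L M)"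
proof -
  obtain K K' where K: "\<And>n. norm (X n) \<le> K" "\<And>n. norm (Y n) \<le> K'"
    using assms unfolding strong_lim_def by blast
  then have "norm (X n o\<^sub>L Y n) \<le> K * K'" for n
    by (intro order.trans[OF norm_blinfun_compose] mult_mono) (auto intro: order.trans[OF norm_ge_zero])
  moreover have "(\<lambda>n. (X n o\<^sub>L Y n) x) \<longlonglongrightarrow> (L o\<^sub>L M) x" for x
    using bounded_strong_tendsto_apply[OF always_eventually[OF allI[OF K(1)]] strong_limD[OF assms(1)] strong_limD[OF assms(2)]] by simp
  ultimately show ?thesis by (rule strong_limI)
qed

lemma tendsto_imp_strong_lim:
  assumes "X \<longlonglongrightarrow> L"
  shows "strong_lim X L"
proof -
  obtain K where "\<And>n. norm (X n) \<le> K"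
    using convergent_imp_Bseq[OF convergentI[OF assms]] by (meson BseqE)
  then show ?thesis
    by (rule strong_limI) (intro tendsto_intros assms)
qed

lemma strong_lim_Suc: "strong_lim X L \<Longrightarrow> strong_lim (\<lambda>n. X (Suc n)) L"
  unfolding strong_lim_def using LIMSEQ_Suc by blast

lemma strong_lim_exists:
  fixes X :: "nat \<Rightarrow> 'a::real_normed_vector \<Rightarrow>\<^sub>L 'b::{real_normed_vector,complete_space}"
  assumes K: "\<And>n. norm (X n) \<le> K" and C: "\<And>x. Cauchy (\<lambda>n. X n x)"
  shows "\<exists>L. strong_lim X L \<and> norm L \<le> K"
proof -
  have "\<exists>l. (\<lambda>n. X n x) \<longlonglongrightarrow> l" for x
    using C[of x] Cauchy_convergent_iff convergent_def by metis
  then obtain L where L: "\<And>x. (\<lambda>n. X n x) \<longlonglongrightarrow> L x" by metis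
  have nL: "norm (L x) \<le> norm x * K" for x
  proof (rule LIMSEQ_le_const2[OF tendsto_norm[OF L]], intro exI allI impI)
    fix n show "norm (X n x) \<le> norm x * K"
      using mult_right_mono[OF K[of n] norm_ge_zero[of x]] norm_blinfun[of "X n" x]
      by (simp add: mult.commute)
  qed
  have "bounded_linear L"
  proof (rule bounded_linear_intro[OF _ _ nL])
    fix x y :: 'a and r :: real
    show "L (x + y) = L x + L y"
      by (rule LIMSEQ_unique[OF L]) (simp add: blinfun.add_right tendsto_add[OF L L])
    show "L (r *\<^sub>R x) = r *\<^sub>R L x"
      by (rule LIMSEQ_unique[OF L]) (simp add: blinfun.scaleR_right tendsto_scaleR[OF tendsto_const L])
  qed
  then have B: "blinfun_apply (Blinfun L) = L" by (rule bounded_linear_Blinfun_apply)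
  have "strong_lim X (Blinfun L)" by (rule strong_limI[OF K]) (simp add: B L)
  moreover have "norm (Blinfun L) \<le> K"
    using nL order.trans[OF norm_ge_zero K[of 0]] B by (intro norm_blinfun_bound) (auto simp: mult.commute)
  ultimately show ?thesis by blast
qed

text \<open>Strong convergence does not pass to adjoints, so both limits are assumed; inner products
  then identify them.\<close>

lemma strong_lim_adj_eq:
  fixes X :: "nat \<Rightarrow> 'h::{real_inner,complete_space} \<Rightarrow>\<^sub>L 'h"
  assumes "strong_lim X L" "strong_lim (\<lambda>n. adj (X n)) L'"
  shows "adj L = L'"
proof (rule adj_eqI)
  fix x y
  have "(\<lambda>n. inner (X n x) y) \<longlonglongrightarrow> inner (L x) y"
    by (intro tendsto_intros strong_limD assms)
  moreover have "(\<lambda>n. inner (X n x) y) \<longlonglongrightarrow> inner x (L' y)"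
    unfolding inner_adj by (intro tendsto_intros strong_limD assms)
  ultimately show "inner (L x) y = inner x (L' y)" by (rule LIMSEQ_unique)
qed

lemma strong_lim_selfadjoint:
  assumes "strong_lim X L" "\<And>n. adj (X n) = X n"
  shows "adj L = L"
  using strong_lim_adj_eq[OF assms(1), of L] assms by simp

text \<open>Pairs of operators are used because the functional calculi of two operators have to be
  compared. Applied to \<open>{(X, Y). X \<in> M}\<close>, statements about such sets become statements about
  a single strongly closed algebra.\<close>

definition strong_pair_algebra :: "(('h::real_normed_vector \<Rightarrow>\<^sub>L 'h) \<times> ('h \<Rightarrow>\<^sub>L 'h)) set \<Rightarrow> bool" where
  "strong_pair_algebra G \<longleftrightarrow> (id_blinfun, id_blinfun) \<in> G \<and>
    (\<forall>X Y X' Y'. (X, Y) \<in> G \<longrightarrow> (X', Y') \<in> G \<longrightarrow> (X + X', Y + Y') \<in> G \<and> (X o\<^sub>L X', Y o\<^sub>L Y') \<in> G) \<and>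
    (\<forall>X Y. \<forall>c::real. (X, Y) \<in> G \<longrightarrow> (c *\<^sub>R X, c *\<^sub>R Y) \<in> G) \<and>
    (\<forall>X Y L M. (\<forall>n. (X n, Y n) \<in> G) \<longrightarrow> strong_lim X L \<longrightarrow> strong_lim Y M \<longrightarrow> (L, M) \<in> G)"

context
  fixes G :: "(('h::real_normed_vector \<Rightarrow>\<^sub>L 'h) \<times> ('h \<Rightarrow>\<^sub>L 'h)) set"
  assumes G: "strong_pair_algebra G"
begin

lemma spa_id: "(id_blinfun, id_blinfun) \<in> G"
  using G unfolding strong_pair_algebra_def by blast

lemma spa_add: "(X, Y) \<in> G \<Longrightarrow> (X', Y') \<in> G \<Longrightarrow> (X + X', Y + Y') \<in> G"
  using G unfolding strong_pair_algebra_def by blast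

lemma spa_compose: "(X, Y) \<in> G \<Longrightarrow> (X', Y') \<in> G \<Longrightarrow> (X o\<^sub>L X', Y o\<^sub>L Y') \<in> G"
  using G unfolding strong_pair_algebra_def by blast

lemma spa_scaleR: "(X, Y) \<in> G \<Longrightarrow> (c *\<^sub>R X, c *\<^sub>R Y) \<in> G"
  using G unfolding strong_pair_algebra_def by blast

lemma spa_lim: "(\<And>n. (X n, Y n) \<in> G) \<Longrightarrow> strong_lim X L \<Longrightarrow> strong_lim Y M \<Longrightarrow> (L, M) \<in> G"
  using G unfolding strong_pair_algebra_def by blast

lemma spa_diff: "(X, Y) \<in> G \<Longrightarrow> (X', Y') \<in> G \<Longrightarrow> (X - X', Y - Y') \<in> G"
  using spa_add[of X Y "- X'" "- Y'"] spa_scaleR[of X' Y' "-1"] by simp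

lemma spa_zero: "(0, 0) \<in> G"
  using spa_scaleR[OF spa_id, of 0] by simp

lemma spa_sum: "(\<And>i. i \<in> I \<Longrightarrow> (X i, Y i) \<in> G) \<Longrightarrow> (sum X I, sum Y I) \<in> G"
  by (induction I rule: infinite_finite_induct) (simp_all add: spa_zero spa_add)

end

lemma blinfun_eq_iff: "S = T \<longleftrightarrow> (\<forall>x. blinfun_apply S x = blinfun_apply T x)"
  using blinfun_eqI by blast

lemma compose_add_left: "(S + T) o\<^sub>L U = (S o\<^sub>L U) + (T o\<^sub>L U)"
  and compose_add_right: "U o\<^sub>L (S + T) = (U o\<^sub>L S) + (U o\<^sub>L T)"
  and compose_diff_left: "(S - T) o\<^sub>L U = (S o\<^sub>L U) - (T o\<^sub>L U)"
  and compose_diff_right: "U o\<^sub>L (S - T) = (U o\<^sub>L S) - (U o\<^sub>L T)"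
  and compose_scaleR_left: "(c *\<^sub>R S) o\<^sub>L U = c *\<^sub>R (S o\<^sub>L U)"
  and compose_scaleR_right: "U o\<^sub>L (c *\<^sub>R S) = c *\<^sub>R (U o\<^sub>L S)"
  by (simp_all add: blinfun_eq_iff blinfun.bilinear_simps)

lemma compose_assoc: "(S o\<^sub>L T) o\<^sub>L U = S o\<^sub>L (T o\<^sub>L U)"
  and compose_id_left [simp]: "id_blinfun o\<^sub>L S' = S'"
  and compose_id_right [simp]: "S' o\<^sub>L id_blinfun = S'"
  by (simp_all add: blinfun_eq_iff)

lemma compose_sum_left: "sum S I o\<^sub>L U = (\<Sum>i\<in>I. S i o\<^sub>L U)"
  and compose_sum_right: "U o\<^sub>L sum S' I = (\<Sum>i\<in>I. U o\<^sub>L S' i)"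
  by (simp_all add: blinfun_eq_iff blinfun.sum_left blinfun.sum_right)

lemmas compose_distribs = compose_add_left compose_add_right compose_diff_left compose_diff_right
  compose_scaleR_left compose_scaleR_right

text \<open>The second component is a dummy. With this instance every closure lemma for pair
  algebras becomes a statement that a derived operator still commutes with \<open>S\<close>.\<close>

lemma strong_pair_algebra_commute:
  fixes S :: "'h::real_normed_vector \<Rightarrow>\<^sub>L 'h"
  shows "strong_pair_algebra {(X, Y). X o\<^sub>L S = S o\<^sub>L X}"
proof -
  have "L o\<^sub>L S = S o\<^sub>L L" if "\<And>n. X n o\<^sub>L S = S o\<^sub>L X n" "strong_lim X L" for X L
    using strong_lim_unique[OF strong_lim_compose[OF that(2) strong_lim_const[of S]]]
      strong_lim_compose[OF strong_lim_const[of S] that(2)] that(1) by simp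
  moreover have "(X o\<^sub>L X') o\<^sub>L S = S o\<^sub>L (X o\<^sub>L X')"
    if "X o\<^sub>L S = S o\<^sub>L X" "X' o\<^sub>L S = S o\<^sub>L X'" for X X'
    using that by (metis compose_assoc)
  ultimately show ?thesis
    unfolding strong_pair_algebra_def by (auto simp: compose_distribs)
qed

lemma opow_0 [simp]: "opow A 0 = id_blinfun"
  and opow_Suc [simp]: "opow A (Suc n) = A o\<^sub>L opow A n"
  by (simp_all add: opow_def)

lemma spa_opow: "strong_pair_algebra G \<Longrightarrow> (X, Y) \<in> G \<Longrightarrow> (opow X n, opow Y n) \<in> G"
  by (induction n) (auto intro: spa_id spa_compose)

lemma opow_add: "opow A (m + n) = opow A m o\<^sub>L opow A n"
  by (induction m) (simp_all add: compose_assoc)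

lemma norm_opow_le: "norm (A::'h::{real_inner,complete_space} \<Rightarrow>\<^sub>L 'h) \<le> R \<Longrightarrow> norm (opow A n) \<le> R ^ n"
proof (induction n)
  case 0
  then show ?case by (simp add: norm_blinfun_id_le)
next
  case (Suc n)
  then show ?case
    by (simp, intro order.trans[OF norm_blinfun_compose] mult_mono) (auto intro: order.trans[OF norm_ge_zero])
qed

lemma adj_opow: "adj A = A \<Longrightarrow> adj (opow A n) = opow A n"
proof (induction n)
  case (Suc n)
  moreover have "A o\<^sub>L opow A n = opow A n o\<^sub>L A"
    using opow_add[of A n 1] opow_add[of A 1 n] by (simp add: add.commute)
  ultimately show ?case by (simp add: adj_compose)
qed simp

lemma norm_apply_le: "norm T \<le> 1 \<Longrightarrow> norm (blinfun_apply T x) \<le> norm x"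
  using norm_blinfun[of T x] mult_right_mono[of "norm T" 1 "norm x"] by simp

section \<open>Square roots and polar decomposition\<close>

text \<open>Picard iteration for \<open>Y = (X + Y\<^sup>2) / 2\<close>, i.e. \<open>(1 - Y)\<^sup>2 = 1 - X\<close>; the scalar sequence
  with \<open>X = 1\<close> dominates it.\<close>

fun sqrt_iter :: "('h::real_normed_vector \<Rightarrow>\<^sub>L 'h) \<Rightarrow> nat \<Rightarrow> ('h \<Rightarrow>\<^sub>L 'h)" where
  "sqrt_iter X 0 = 0"
| "sqrt_iter X (Suc n) = (1/2) *\<^sub>R (X + (sqrt_iter X n o\<^sub>L sqrt_iter X n))"

fun sqrt_majorant :: "nat \<Rightarrow> real" where
  "sqrt_majorant 0 = 0"
| "sqrt_majorant (Suc n) = (1 + (sqrt_majorant n)\<^sup>2) / 2"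

lemma sqrt_majorant_bounds: "0 \<le> sqrt_majorant n \<and> sqrt_majorant n \<le> 1"
  by (induction n) (auto simp: power_le_one)

lemma sqrt_majorant_mono: "m \<le> n \<Longrightarrow> sqrt_majorant m \<le> sqrt_majorant n"
proof (rule lift_Suc_mono_le[of sqrt_majorant])
  fix n
  have "(1 - sqrt_majorant n)\<^sup>2 \<ge> 0" by simp
  then show "sqrt_majorant n \<le> sqrt_majorant (Suc n)" by (simp add: power2_eq_square algebra_simps)
qed

lemma convergent_sqrt_majorant: "convergent sqrt_majorant"
  by (intro Bseq_monoseq_convergent BseqI'[where K = 1] incseq_imp_monoseq)
    (use sqrt_majorant_bounds in \<open>auto simp: incseq_def sqrt_majorant_mono\<close>)

context
  fixes X :: "'h::{real_inner,complete_space} \<Rightarrow>\<^sub>L 'h"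
  assumes X: "norm X \<le> 1"
begin

lemma norm_sqrt_iter: "norm (sqrt_iter X n) \<le> sqrt_majorant n"
proof (induction n)
  case (Suc n)
  have "norm (sqrt_iter X n o\<^sub>L sqrt_iter X n) \<le> sqrt_majorant n * sqrt_majorant n"
    using Suc sqrt_majorant_bounds[of n] by (intro order.trans[OF norm_blinfun_compose] mult_mono) auto
  then have "norm (X + (sqrt_iter X n o\<^sub>L sqrt_iter X n)) \<le> 1 + (sqrt_majorant n)\<^sup>2"
    using X by (intro order.trans[OF norm_triangle_ineq]) (simp add: power2_eq_square)
  then show ?case by simp
qed simp

text \<open>When \<open>norm X = 1\<close> the iteration is not a uniform contraction, so no
  geometric rate is at hand. The identity Y' Y' - Y Y = Y' (Y' - Y) + (Y' - Y) Y, valid without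
  commutativity, bounds each increment by the scalar increment, and those telescope to a bounded
  sum.\<close>

lemma norm_sqrt_iter_step:
  "norm (sqrt_iter X (Suc n) - sqrt_iter X n) \<le> sqrt_majorant (Suc n) - sqrt_majorant n"
proof (induction n)
  case 0
  then show ?case using X by simp
next
  case (Suc n)
  let ?Y = "sqrt_iter X" and ?y = sqrt_majorant
  let ?D = "?Y (Suc n) - ?Y n" and ?d = "?y (Suc n) - ?y n"
  have "?Y (Suc (Suc n)) - ?Y (Suc n) =
      (1/2) *\<^sub>R ((?Y (Suc n) o\<^sub>L ?Y (Suc n)) - (?Y n o\<^sub>L ?Y n))"
    by (simp only: sqrt_iter.simps(2)[of X "Suc n"] sqrt_iter.simps(2)[of X n, symmetric])
      (simp only: sqrt_iter.simps scaleR_diff_right[symmetric] add_diff_cancel_left)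
  also have "(?Y (Suc n) o\<^sub>L ?Y (Suc n)) - (?Y n o\<^sub>L ?Y n) = (?Y (Suc n) o\<^sub>L ?D) + (?D o\<^sub>L ?Y n)"
    by (simp only: compose_distribs) simp
  also have "norm ((1/2) *\<^sub>R \<dots>) \<le> (1/2) * (?y (Suc n) * ?d + ?d * ?y n)"
  proof -
    have "norm (?Y (Suc n) o\<^sub>L ?D) \<le> ?y (Suc n) * ?d"
      by (intro order.trans[OF norm_blinfun_compose] mult_mono norm_sqrt_iter Suc)
        (use sqrt_majorant_bounds in auto)
    moreover have "norm (?D o\<^sub>L ?Y n) \<le> ?d * ?y n"
      using order.trans[OF norm_ge_zero Suc]
      by (intro order.trans[OF norm_blinfun_compose] mult_mono norm_sqrt_iter Suc)
        (use sqrt_majorant_bounds in auto)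
    ultimately show ?thesis
      using norm_triangle_ineq[of "?Y (Suc n) o\<^sub>L ?D" "?D o\<^sub>L ?Y n"] by simp
  qed
  also have "\<dots> = (1/2) * ((?y (Suc n))\<^sup>2 - (?y n)\<^sup>2)"
    by (simp add: power2_eq_square algebra_simps del: sqrt_majorant.simps)
  also have "\<dots> = ?y (Suc (Suc n)) - ?y (Suc n)"
    by (simp only: sqrt_majorant.simps(2)[of "Suc n"] sqrt_majorant.simps(2)[of n]) argo
  finally show ?case .
qed

lemma norm_sqrt_iter_diff:
  "m \<le> n \<Longrightarrow> norm (sqrt_iter X n - sqrt_iter X m) \<le> sqrt_majorant n - sqrt_majorant m"
proof (induction n rule: dec_induct)
  case (step n)
  have "norm (sqrt_iter X (Suc n) - sqrt_iter X m)
      \<le> norm (sqrt_iter X (Suc n) - sqrt_iter X n) + norm (sqrt_iter X n - sqrt_iter X m)"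
    using norm_triangle_ineq[of "sqrt_iter X (Suc n) - sqrt_iter X n" "sqrt_iter X n - sqrt_iter X m"] by simp
  with step norm_sqrt_iter_step[of n] show ?case by linarith
qed simp

lemma sqrt_iter_strong_lim: "\<exists>Y. strong_lim (sqrt_iter X) Y \<and> norm Y \<le> 1"
proof (rule strong_lim_exists)
  show "norm (sqrt_iter X n) \<le> 1" for n
    using norm_sqrt_iter[of n] sqrt_majorant_bounds[of n] by linarith
  fix x :: 'h
  show "Cauchy (\<lambda>n. sqrt_iter X n x)"
  proof (rule metric_CauchyI)
    fix e :: real assume "e > 0"
    \<comment> \<open>The added 1 keeps the divisor positive for \<open>x = 0\<close>.\<close>
    then have e: "e / (norm x + 1) > 0" by (simp add: add_nonneg_pos)
    obtain N where N: "\<And>m n. m \<ge> N \<Longrightarrow> n \<ge> N \<Longrightarrow> dist (sqrt_majorant m) (sqrt_majorant n) < e / (norm x + 1)"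
      using metric_CauchyD[OF convergent_Cauchy[OF convergent_sqrt_majorant] e] by blast
    have *: "norm (sqrt_iter X n x - sqrt_iter X m x) < e" if "m \<ge> N" "n \<ge> m" for m n
    proof -
      have "norm (sqrt_iter X n x - sqrt_iter X m x) \<le> norm (sqrt_iter X n - sqrt_iter X m) * norm x"
        using norm_blinfun[of "sqrt_iter X n - sqrt_iter X m" x] by (simp add: blinfun.diff_left)
      also have "\<dots> \<le> (sqrt_majorant n - sqrt_majorant m) * norm x"
        by (intro mult_right_mono norm_sqrt_iter_diff that) simp
      also have "\<dots> \<le> (sqrt_majorant n - sqrt_majorant m) * (norm x + 1)"
        using sqrt_majorant_mono[OF that(2)] by (intro mult_left_mono) auto
      also have "\<dots> < e"
        using N[of n m] that sqrt_majorant_mono[OF that(2)]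
        by (simp add: dist_real_def pos_less_divide_eq add_nonneg_pos)
      finally show ?thesis .
    qed
    have "dist (sqrt_iter X m x) (sqrt_iter X n x) < e" if "m \<ge> N" "n \<ge> N" for m n
      using *[of m n] *[of n m] that by (cases "m \<le> n") (auto simp: dist_norm norm_minus_commute)
    then show "\<exists>N. \<forall>m\<ge>N. \<forall>n\<ge>N. dist (sqrt_iter X m x) (sqrt_iter X n x) < e" by blast
  qed
qed

end

definition op_sqrt :: "('h::{real_inner,complete_space} \<Rightarrow>\<^sub>L 'h) \<Rightarrow> ('h \<Rightarrow>\<^sub>L 'h)" where
  "op_sqrt P = id_blinfun - (THE Y. strong_lim (sqrt_iter (id_blinfun - P)) Y)"

context
  fixes P :: "'h::{real_inner,complete_space} \<Rightarrow>\<^sub>L 'h"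
  assumes P: "norm (id_blinfun - P) \<le> 1"
begin

lemma op_sqrt_lim: "strong_lim (sqrt_iter (id_blinfun - P)) (id_blinfun - op_sqrt P)"
  and norm_id_minus_op_sqrt: "norm (id_blinfun - op_sqrt P) \<le> 1"
proof -
  obtain Y where Y: "strong_lim (sqrt_iter (id_blinfun - P)) Y" "norm Y \<le> 1"
    using sqrt_iter_strong_lim[OF P] by blast
  then have "(THE Y. strong_lim (sqrt_iter (id_blinfun - P)) Y) = Y"
    by (intro the_equality strong_lim_unique[of "sqrt_iter (id_blinfun - P)"])
  then have "id_blinfun - op_sqrt P = Y" by (simp add: op_sqrt_def)
  with Y show "strong_lim (sqrt_iter (id_blinfun - P)) (id_blinfun - op_sqrt P)"
    "norm (id_blinfun - op_sqrt P) \<le> 1" by simp_all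
qed

lemma op_sqrt_square: "op_sqrt P o\<^sub>L op_sqrt P = P"
proof -
  define Y where "Y = id_blinfun - op_sqrt P"
  have "strong_lim (\<lambda>n. (1/2) *\<^sub>R ((id_blinfun - P) +
      (sqrt_iter (id_blinfun - P) n o\<^sub>L sqrt_iter (id_blinfun - P) n)))
      ((1/2) *\<^sub>R ((id_blinfun - P) + (Y o\<^sub>L Y)))"
    unfolding Y_def by (intro strong_lim_scaleR strong_lim_add strong_lim_const strong_lim_compose op_sqrt_lim)
  then have "strong_lim (\<lambda>n. sqrt_iter (id_blinfun - P) (Suc n)) ((1/2) *\<^sub>R ((id_blinfun - P) + (Y o\<^sub>L Y)))"
    by simp
  then have "Y = (1/2) *\<^sub>R ((id_blinfun - P) + (Y o\<^sub>L Y))"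
    using strong_lim_unique[OF strong_lim_Suc[OF op_sqrt_lim]] unfolding Y_def by blast
  then have "2 *\<^sub>R Y = (id_blinfun - P) + (Y o\<^sub>L Y)"
    by (metis scaleR_half_double scaleR_left.add scaleR_scaleR one_add_one scaleR_one nonzero_mult_div_cancel_left times_divide_eq_right zero_neq_numeral mult.right_neutral)
  then have "Y o\<^sub>L Y = Y + Y - (id_blinfun - P)" by (simp add: scaleR_2)
  moreover have "op_sqrt P = id_blinfun - Y" by (simp add: Y_def)
  ultimately show ?thesis by (simp add: compose_distribs)
qed

lemma op_sqrt_selfadjoint:
  assumes "adj P = P"
  shows "adj (op_sqrt P) = op_sqrt P"
proof -
  have "adj (sqrt_iter (id_blinfun - P) n) = sqrt_iter (id_blinfun - P) n" for n
    by (induction n) (simp_all add: adj_scaleR adj_add adj_diff adj_compose assms)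
  from strong_lim_selfadjoint[OF op_sqrt_lim this] show ?thesis by (simp add: adj_diff)
qed

text \<open>Positivity comes from the norm alone: an operator within distance 1 of the identity has
  a nonnegative real quadratic form, by Cauchy-Schwarz.\<close>

lemma inner_op_sqrt_nonneg: "inner (op_sqrt P x) x \<ge> 0"
proof -
  have "inner ((id_blinfun - op_sqrt P) x) x \<le> norm ((id_blinfun - op_sqrt P) x) * norm x"
    by (rule norm_cauchy_schwarz)
  also have "\<dots> \<le> norm x * norm x"
    by (intro mult_right_mono norm_apply_le norm_id_minus_op_sqrt) simp
  finally show ?thesis
    by (simp add: blinfun.diff_left inner_diff_left power2_norm_eq_inner[symmetric] power2_eq_square)
qed

end

lemma spa_sqrt_iter: "strong_pair_algebra G \<Longrightarrow> (X, Y) \<in> G \<Longrightarrow> (sqrt_iter X n, sqrt_iter Y n) \<in> G"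
  by (induction n) (auto intro: spa_zero spa_compose spa_add spa_scaleR)

lemma spa_op_sqrt:
  assumes G: "strong_pair_algebra G" and "(P, Q) \<in> G"
    and "norm (id_blinfun - P) \<le> 1" "norm (id_blinfun - Q) \<le> 1"
  shows "(op_sqrt P, op_sqrt Q) \<in> G"
proof -
  have "(id_blinfun - P, id_blinfun - Q) \<in> G" using assms spa_id spa_diff by blast
  then have "(id_blinfun - op_sqrt P, id_blinfun - op_sqrt Q) \<in> G"
    using assms by (intro spa_lim[OF G spa_sqrt_iter[OF G] op_sqrt_lim op_sqrt_lim])
  from spa_diff[OF G spa_id[OF G] this] show ?thesis by simp
qed

definition op_abs :: "('h::{real_inner,complete_space} \<Rightarrow>\<^sub>L 'h) \<Rightarrow> ('h \<Rightarrow>\<^sub>L 'h)" where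
  "op_abs T = op_sqrt (adj T o\<^sub>L T)"

text \<open>Expanding the square gives |x|^2 - 2 |T x|^2 + |T* T x|^2, and the last term is at most
  |T x|^2. This makes T* T an admissible argument of \<open>op_sqrt\<close>.\<close>

lemma norm_id_minus_adj_compose_self:
  fixes T :: "'h::{real_inner,complete_space} \<Rightarrow>\<^sub>L 'h"
  assumes T: "norm T \<le> 1"
  shows "norm (id_blinfun - (adj T o\<^sub>L T)) \<le> 1"
proof (rule norm_blinfun_bound)
  fix x
  have "norm (adj T (T x)) \<le> norm (T x)" using T by (intro norm_apply_le) (simp add: norm_adj)
  then have "(norm (adj T (T x)))\<^sup>2 \<le> (norm (T x))\<^sup>2" by simp
  then have "(norm (adj T (T x)))\<^sup>2 \<le> (norm (T x))\<^sup>2" by simp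
  moreover have "inner (adj T (T x)) x = (norm (T x))\<^sup>2" "inner x (adj T (T x)) = (norm (T x))\<^sup>2"
    by (simp_all add: inner_adj'[symmetric] inner_adj[symmetric] power2_norm_eq_inner)
  ultimately have "(norm (x - adj T (T x)))\<^sup>2 \<le> (norm x)\<^sup>2"
    by (simp add: power2_norm_eq_inner inner_diff_left inner_diff_right,
        use inner_ge_zero[of "T x"] in linarith)
  then show "norm ((id_blinfun - (adj T o\<^sub>L T)) x) \<le> 1 * norm x"
    by (simp add: blinfun.diff_left)
qed simp

context
  fixes T :: "'h::{real_inner,complete_space} \<Rightarrow>\<^sub>L 'h"
  assumes T: "norm T \<le> 1"
begin

lemma op_abs_square: "op_abs T o\<^sub>L op_abs T = adj T o\<^sub>L T"
  unfolding op_abs_def by (rule op_sqrt_square[OF norm_id_minus_adj_compose_self[OF T]])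

lemma op_abs_selfadjoint: "adj (op_abs T) = op_abs T"
  unfolding op_abs_def
  by (rule op_sqrt_selfadjoint[OF norm_id_minus_adj_compose_self[OF T]]) (simp add: adj_compose)

lemma norm_op_abs_apply: "norm (op_abs T x) = norm (T x)"
proof -
  have "inner (op_abs T x) (op_abs T x) = inner x ((op_abs T o\<^sub>L op_abs T) x)"
    by (simp add: inner_adj op_abs_selfadjoint)
  also have "\<dots> = inner (T x) (T x)" by (simp add: op_abs_square inner_adj)
  finally show ?thesis by (simp add: norm_eq_sqrt_inner)
qed

lemma norm_op_abs_le: "norm (op_abs T) \<le> 1"
  by (rule norm_blinfun_bound) (simp_all add: norm_op_abs_apply norm_apply_le T)

end

lemma inner_opow:
  assumes "adj D = D"
  shows "inner (opow D m x) (opow D n y) = inner x (opow D (m + n) y)"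
  by (simp add: inner_adj adj_opow[OF assms] opow_add)

text \<open>For a selfadjoint contraction \<open>D\<close> the even powers converge strongly to the projection onto
  the fixed space of \<open>D\<^sup>2\<close>.\<close>

definition fix_proj :: "('h::{real_inner,complete_space} \<Rightarrow>\<^sub>L 'h) \<Rightarrow> ('h \<Rightarrow>\<^sub>L 'h)" where
  "fix_proj D = (THE E. strong_lim (\<lambda>n. opow D (2 * n)) E)"

context
  fixes D :: "'h::{real_inner,complete_space} \<Rightarrow>\<^sub>L 'h"
  assumes D: "adj D = D" and nD: "norm D \<le> 1"
begin

text \<open>Self-adjointness turns the mixed term into the square of the norm of
  \<open>opow D (m + n) x\<close>. Hence the powers of even order are Cauchy as soon as the
  decreasing numbers |D^k x|^2 are. Even orders are essential: an eigenvalue -1 would make the full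
  sequence of powers oscillate.\<close>

lemma norm_opow_diff:
  "(norm (opow D (2 * m) x - opow D (2 * n) x))\<^sup>2 =
    (norm (opow D (2 * m) x))\<^sup>2 - 2 * (norm (opow D (m + n) x))\<^sup>2 + (norm (opow D (2 * n) x))\<^sup>2"
proof -
  have e: "2 * m + 2 * n = (m + n) + (m + n)" "2 * n + 2 * m = (m + n) + (m + n)" by simp_all
  have "inner (opow D (2 * m) x) (opow D (2 * n) x) = inner (opow D (m + n) x) (opow D (m + n) x)"
    "inner (opow D (2 * n) x) (opow D (2 * m) x) = inner (opow D (m + n) x) (opow D (m + n) x)"
    unfolding inner_opow[OF D] e by simp_all
  then show ?thesis unfolding power2_norm_eq_inner by (simp add: inner_diff_left inner_diff_right)
qed

lemma fix_proj_lim: "strong_lim (\<lambda>n. opow D (2 * n)) (fix_proj D)"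
proof -
  have "\<exists>E. strong_lim (\<lambda>n. opow D (2 * n)) E \<and> norm E \<le> 1"
  proof (rule strong_lim_exists)
    show "norm (opow D (2 * n)) \<le> 1" for n using norm_opow_le[OF nD, of "2 * n"] by simp
    fix x :: 'h
    define a where "a k = (norm (opow D k x))\<^sup>2" for k
    have "a (Suc k) \<le> a k" for k using norm_apply_le[OF nD, of "opow D k x"] by (simp add: a_def)
    then have "decseq a" by (rule decseq_SucI)
    moreover have "Bseq a"
      by (rule decseq_bounded[OF \<open>decseq a\<close>, where B = 0]) (simp add: a_def)
    ultimately have "Cauchy a"
      by (intro convergent_Cauchy Bseq_monoseq_convergent decseq_imp_monoseq)
    show "Cauchy (\<lambda>n. opow D (2 * n) x)"
    proof (rule metric_CauchyI)
      fix e :: real assume e: "e > 0"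
      then obtain N where N: "\<And>m n. m \<ge> N \<Longrightarrow> n \<ge> N \<Longrightarrow> dist (a m) (a n) < e\<^sup>2 / 2"
        using metric_CauchyD[OF \<open>Cauchy a\<close>, of "e\<^sup>2 / 2"] by auto
      have "dist (opow D (2 * m) x) (opow D (2 * n) x) < e" if "m \<ge> N" "n \<ge> N" for m n
      proof -
        have "\<bar>a (2 * m) - a (m + n)\<bar> < e\<^sup>2 / 2" "\<bar>a (2 * n) - a (m + n)\<bar> < e\<^sup>2 / 2"
          using N[of "2 * m" "m + n"] N[of "2 * n" "m + n"] that by (auto simp: dist_real_def)
        then have "(norm (opow D (2 * m) x - opow D (2 * n) x))\<^sup>2 < e\<^sup>2"
          unfolding norm_opow_diff a_def by argo
        then show ?thesis using e by (simp add: dist_norm power2_less_imp_less)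
      qed
      then show "\<exists>N. \<forall>m\<ge>N. \<forall>n\<ge>N. dist (opow D (2 * m) x) (opow D (2 * n) x) < e" by blast
    qed
  qed
  then obtain E where E: "strong_lim (\<lambda>n. opow D (2 * n)) E" by blast
  show ?thesis unfolding fix_proj_def by (rule theI[of _ E], rule E, rule strong_lim_unique[OF _ E])
qed

lemma fix_proj_selfadjoint: "adj (fix_proj D) = fix_proj D"
  by (rule strong_lim_selfadjoint[OF fix_proj_lim]) (rule adj_opow[OF D])

lemma fix_proj_absorb: "D o\<^sub>L (D o\<^sub>L fix_proj D) = fix_proj D"
proof -
  have "strong_lim (\<lambda>n. D o\<^sub>L (D o\<^sub>L opow D (2 * n))) (D o\<^sub>L (D o\<^sub>L fix_proj D))"
    by (intro strong_lim_compose strong_lim_const fix_proj_lim)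
  then have "strong_lim (\<lambda>n. opow D (2 * Suc n)) (D o\<^sub>L (D o\<^sub>L fix_proj D))" by simp
  then show ?thesis
    using strong_lim_unique strong_lim_Suc[OF fix_proj_lim] by blast
qed

lemma fix_proj_fixed:
  assumes "D (D x) = x"
  shows "fix_proj D x = x"
proof -
  have "opow D (2 * n) x = x" for n by (induction n) (simp_all add: assms)
  then show ?thesis using strong_limD[OF fix_proj_lim, of x] by (simp add: LIMSEQ_const_iff)
qed

lemma fix_proj_idem: "fix_proj D o\<^sub>L fix_proj D = fix_proj D"
proof (rule blinfun_eqI)
  fix x
  have "D (D (fix_proj D x)) = fix_proj D x"
    using fix_proj_absorb by (metis blinfun_apply_blinfun_compose)
  then show "(fix_proj D o\<^sub>L fix_proj D) x = fix_proj D x" by (simp add: fix_proj_fixed)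
qed

text \<open>Fixed vectors of D^2 could come from the eigenvalues 1 and -1; positivity excludes -1,
  and \<open>D x - x\<close> would be an eigenvector for it.\<close>

lemma fix_proj_iff:
  assumes pos: "\<And>x. inner (D x) x \<ge> 0"
  shows "fix_proj D x = x \<longleftrightarrow> D x = x"
proof
  assume "fix_proj D x = x"
  then have "D (D x) = x" using fix_proj_absorb by (metis blinfun_apply_blinfun_compose)
  define v where "v = D x - x"
  have "D v = - v" using \<open>D (D x) = x\<close> by (simp add: v_def blinfun.diff_right)
  with pos[of v] have "inner v v \<le> 0" by simp
  then have "v = 0" by (metis inner_eq_zero_iff inner_ge_zero order.antisym)
  then show "D x = x" by (simp add: v_def)
qed (simp add: fix_proj_fixed)

end

lemma spa_fix_proj:
  assumes "strong_pair_algebra G" "(C, D) \<in> G" "adj C = C" "norm C \<le> 1" "adj D = D" "norm D \<le> 1"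
  shows "(fix_proj C, fix_proj D) \<in> G"
  by (rule spa_lim[OF assms(1) spa_opow[OF assms(1,2)] fix_proj_lim fix_proj_lim]) (rule assms)+

section \<open>Projections and polar decomposition\<close>

definition is_projection :: "('h::{real_inner,complete_space} \<Rightarrow>\<^sub>L 'h) \<Rightarrow> bool" where
  "is_projection P \<longleftrightarrow> adj P = P \<and> P o\<^sub>L P = P"

text \<open>\<open>W\<close> is the limit of \<open>T\<close> times approximate inverses of the
  absolute value H of \<open>T\<close>. The sequence converges because T and H have the same norm at
  every vector, so T k_n behaves like H k_n. The clause on \<open>G\<close> records that the
  approximate inverses arise from T* T alone, which later places \<open>W\<close> in the
  algebra.\<close>

lemma polar_decomposition:
  fixes T :: "'h::{real_inner,complete_space} \<Rightarrow>\<^sub>L 'h"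
  assumes T: "norm T \<le> 1"
  shows "\<exists>W k. strong_lim (\<lambda>n. T o\<^sub>L k n) W \<and>
    (\<forall>G. strong_pair_algebra G \<longrightarrow> (adj T o\<^sub>L T, adj T o\<^sub>L T) \<in> G \<longrightarrow> (\<forall>n. (k n, k n) \<in> G)) \<and>
    is_projection (adj W o\<^sub>L W) \<and> (\<forall>x. (adj W o\<^sub>L W) x = 0 \<longleftrightarrow> T x = 0)"
proof -
  define H where "H = op_abs T"
  define D where "D = id_blinfun - H"
  have nP: "norm (id_blinfun - (adj T o\<^sub>L T)) \<le> 1" by (rule norm_id_minus_adj_compose_self[OF T])
  have adjH: "adj H = H" unfolding H_def by (rule op_abs_selfadjoint[OF T])
  have adjD: "adj D = D" by (simp add: D_def adj_diff adjH)
  have nD: "norm D \<le> 1" unfolding D_def H_def op_abs_def by (rule norm_id_minus_op_sqrt[OF nP])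
  have posD: "inner (D x) x \<ge> 0" for x
  proof -
    have "inner (H x) x \<le> norm (H x) * norm x" by (rule norm_cauchy_schwarz)
    also have "\<dots> \<le> norm x * norm x"
      unfolding H_def by (intro mult_right_mono norm_apply_le norm_op_abs_le[OF T]) simp
    finally show ?thesis
      by (simp add: D_def blinfun.diff_left inner_diff_left power2_norm_eq_inner[symmetric] power2_eq_square)
  qed
  \<comment> \<open>Partial sums of the Neumann series of 1 - D, taken 2n terms at a time. Pairing
    D^(2j) with D^(2j+1) leaves the remainder \<open>opow D (2 * n)\<close>, whose strong limit is
    \<open>fix_proj D\<close>.\<close>
  define k where "k n = (id_blinfun + D) o\<^sub>L (\<Sum>j<n. opow D (2 * j))" for n
  have Hk: "H o\<^sub>L k n = id_blinfun - opow D (2 * n)" for n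
  proof (induction n)
    case (Suc n)
    have "k (Suc n) = k n + ((id_blinfun + D) o\<^sub>L opow D (2 * n))"
      by (simp add: k_def compose_distribs)
    moreover have "H o\<^sub>L ((id_blinfun + D) o\<^sub>L opow D (2 * n)) = opow D (2 * n) - opow D (2 * Suc n)"
    proof -
      have "H = id_blinfun - D" by (simp add: D_def)
      then show ?thesis by (simp add: compose_distribs)
    qed
    ultimately show ?case by (simp add: compose_distribs Suc)
  qed (simp add: k_def)
  have nT: "norm (T x) = norm (H x)" for x by (simp add: H_def norm_op_abs_apply[OF T])
  have "\<exists>W. strong_lim (\<lambda>n. T o\<^sub>L k n) W \<and> norm W \<le> 2"
  proof (rule strong_lim_exists)
    fix n
    show "norm (T o\<^sub>L k n) \<le> 2"
    proof (rule norm_blinfun_bound)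
      fix x
      have "norm ((T o\<^sub>L k n) x) = norm ((H o\<^sub>L k n) x)" by (simp add: nT)
      also have "\<dots> \<le> norm x + norm (opow D (2 * n) x)"
        unfolding Hk using norm_triangle_ineq4 by (auto simp: blinfun.diff_left)
      also have "norm (opow D (2 * n) x) \<le> norm x"
        using norm_opow_le[OF nD, of "2 * n"] by (intro norm_apply_le) simp
      finally show "norm ((T o\<^sub>L k n) x) \<le> 2 * norm x" by simp
    qed simp
  next
    fix x
    have "norm ((T o\<^sub>L k m) x - (T o\<^sub>L k n) x) = norm (opow D (2 * m) x - opow D (2 * n) x)" for m n
    proof -
      have "(T o\<^sub>L k m) x - (T o\<^sub>L k n) x = T (k m x - k n x)" by (simp add: blinfun.diff_right)
      then have "norm ((T o\<^sub>L k m) x - (T o\<^sub>L k n) x) = norm ((H o\<^sub>L k m) x - (H o\<^sub>L k n) x)"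
        by (simp only: nT) (simp add: blinfun.diff_right)
      then show ?thesis unfolding Hk by (simp add: blinfun.diff_left norm_minus_commute)
    qed
    moreover have "Cauchy (\<lambda>n. opow D (2 * n) x)"
      using strong_limD[OF fix_proj_lim[OF adjD nD]] by (rule LIMSEQ_imp_Cauchy)
    ultimately show "Cauchy (\<lambda>n. (T o\<^sub>L k n) x)"
      unfolding Cauchy_def dist_norm by simp
  qed
  then obtain W where W: "strong_lim (\<lambda>n. T o\<^sub>L k n) W" by blast
  define E where "E = fix_proj D"
  have E: "adj E = E" "E o\<^sub>L E = E"
    unfolding E_def by (rule fix_proj_selfadjoint[OF adjD nD], rule fix_proj_idem[OF adjD nD])
  have innerT: "inner (T x) (T y) = inner (H x) (H y)" for x y
  proof -
    have "inner (T x) (T y) = inner x ((adj T o\<^sub>L T) y)" by (simp add: inner_adj)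
    also have "\<dots> = inner (H x) (H y)"
      unfolding op_abs_square[OF T, folded H_def, symmetric] by (simp add: inner_adj adjH)
    finally show ?thesis .
  qed
  \<comment> \<open>Computed through inner products of values, since the adjoints of the
    approximants are not known to converge strongly.\<close>
  have "adj W o\<^sub>L W = id_blinfun - E"
  proof (rule blinfun_eqI, rule vector_eq_ldot[THEN iffD1], rule allI)
    fix x y
    have lim1: "(\<lambda>n. inner ((T o\<^sub>L k n) y) ((T o\<^sub>L k n) x)) \<longlonglongrightarrow> inner (W y) (W x)"
      by (intro tendsto_intros strong_limD W)
    have TH: "inner ((T o\<^sub>L k n) y) ((T o\<^sub>L k n) x) = inner ((H o\<^sub>L k n) y) ((H o\<^sub>L k n) x)" for n
      by (simp add: innerT)
    have lim2: "(\<lambda>n. inner ((H o\<^sub>L k n) y) ((H o\<^sub>L k n) x)) \<longlonglongrightarrow> inner ((id_blinfun - E) y) ((id_blinfun - E) x)"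
      unfolding Hk E_def
      by (intro tendsto_inner strong_limD strong_lim_diff strong_lim_const fix_proj_lim adjD nD)
    have "inner (W y) (W x) = inner ((id_blinfun - E) y) ((id_blinfun - E) x)"
      by (rule LIMSEQ_unique[OF lim1[unfolded TH] lim2])
    also have "\<dots> = inner y (((id_blinfun - E) o\<^sub>L (id_blinfun - E)) x)"
      by (simp add: inner_adj adj_diff E)
    also have "(id_blinfun - E) o\<^sub>L (id_blinfun - E) = id_blinfun - E"
      by (simp add: compose_distribs E)
    finally show "inner y ((adj W o\<^sub>L W) x) = inner y ((id_blinfun - E) x)"
      by (simp add: inner_adj)
  qed
  moreover have "is_projection (id_blinfun - E)"
    by (simp add: is_projection_def compose_distribs E adj_diff)
  moreover have "(id_blinfun - E) x = 0 \<longleftrightarrow> T x = 0" for x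
  proof -
    have "(id_blinfun - E) x = 0 \<longleftrightarrow> D x = x"
      using fix_proj_iff[OF adjD nD posD, of x] by (auto simp: blinfun.diff_left E_def)
    also have "\<dots> \<longleftrightarrow> norm (H x) = 0" by (auto simp: D_def blinfun.diff_left)
    finally show ?thesis by (simp add: nT[symmetric])
  qed
  moreover have "(k n, k n) \<in> G" if G: "strong_pair_algebra G" and TT: "(adj T o\<^sub>L T, adj T o\<^sub>L T) \<in> G" for G n
  proof -
    have "(H, H) \<in> G" unfolding H_def op_abs_def by (rule spa_op_sqrt[OF G TT nP nP])
    then have "(D, D) \<in> G" unfolding D_def by (intro spa_diff[OF G] spa_id[OF G])
    then show ?thesis unfolding k_def
      by (intro spa_compose[OF G] spa_add[OF G] spa_sum[OF G] spa_id[OF G] spa_opow[OF G])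
  qed
  ultimately show ?thesis using W by metis
qed

section \<open>Spectral projections\<close>

text \<open>Polarisation for a symmetric form: a bound on the quadratic form bounds the bilinear
  form, hence the operator.\<close>

lemma selfadjoint_norm_le:
  fixes S :: "'h::{real_inner,complete_space} \<Rightarrow>\<^sub>L 'h"
  assumes S: "adj S = S" and q: "\<And>x. \<bar>inner (S x) x\<bar> \<le> c * (norm x)\<^sup>2"
  shows "norm (S x) \<le> c * norm x"
proof (cases "x = 0 \<or> S x = 0")
  case True
  have "0 \<le> c * (norm x)\<^sup>2" using q[of x] by linarith
  then have "0 \<le> c * norm x" by (cases "x = 0") (auto simp: zero_le_mult_iff)
  with True show ?thesis by auto
next
  case False
  \<comment> \<open>\<open>y\<close> has the direction of \<open>S x\<close> and the length of
    \<open>x\<close>, so \<open>inner (S x) y\<close> is the product of the two norms and the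
    parallelogram sum is four times the square of \<open>norm x\<close>.\<close>
  define y where "y = (norm x / norm (S x)) *\<^sub>R S x"
  have ny: "norm y = norm x" using False by (simp add: y_def)
  have sym: "inner (S y) x = inner (S x) y" by (metis inner_adj S inner_commute)
  have "4 * inner (S x) y = inner (S (x + y)) (x + y) - inner (S (x - y)) (x - y)"
    by (simp add: blinfun.bilinear_simps inner_add_left inner_add_right inner_diff_left inner_diff_right sym)
  also have "\<dots> \<le> c * ((norm (x + y))\<^sup>2 + (norm (x - y))\<^sup>2)"
    using q[of "x + y"] q[of "x - y"] by (simp add: distrib_left)
  also have "(norm (x + y))\<^sup>2 + (norm (x - y))\<^sup>2 = 2 * (norm x)\<^sup>2 + 2 * (norm y)\<^sup>2"
    by (simp add: power2_norm_eq_inner inner_add_left inner_add_right inner_diff_left inner_diff_right)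
  finally have "inner (S x) y \<le> c * (norm x)\<^sup>2" by (simp add: ny)
  moreover have "inner (S x) y = norm x * norm (S x)"
    using False by (simp add: y_def power2_norm_eq_inner[symmetric] power2_eq_square)
  ultimately have "norm x * norm (S x) \<le> norm x * (c * norm x)"
    by (simp add: power2_eq_square mult_ac)
  with False show ?thesis by (simp add: mult_le_cancel_left)
qed

lemma is_projection_id: "is_projection id_blinfun"
  by (simp add: is_projection_def)

lemma is_projection_complement: "is_projection P \<Longrightarrow> is_projection (id_blinfun - P)"
  by (simp add: is_projection_def adj_diff compose_distribs)

lemma is_projection_compose:
  "is_projection P \<Longrightarrow> is_projection Q \<Longrightarrow> P o\<^sub>L Q = Q o\<^sub>L P \<Longrightarrow> is_projection (P o\<^sub>L Q)"
  unfolding is_projection_def by (metis adj_compose compose_assoc)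

lemma is_projection_idem: "is_projection P \<Longrightarrow> P (P x) = P x"
  unfolding is_projection_def by (metis blinfun_apply_blinfun_compose)

lemma norm_is_projection_le:
  assumes "is_projection P"
  shows "norm (P x) \<le> norm x"
proof -
  have "norm (P x) * norm (P x) = inner (P x) x"
    using assms is_projection_idem[OF assms, of x]
    by (metis inner_adj is_projection_def power2_eq_square power2_norm_eq_inner)
  also have "\<dots> \<le> norm (P x) * norm x" by (rule norm_cauchy_schwarz)
  finally show ?thesis by (cases "P x = 0") (auto simp: mult_le_cancel_left)
qed

definition pos_part :: "('h::{real_inner,complete_space} \<Rightarrow>\<^sub>L 'h) \<Rightarrow> ('h \<Rightarrow>\<^sub>L 'h)" where
  "pos_part A = (1/2) *\<^sub>R (op_abs A + A)"

text \<open>The projection onto the kernel of the positive part.\<close>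

definition neg_proj :: "('h::{real_inner,complete_space} \<Rightarrow>\<^sub>L 'h) \<Rightarrow> ('h \<Rightarrow>\<^sub>L 'h)" where
  "neg_proj A = fix_proj (id_blinfun - (pos_part A o\<^sub>L pos_part A))"

context
  fixes A :: "'h::{real_inner,complete_space} \<Rightarrow>\<^sub>L 'h"
  assumes A: "adj A = A" and nA: "norm A \<le> 1"
begin

lemma op_abs_commute: "op_abs A o\<^sub>L A = A o\<^sub>L op_abs A"
proof -
  have "(op_abs A, op_abs A) \<in> {(X, Y). X o\<^sub>L A = A o\<^sub>L X}"
    unfolding op_abs_def
    by (rule spa_op_sqrt[OF strong_pair_algebra_commute _ norm_id_minus_adj_compose_self[OF nA]
          norm_id_minus_adj_compose_self[OF nA]]) (simp add: A compose_assoc)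
  then show ?thesis by simp
qed

lemma pos_part_selfadjoint: "adj (pos_part A) = pos_part A"
  by (simp add: pos_part_def adj_scaleR adj_add op_abs_selfadjoint[OF nA] A)

lemma norm_pos_part_le: "norm (pos_part A) \<le> 1"
  using norm_triangle_ineq[of "op_abs A" A] norm_op_abs_le[OF nA] nA by (simp add: pos_part_def)

lemma neg_proj_generator:
  "adj (id_blinfun - (pos_part A o\<^sub>L pos_part A)) = id_blinfun - (pos_part A o\<^sub>L pos_part A)"
  "norm (id_blinfun - (pos_part A o\<^sub>L pos_part A)) \<le> 1"
  using norm_id_minus_adj_compose_self[OF norm_pos_part_le]
  by (simp_all add: adj_diff adj_compose pos_part_selfadjoint)

lemma neg_proj_is_projection: "is_projection (neg_proj A)"
  unfolding neg_proj_def is_projection_def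
  using fix_proj_selfadjoint[OF neg_proj_generator] fix_proj_idem[OF neg_proj_generator] by blast

text \<open>The generator 1 - p^2, where p is the positive part, is a positive contraction, so its
  fixed vectors are the kernel of p^2, and for self-adjoint p this is the kernel of p.\<close>

lemma neg_proj_fixed_iff: "neg_proj A x = x \<longleftrightarrow> pos_part A x = 0"
proof -
  have inner_D: "inner ((id_blinfun - (pos_part A o\<^sub>L pos_part A)) x) x = (norm x)\<^sup>2 - (norm (pos_part A x))\<^sup>2" for x
    by (simp add: blinfun.diff_left inner_diff_left power2_norm_eq_inner inner_adj[of "pos_part A"] pos_part_selfadjoint)
  have "0 \<le> inner ((id_blinfun - (pos_part A o\<^sub>L pos_part A)) x) x" for x
    unfolding inner_D using norm_apply_le[OF norm_pos_part_le, of x] by simp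
  from fix_proj_iff[OF neg_proj_generator this]
  have "neg_proj A x = x \<longleftrightarrow> pos_part A (pos_part A x) = 0"
    by (auto simp: neg_proj_def blinfun.diff_left)
  also have "\<dots> \<longleftrightarrow> pos_part A x = 0"
    using inner_adj[of "pos_part A" x "pos_part A x"] by (auto simp: pos_part_selfadjoint)
  finally show ?thesis .
qed

lemma neg_proj_nonpos:
  assumes "neg_proj A x = x"
  shows "inner (A x) x \<le> 0"
proof -
  have "op_abs A x = - A x"
    using assms unfolding neg_proj_fixed_iff
    by (simp add: pos_part_def blinfun.bilinear_simps add_eq_0_iff2)
  moreover have "inner (op_abs A x) x \<ge> 0"
    unfolding op_abs_def by (rule inner_op_sqrt_nonneg[OF norm_id_minus_adj_compose_self[OF nA]])
  ultimately show ?thesis by simp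
qed

text \<open>The negative part \<open>N\<close> maps into the kernel of the positive part, since
  their product is a quarter of |A|^2 - A^2 = 0. A vector annihilated by the kernel projection is
  therefore annihilated by \<open>N\<close>, and there \<open>A\<close> agrees with its absolute
  value.\<close>

lemma neg_proj_complement_nonneg:
  assumes "neg_proj A x = 0"
  shows "inner (A x) x \<ge> 0"
proof -
  define N where "N = (1/2) *\<^sub>R (op_abs A - A)"
  have "pos_part A o\<^sub>L N = 0"
    using op_abs_square[OF nA] op_abs_commute by (simp add: pos_part_def N_def compose_distribs A)
  then have "pos_part A (N y) = 0" for y by (metis blinfun_apply_blinfun_compose zero_blinfun.rep_eq)
  then have E: "neg_proj A (N y) = N y" for y by (simp add: neg_proj_fixed_iff)
  have adjN: "adj N = N" by (simp add: N_def adj_scaleR adj_diff op_abs_selfadjoint[OF nA] A)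
  have "inner (N x) (N x) = inner x (neg_proj A (N (N x)))" by (simp add: inner_adj adjN E)
  also have "\<dots> = inner (neg_proj A x) (N (N x))"
    using neg_proj_is_projection by (simp add: inner_adj is_projection_def)
  finally have "N x = 0" by (simp add: assms)
  then have "op_abs A x = A x" by (simp add: N_def blinfun.bilinear_simps)
  moreover have "inner (op_abs A x) x \<ge> 0"
    unfolding op_abs_def by (rule inner_op_sqrt_nonneg[OF norm_id_minus_adj_compose_self[OF nA]])
  ultimately show ?thesis by simp
qed

end

lemma spa_neg_proj:
  assumes G: "strong_pair_algebra G" and AB: "(A, B) \<in> G"
    and A: "adj A = A" "norm A \<le> 1" and B: "adj B = B" "norm B \<le> 1"
  shows "(neg_proj A, neg_proj B) \<in> G"
proof -
  have "(op_abs A, op_abs B) \<in> G"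
    unfolding op_abs_def
    by (rule spa_op_sqrt[OF G _ norm_id_minus_adj_compose_self[OF A(2)] norm_id_minus_adj_compose_self[OF B(2)]])
      (simp add: A B spa_compose[OF G AB AB])
  then have "(pos_part A, pos_part B) \<in> G"
    unfolding pos_part_def by (intro spa_scaleR[OF G] spa_add[OF G] AB)
  then show ?thesis
    unfolding neg_proj_def
    by (intro spa_fix_proj[OF G] spa_diff[OF G] spa_id[OF G] spa_compose[OF G] neg_proj_generator A B)
qed

text \<open>For suitable \<open>c\<close> this is the spectral projection of \<open>A\<close> for
  the half-line up to and including \<open>t\<close>; dividing by \<open>c\<close> only turns the
  shifted operator into a contraction.\<close>

definition level_proj :: "real \<Rightarrow> real \<Rightarrow> ('h::{real_inner,complete_space} \<Rightarrow>\<^sub>L 'h) \<Rightarrow> ('h \<Rightarrow>\<^sub>L 'h)" where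
  "level_proj c t A = neg_proj ((1/c) *\<^sub>R (A - t *\<^sub>R id_blinfun))"

context
  fixes A :: "'h::{real_inner,complete_space} \<Rightarrow>\<^sub>L 'h" and R c t :: real
  assumes A: "adj A = A" and nA: "norm A \<le> R" and c: "c > 0" "R + \<bar>t\<bar> \<le> c"
begin

lemma level_shift:
  "adj ((1/c) *\<^sub>R (A - t *\<^sub>R id_blinfun)) = (1/c) *\<^sub>R (A - t *\<^sub>R id_blinfun)"
  "norm ((1/c) *\<^sub>R (A - t *\<^sub>R id_blinfun)) \<le> 1"
proof -
  have "norm (t *\<^sub>R (id_blinfun :: 'h \<Rightarrow>\<^sub>L 'h)) \<le> \<bar>t\<bar> * 1"
    unfolding norm_scaleR by (intro mult_left_mono norm_blinfun_id_le) simp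
  then have "norm (A - t *\<^sub>R id_blinfun) \<le> c"
    using norm_triangle_ineq4[of A "t *\<^sub>R id_blinfun"] nA c by linarith
  then show "norm ((1/c) *\<^sub>R (A - t *\<^sub>R id_blinfun)) \<le> 1" using c by simp
qed (simp add: adj_scaleR adj_diff A)

lemma level_proj_is_projection: "is_projection (level_proj c t A)"
  unfolding level_proj_def by (rule neg_proj_is_projection[OF level_shift])

lemma inner_level_shift:
  "inner (((1/c) *\<^sub>R (A - t *\<^sub>R id_blinfun)) x) x = (inner (A x) x - t * (norm x)\<^sup>2) / c"
  by (simp add: blinfun.bilinear_simps inner_diff_left power2_norm_eq_inner)

lemma level_proj_le: "level_proj c t A x = x \<Longrightarrow> inner (A x) x \<le> t * (norm x)\<^sup>2"
  using neg_proj_nonpos[OF level_shift, of x] c unfolding level_proj_def inner_level_shift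
  by (simp add: divide_le_0_iff)

lemma level_proj_ge: "level_proj c t A x = 0 \<Longrightarrow> t * (norm x)\<^sup>2 \<le> inner (A x) x"
  using neg_proj_complement_nonneg[OF level_shift, of x] c unfolding level_proj_def inner_level_shift
  by (simp add: zero_le_divide_iff)

end

lemma spa_level_proj:
  assumes G: "strong_pair_algebra G" and AB: "(A, B) \<in> G" and "adj A = A" "norm A \<le> R"
    and "adj B = B" "norm B \<le> R" and "c > 0" "R + \<bar>t\<bar> \<le> c"
  shows "(level_proj c t A, level_proj c t B) \<in> G"
  unfolding level_proj_def
  by (intro spa_neg_proj[OF G] level_shift[where R = R] spa_scaleR[OF G] spa_diff[OF G] spa_id[OF G] assms)

lemma level_proj_commute:
  assumes "adj A = A" "norm A \<le> R" "c > 0" "R + \<bar>t\<bar> \<le> c" "A o\<^sub>L S = S o\<^sub>L A"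
  shows "level_proj c t A o\<^sub>L S = S o\<^sub>L level_proj c t A"
  using spa_level_proj[OF strong_pair_algebra_commute[of S], of A A R c t] assms by simp

section \<open>Slicing by commuting projections\<close>

primrec rem_proj :: "(nat \<Rightarrow> 'h::real_normed_vector \<Rightarrow>\<^sub>L 'h) \<Rightarrow> nat \<Rightarrow> ('h \<Rightarrow>\<^sub>L 'h)" where
  "rem_proj E 0 = id_blinfun"
| "rem_proj E (Suc j) = rem_proj E j o\<^sub>L (id_blinfun - E j)"

lemma rem_proj_commute:
  "(\<And>i. i < j \<Longrightarrow> E i o\<^sub>L S = S o\<^sub>L E i) \<Longrightarrow> rem_proj E j o\<^sub>L S = S o\<^sub>L rem_proj E j"
proof (induction j)
  case (Suc j)
  then have "rem_proj E j o\<^sub>L S = S o\<^sub>L rem_proj E j" "E j o\<^sub>L S = S o\<^sub>L E j" by simp_all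
  then show ?case by (simp add: compose_distribs) (metis compose_assoc)
qed simp

lemma rem_proj_sum: "(\<Sum>j<k. rem_proj E j o\<^sub>L E j) = id_blinfun - rem_proj E k"
  by (induction k) (simp_all add: compose_distribs)

lemma spa_rem_proj:
  "strong_pair_algebra G \<Longrightarrow> (\<And>i. i < j \<Longrightarrow> (E i, F i) \<in> G) \<Longrightarrow> (rem_proj E j, rem_proj F j) \<in> G"
  by (induction j) (auto intro!: spa_id spa_compose spa_diff)

context
  fixes E :: "nat \<Rightarrow> 'h::{real_inner,complete_space} \<Rightarrow>\<^sub>L 'h" and k :: nat
  assumes E: "\<And>i. i < k \<Longrightarrow> is_projection (E i)"
    and EE: "\<And>i j. i < k \<Longrightarrow> j < k \<Longrightarrow> E i o\<^sub>L E j = E j o\<^sub>L E i"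
begin

lemma rem_proj_commute_E: "j \<le> k \<Longrightarrow> i < k \<Longrightarrow> rem_proj E j o\<^sub>L E i = E i o\<^sub>L rem_proj E j"
  by (rule rem_proj_commute) (simp add: EE)

lemma rem_proj_is_projection: "j \<le> k \<Longrightarrow> is_projection (rem_proj E j)"
proof (induction j)
  case (Suc j)
  then show ?case using rem_proj_commute_E[of j j]
    by (simp, intro is_projection_compose is_projection_complement E) (simp_all add: compose_distribs)
qed (simp add: is_projection_id)

lemma rem_proj_annihilates: "j \<le> k \<Longrightarrow> i < j \<Longrightarrow> rem_proj E j o\<^sub>L E i = 0"
proof (induction j)
  case (Suc j)
  show ?case
  proof (cases "i = j")
    case True
    have "E j o\<^sub>L E j = E j" using E[of j] Suc.prems by (simp add: is_projection_def)
    with True show ?thesis by (simp add: compose_distribs compose_assoc)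
  next
    case False
    then have "rem_proj E j o\<^sub>L E i = 0" using Suc by simp
    moreover have "rem_proj E (Suc j) o\<^sub>L E i = (rem_proj E j o\<^sub>L E i) o\<^sub>L (id_blinfun - E j)"
      using EE[of i j] Suc.prems by (simp add: compose_distribs compose_assoc)
    ultimately show ?thesis by simp
  qed
qed simp

lemma slice_is_projection: "j < k \<Longrightarrow> is_projection (rem_proj E j o\<^sub>L E j)"
  by (intro is_projection_compose rem_proj_is_projection E rem_proj_commute_E) simp_all

text \<open>For \<open>i < j\<close> the later slice contains the factor
  \<open>id_blinfun - E i\<close>, which kills \<open>E i\<close>; the other order follows by taking
  adjoints. For an increasing family the slices are the differences of consecutive members, but the
  product form works for any commuting family.\<close>

lemma slice_orthogonal:
  assumes "i < k" "j < k" "i \<noteq> j"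
  shows "(rem_proj E i o\<^sub>L E i) o\<^sub>L (rem_proj E j o\<^sub>L E j) = 0"
proof -
  have *: "(rem_proj E j o\<^sub>L E j) o\<^sub>L (rem_proj E i o\<^sub>L E i) = 0" if "i < j" "j < k" for i j
  proof -
    have "(rem_proj E j o\<^sub>L E j) o\<^sub>L (rem_proj E i o\<^sub>L E i) =
        E j o\<^sub>L ((rem_proj E j o\<^sub>L E i) o\<^sub>L rem_proj E i)"
      using that rem_proj_commute_E[of j j] rem_proj_commute_E[of i i] by (simp add: compose_assoc)
    then show ?thesis using rem_proj_annihilates[of j i] that by simp
  qed
  show ?thesis
  proof (cases "i < j")
    case True
    then have "adj ((rem_proj E j o\<^sub>L E j) o\<^sub>L (rem_proj E i o\<^sub>L E i)) = 0" using * assms by simp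
    moreover have "adj (rem_proj E j o\<^sub>L E j) = rem_proj E j o\<^sub>L E j" "adj (rem_proj E i o\<^sub>L E i) = rem_proj E i o\<^sub>L E i"
      using slice_is_projection assms unfolding is_projection_def by blast+
    ultimately show ?thesis by (metis adj_compose)
  qed (use * assms in auto)
qed

end

section \<open>Partitions of the identity and step approximation\<close>

definition projection_partition :: "nat \<Rightarrow> (nat \<Rightarrow> 'h::{real_inner,complete_space} \<Rightarrow>\<^sub>L 'h) \<Rightarrow> bool" where
  "projection_partition k P \<longleftrightarrow> (\<forall>j<k. is_projection (P j)) \<and>
    (\<forall>i<k. \<forall>j<k. i \<noteq> j \<longrightarrow> P i o\<^sub>L P j = 0) \<and> (\<Sum>j<k. P j) = id_blinfun"

lemma projection_partition_compose:
  "projection_partition k P \<Longrightarrow> i < k \<Longrightarrow> j < k \<Longrightarrow> P i o\<^sub>L P j = (if i = j then P i else 0)"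
  by (simp add: projection_partition_def is_projection_def)

lemma inner_is_projection_orthogonal:
  assumes "is_projection P" "is_projection Q" "P o\<^sub>L Q = 0"
  shows "inner (P x) (Q y) = 0"
proof -
  have "inner (P x) (Q y) = inner x ((P o\<^sub>L Q) y)"
    using assms(1) by (simp add: inner_adj is_projection_def)
  then show ?thesis by (simp add: assms(3))
qed

text \<open>A block diagonal operator is bounded by its largest block, not by the sum of the blocks.
  Commutation keeps the values in mutually orthogonal ranges, so Pythagoras applies both to the
  values and to the decomposition of the vector.\<close>

lemma projection_partition_norm_le:
  assumes P: "projection_partition k P" and T: "\<And>j. j < k \<Longrightarrow> T j o\<^sub>L P j = P j o\<^sub>L T j"
    and e: "\<And>j x. j < k \<Longrightarrow> norm (T j (P j x)) \<le> \<epsilon> * norm (P j x)" "\<epsilon> \<ge> 0"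
  shows "norm (\<Sum>j<k. T j o\<^sub>L P j) \<le> \<epsilon>"
proof (rule norm_blinfun_bound[OF e(2)])
  fix x
  have proj: "is_projection (P j)" if "j < k" for j using P that by (simp add: projection_partition_def)
  have TP: "T j (P j x) = P j (T j (P j x))" if "j < k" for j
    using is_projection_idem[OF proj[OF that]] T[OF that] by (metis blinfun_apply_blinfun_compose)
  have orth: "orthogonal (P i y) (P j z)" if "i < k" "j < k" "i \<noteq> j" for i j y z
    unfolding orthogonal_def using P that
    by (intro inner_is_projection_orthogonal) (auto simp: projection_partition_def)
  have "(norm ((\<Sum>j<k. T j o\<^sub>L P j) x))\<^sup>2 = (norm (\<Sum>j<k. T j (P j x)))\<^sup>2"
    by (simp add: blinfun.sum_left)
  also have "\<dots> = (\<Sum>j<k. (norm (T j (P j x)))\<^sup>2)"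
  proof (rule norm_sum_Pythagorean)
    show "pairwise (\<lambda>i j. orthogonal (T i (P i x)) (T j (P j x))) {..<k}"
      unfolding pairwise_def using orth TP by (metis lessThan_iff)
  qed simp
  also have "\<dots> \<le> (\<Sum>j<k. (\<epsilon> * norm (P j x))\<^sup>2)"
    using e by (intro sum_mono power_mono) auto
  also have "\<dots> = \<epsilon>\<^sup>2 * (\<Sum>j<k. (norm (P j x))\<^sup>2)" by (simp add: power_mult_distrib sum_distrib_left)
  also have "(\<Sum>j<k. (norm (P j x))\<^sup>2) = (norm (\<Sum>j<k. P j x))\<^sup>2"
    by (rule norm_sum_Pythagorean[symmetric]) (auto simp: pairwise_def orth)
  also have "(\<Sum>j<k. P j x) = (\<Sum>j<k. P j) x" by (simp add: blinfun.sum_left)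
  also have "\<dots> = x" using P by (simp add: projection_partition_def)
  finally have "(norm ((\<Sum>j<k. T j o\<^sub>L P j) x))\<^sup>2 \<le> (\<epsilon> * norm x)\<^sup>2" by (simp add: power_mult_distrib)
  then show "norm ((\<Sum>j<k. T j o\<^sub>L P j) x) \<le> \<epsilon> * norm x"
    by (rule power2_le_imp_le) (use e in simp)
qed

text \<open>The levels start at -R and pass R in steps of \<epsilon>. On slice j the quadratic form
  of \<open>A\<close> lies between the j-th level minus \<epsilon> and the j-th level, so
  subtracting the level leaves a block of norm at most \<epsilon>.\<close>

lemma spectral_step_approx:
  fixes A :: "'h::{real_inner,complete_space} \<Rightarrow>\<^sub>L 'h"
  defines "E c R \<epsilon> j \<equiv> level_proj c (real j * \<epsilon> - R) A"
  assumes A: "adj A = A" "norm A \<le> R" and e: "\<epsilon> > 0" and k: "2 * R < real k * \<epsilon>"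
    and c: "c > 0" "\<And>j. j < Suc k \<Longrightarrow> R + \<bar>real j * \<epsilon> - R\<bar> \<le> c"
  shows "projection_partition (Suc k) (\<lambda>j. rem_proj (E c R \<epsilon>) j o\<^sub>L E c R \<epsilon> j)" (is ?part)
    and "norm (A - (\<Sum>j<Suc k. (real j * \<epsilon> - R) *\<^sub>R (rem_proj (E c R \<epsilon>) j o\<^sub>L E c R \<epsilon> j))) \<le> \<epsilon>" (is ?approx)
proof -
  define t where "t j = real j * \<epsilon> - R" for j
  define F where "F = E c R \<epsilon>"
  have F: "F j = level_proj c (t j) A" for j by (simp add: F_def E_def t_def)
  have c': "R + \<bar>t j\<bar> \<le> c" if "j < Suc k" for j using c that by (simp add: t_def)
  have proj: "is_projection (F j)" if "j < Suc k" for j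
    unfolding F by (rule level_proj_is_projection[OF A c(1) c'[OF that]])
  have FA: "F j o\<^sub>L A = A o\<^sub>L F j" if "j < Suc k" for j
    unfolding F by (rule level_proj_commute[OF A c(1) c'[OF that]]) simp
  have FF: "F i o\<^sub>L F j = F j o\<^sub>L F i" if "i < Suc k" "j < Suc k" for i j
    unfolding F[of i] by (rule level_proj_commute[OF A c(1) c'[OF that(1)]]) (simp add: FA that)
  have remA: "rem_proj F j o\<^sub>L A = A o\<^sub>L rem_proj F j" if "j \<le> Suc k" for j
    by (rule rem_proj_commute) (use FA that in simp)
  have le: "inner (A v) v \<le> t j * (norm v)\<^sup>2" if "j < Suc k" "F j v = v" for j v
    using that level_proj_le[OF A c(1) c'] by (simp add: F)
  have ge: "t j * (norm v)\<^sup>2 \<le> inner (A v) v" if "j < Suc k" "F j v = 0" for j v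
    using that level_proj_ge[OF A c(1) c'] by (simp add: F)
  have F_rem: "F i (rem_proj F j x) = 0" if "j \<le> Suc k" "i < j" for i j x
  proof -
    have "F i o\<^sub>L rem_proj F j = 0"
      using rem_proj_commute_E[of "Suc k" F j i] rem_proj_annihilates[of "Suc k" F j i] proj FF that by simp
    then show ?thesis by (metis blinfun_apply_blinfun_compose zero_blinfun.rep_eq)
  qed
  \<comment> \<open>A vector left over after all levels would have quadratic form at least
    \<open>t k * (norm v)\<^sup>2\<close>, whereas \<open>t k > R\<close> and
    \<open>norm A \<le> R\<close>.\<close>
  have last: "rem_proj F (Suc k) = 0"
  proof (rule blinfun_eqI)
    fix x
    define v where "v = rem_proj F (Suc k) x"
    have "t k * (norm v)\<^sup>2 \<le> inner (A v) v" unfolding v_def by (intro ge F_rem) simp_all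
    also have "\<dots> \<le> norm (A v) * norm v" by (rule norm_cauchy_schwarz)
    also have "\<dots> \<le> (R * norm v) * norm v"
      using norm_blinfun[of A v] mult_right_mono[OF A(2) norm_ge_zero[of v]]
      by (intro mult_right_mono) auto
    finally have "(t k - R) * (norm v)\<^sup>2 \<le> 0" by (simp add: power2_eq_square algebra_simps)
    moreover have "t k - R > 0" using k by (simp add: t_def)
    ultimately show "rem_proj F (Suc k) x = blinfun_apply 0 x" by (simp add: mult_le_0_iff v_def)
  qed
  define P where "P j = rem_proj F j o\<^sub>L F j" for j
  have P_proj: "is_projection (P j)" if "j < Suc k" for j
    unfolding P_def by (rule slice_is_projection[of "Suc k"]) (use proj FF that in auto)
  have part: "projection_partition (Suc k) P"
    unfolding projection_partition_def
  proof (intro conjI allI impI P_proj)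
    show "P i o\<^sub>L P j = 0" if "i < Suc k" "j < Suc k" "i \<noteq> j" for i j
      unfolding P_def by (rule slice_orthogonal[of "Suc k"]) (use proj FF that in auto)
    show "(\<Sum>j<Suc k. P j) = id_blinfun" unfolding P_def rem_proj_sum last by simp
  qed
  then show ?part unfolding P_def F_def .
  have PA: "P j o\<^sub>L A = A o\<^sub>L P j" if "j < Suc k" for j
    using FA[OF that] remA[of j] that unfolding P_def by (metis compose_assoc less_imp_le)
  have norm_slice: "norm ((A - t j *\<^sub>R id_blinfun) (P j x)) \<le> \<epsilon> * norm (P j x)" if j: "j < Suc k" for j x
  proof -
    \<comment> \<open>Cutting down by \<open>P j\<close>, which commutes with \<open>A\<close>,
      gives a self-adjoint operator on the whole space, so its norm can be read off from the
      quadratic form at arbitrary vectors.\<close>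
    define S where "S = (A - t j *\<^sub>R id_blinfun) o\<^sub>L P j"
    have PS: "P j o\<^sub>L S = S"
      using PA[OF j] P_proj[OF j] unfolding S_def is_projection_def
      by (simp add: compose_distribs) (metis compose_assoc)
    have "adj S = S"
      using P_proj[OF j] PA[OF j] by (simp add: S_def adj_compose adj_diff adj_scaleR A is_projection_def compose_distribs)
    moreover have "\<bar>inner (S y) y\<bar> \<le> \<epsilon> * (norm y)\<^sup>2" for y
    proof -
      define v where "v = P j y"
      have "inner (S y) y = inner (S y) (P j y)"
        using PS P_proj[OF j] by (metis blinfun_apply_blinfun_compose inner_adj is_projection_def)
      then have eq: "inner (S y) y = inner (A v) v - t j * (norm v)\<^sup>2"
        by (simp add: S_def v_def blinfun.bilinear_simps inner_diff_left power2_norm_eq_inner)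
      have "F j v = v"
        unfolding v_def P_def using rem_proj_commute_E[of "Suc k" F j j] proj FF j is_projection_idem[OF proj[OF j]]
        by (metis blinfun_apply_blinfun_compose less_imp_le)
      then have up: "inner (A v) v \<le> t j * (norm v)\<^sup>2" using le j by blast
      \<comment> \<open>A slice with positive index is annihilated by the preceding level
        projection. The first slice has no predecessor; there the lower bound is the norm bound, as
        \<open>t 0 = - R\<close>.\<close>
      have low: "(t j - \<epsilon>) * (norm v)\<^sup>2 \<le> inner (A v) v"
      proof (cases j)
        case 0
        have "\<bar>inner (A v) v\<bar> \<le> norm (A v) * norm v" by (rule Cauchy_Schwarz_ineq2)
        also have "\<dots> \<le> (R * norm v) * norm v"
          using norm_blinfun[of A v] mult_right_mono[OF A(2) norm_ge_zero[of v]]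
          by (intro mult_right_mono) auto
        finally have "- R * (norm v)\<^sup>2 \<le> inner (A v) v" by (simp add: power2_eq_square abs_le_iff)
        moreover have "(t j - \<epsilon>) * (norm v)\<^sup>2 \<le> - R * (norm v)\<^sup>2"
          using 0 e by (intro mult_right_mono) (auto simp: t_def)
        ultimately show ?thesis by linarith
      next
        case (Suc i)
        have "F i v = 0" unfolding v_def P_def using F_rem[of j i] Suc j by simp
        then have "t i * (norm v)\<^sup>2 \<le> inner (A v) v" using Suc j by (intro ge) auto
        moreover have "t i = t j - \<epsilon>" by (simp add: t_def Suc algebra_simps)
        ultimately show ?thesis by simp
      qed
      have "\<bar>inner (S y) y\<bar> \<le> \<epsilon> * (norm v)\<^sup>2"
        unfolding eq using up low by (simp add: algebra_simps)
      also have "\<dots> \<le> \<epsilon> * (norm y)\<^sup>2"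
        unfolding v_def using norm_is_projection_le[OF P_proj[OF j], of y] e by (intro mult_left_mono power_mono) auto
      finally show ?thesis .
    qed
    ultimately have "norm (S (P j x)) \<le> \<epsilon> * norm (P j x)" by (rule selfadjoint_norm_le)
    then show ?thesis by (simp add: S_def is_projection_idem[OF P_proj[OF j]])
  qed
  have "norm (\<Sum>j<Suc k. (A - t j *\<^sub>R id_blinfun) o\<^sub>L P j) \<le> \<epsilon>"
    by (rule projection_partition_norm_le[OF part])
      (use norm_slice e PA in \<open>auto simp: compose_distribs\<close>)
  also have "(\<Sum>j<Suc k. (A - t j *\<^sub>R id_blinfun) o\<^sub>L P j) = (A o\<^sub>L (\<Sum>j<Suc k. P j)) - (\<Sum>j<Suc k. t j *\<^sub>R P j)"
    unfolding compose_sum_right by (simp add: compose_distribs sum_subtractf del: sum.lessThan_Suc)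
  also have "\<dots> = A - (\<Sum>j<Suc k. t j *\<^sub>R P j)"
    using part by (simp add: projection_partition_def del: sum.lessThan_Suc)
  finally show ?approx unfolding P_def F_def t_def .
qed

text \<open>Both operators are cut at the same levels with the same scaling constant, so
  corresponding slices arise from \<open>(A, B)\<close> by identical operations. With the joint
  calculus as \<open>G\<close> this compares traces; with a dummy second component it places the
  slices in the algebra. The bound on \<open>t\<close> later confines the discrete distributions to
  a common interval.\<close>

lemma joint_spectral_step_approx:
  fixes A B :: "'h::{real_inner,complete_space} \<Rightarrow>\<^sub>L 'h"
  assumes G: "strong_pair_algebra G" and AB: "(A, B) \<in> G" and A: "adj A = A" "norm A \<le> R"
    and B: "adj B = B" "norm B \<le> R" and e: "\<epsilon> > 0"
  shows "\<exists>k t P Q. (\<forall>j<k. \<bar>t j\<bar> \<le> R + 2 * \<epsilon>) \<and> (\<forall>j<k. (P j, Q j) \<in> G) \<and>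
    projection_partition k P \<and> projection_partition k Q \<and>
    norm (A - (\<Sum>j<k. t j *\<^sub>R P j)) \<le> \<epsilon> \<and> norm (B - (\<Sum>j<k. t j *\<^sub>R Q j)) \<le> \<epsilon>"
proof -
  have R: "R \<ge> 0" using A(2) norm_ge_zero order.trans by blast
  \<comment> \<open>The smallest number of steps of size \<epsilon> that exceeds the length 2 R; the
    overshoot is at most \<epsilon>.\<close>
  define k where "k = nat \<lfloor>2 * R / \<epsilon>\<rfloor> + 1"
  have "2 * R / \<epsilon> < real k" "real k \<le> 2 * R / \<epsilon> + 1"
    using R e unfolding k_def by (simp_all add: of_nat_nat) linarith+
  then have k: "2 * R < real k * \<epsilon>" "real k * \<epsilon> \<le> 2 * R + \<epsilon>"
    using e by (simp_all add: field_simps)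
  define t where "t j = real j * \<epsilon> - R" for j :: nat
  \<comment> \<open>Large enough for \<open>R + \<bar>t j\<bar>\<close> at every level, so that each
    scaled shift of \<open>A\<close> and of \<open>B\<close> is a contraction.\<close>
  define c where "c = 2 * R + 2 * \<epsilon>"
  have t: "\<bar>t j\<bar> \<le> R + 2 * \<epsilon>" if "j < Suc k" for j
  proof -
    have "real j * \<epsilon> \<le> real k * \<epsilon>" "0 \<le> real j * \<epsilon>" using that e by (auto intro!: mult_right_mono)
    then show ?thesis using k e unfolding t_def by linarith
  qed
  have c: "c > 0" "\<And>j. j < Suc k \<Longrightarrow> R + \<bar>real j * \<epsilon> - R\<bar> \<le> c"
    using R e t by (auto simp: c_def t_def add_nonneg_pos)
  define P where "P X j = rem_proj (\<lambda>j. level_proj c (t j) X) j o\<^sub>L level_proj c (t j) X" for X :: "'h \<Rightarrow>\<^sub>L 'h" and j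
  have GE: "(level_proj c (t j) A, level_proj c (t j) B) \<in> G" if "j < Suc k" for j
    by (rule spa_level_proj[OF G AB A B c(1)]) (use c(2) that in \<open>simp add: t_def\<close>)
  have PG: "(P A j, P B j) \<in> G" if "j < Suc k" for j
    unfolding P_def by (intro spa_compose[OF G] spa_rem_proj[OF G] GE) (use that in auto)
  have step: "projection_partition (Suc k) (P X) \<and> norm (X - (\<Sum>j<Suc k. t j *\<^sub>R P X j)) \<le> \<epsilon>"
    if "adj X = X" "norm X \<le> R" for X
    using spectral_step_approx[OF that e k(1) c] unfolding P_def t_def by blast
  show ?thesis
    by (rule exI[of _ "Suc k"], rule exI[of _ t], rule exI[of _ "P A"], rule exI[of _ "P B"],
        intro conjI allI impI)
      (erule t PG | rule step[OF A, THEN conjunct1] step[OF B, THEN conjunct1]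
        step[OF A, THEN conjunct2] step[OF B, THEN conjunct2])+
qed

text \<open>The product rule allows only left multiplication by the generators. An induction on
  traces could not treat a product of two arbitrary members, because the trace is not
  multiplicative; closure under general products is recovered afterwards by induction on the left
  factor.\<close>

inductive_set joint_calculus :: "('h::real_normed_vector \<Rightarrow>\<^sub>L 'h) \<Rightarrow> ('h \<Rightarrow>\<^sub>L 'h) \<Rightarrow> (('h \<Rightarrow>\<^sub>L 'h) \<times> ('h \<Rightarrow>\<^sub>L 'h)) set"
  for A B where
  id: "(id_blinfun, id_blinfun) \<in> joint_calculus A B"
| mult: "(X, Y) \<in> joint_calculus A B \<Longrightarrow> (A o\<^sub>L X, B o\<^sub>L Y) \<in> joint_calculus A B"
| add: "(X, Y) \<in> joint_calculus A B \<Longrightarrow> (X', Y') \<in> joint_calculus A B \<Longrightarrow>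
    (X + X', Y + Y') \<in> joint_calculus A B"
| scaleR: "(X, Y) \<in> joint_calculus A B \<Longrightarrow> (c *\<^sub>R X, c *\<^sub>R Y) \<in> joint_calculus A B"
| lim: "(\<And>n. (X n, Y n) \<in> joint_calculus A B) \<Longrightarrow> strong_lim X L \<Longrightarrow> strong_lim Y L' \<Longrightarrow>
    (L, L') \<in> joint_calculus A B"

lemma joint_calculus_compose:
  "(X, Y) \<in> joint_calculus A B \<Longrightarrow> (Z, W) \<in> joint_calculus A B \<Longrightarrow> (X o\<^sub>L Z, Y o\<^sub>L W) \<in> joint_calculus A B"
proof (induction rule: joint_calculus.induct)
  case id
  then show ?case by simp
next
  case (mult X Y)
  then show ?case by (simp add: compose_assoc joint_calculus.mult)
next
  case (add X Y X' Y')
  then show ?case by (simp add: compose_distribs joint_calculus.add)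
next
  case (scaleR X Y c)
  then show ?case by (simp add: compose_distribs joint_calculus.scaleR)
next
  case (lim X Y L L')
  show ?case
    by (rule joint_calculus.lim[of "\<lambda>n. X n o\<^sub>L Z" "\<lambda>n. Y n o\<^sub>L W"])
      (intro lim strong_lim_compose strong_lim_const)+
qed

lemma strong_pair_algebra_joint_calculus: "strong_pair_algebra (joint_calculus A B)"
  unfolding strong_pair_algebra_def
  by (auto intro: joint_calculus.intros joint_calculus_compose)

lemma joint_calculus_base: "(A, B) \<in> joint_calculus A B"
  using joint_calculus.mult[OF joint_calculus.id, of A B] by simp

lemma joint_calculus_fst:
  "(X, Y) \<in> joint_calculus A B \<Longrightarrow> strong_pair_algebra {(X, Y :: 'h::real_normed_vector \<Rightarrow>\<^sub>L 'h). X \<in> M} \<Longrightarrow> A \<in> M \<Longrightarrow> X \<in> M"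
proof (induction rule: joint_calculus.induct)
  case (lim X Y L L')
  then show ?case using spa_lim[OF lim.prems(1), of X X L L] by auto
qed (auto dest: spa_id spa_compose spa_add spa_scaleR)

lemma joint_calculus_swap: "(X, Y) \<in> joint_calculus A B \<Longrightarrow> (Y, X) \<in> joint_calculus B A"
  by (induction rule: joint_calculus.induct) (auto intro: joint_calculus.intros)

lemma limitin_strong_operator_topology:
  "limitin strong_operator_topology X L F \<longleftrightarrow> (\<forall>x. ((\<lambda>n. blinfun_apply (X n) x) \<longlongrightarrow> blinfun_apply L x) F)"
proof -
  have "limitin strong_operator_topology X L F \<longleftrightarrow> limitin euclidean (\<lambda>n. blinfun_apply (X n)) (blinfun_apply L) F"
    unfolding limitin_def strong_operator_topology_def openin_pullback_topology topspace_pullback_topology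
    by auto
  also have "\<dots> \<longleftrightarrow> (\<forall>x. ((\<lambda>n. blinfun_apply (X n) x) \<longlongrightarrow> blinfun_apply L x) F)"
    using limitin_componentwise[of "\<lambda>_. euclidean" UNIV "\<lambda>n. blinfun_apply (X n)" "blinfun_apply L" F]
    unfolding euclidean_product_topology by simp
  finally show ?thesis .
qed

lemma strong_lim_norm_le:
  assumes "strong_lim X L" "\<And>n. norm (X n) \<le> K"
  shows "norm L \<le> K"
proof (rule norm_blinfun_bound)
  show "0 \<le> K" using assms(2) norm_ge_zero order.trans by blast
  fix x
  show "norm (L x) \<le> K * norm x"
  proof (rule LIMSEQ_le_const2[OF tendsto_norm[OF strong_limD[OF assms(1)]]], intro exI allI impI)
    fix n show "norm (X n x) \<le> K * norm x"
      using mult_right_mono[OF assms(2)[of n] norm_ge_zero[of x]] norm_blinfun[of "X n" x] by simp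
  qed
qed

section \<open>Comparison of projections in a finite factor\<close>

text \<open>The Brezis-Browder ordering principle, a countable substitute for Zorn's lemma. Each
  \<open>u (Suc n)\<close> nearly attains the supremum of \<open>f\<close> above \<open>u n\<close>,
  so above an upper bound of the whole chain \<open>f\<close> has no room left to grow. Upper bounds
  are needed only for sequences, which strong limits supply.\<close>

lemma ordering_principle:
  fixes f :: "'a \<Rightarrow> real"
  assumes x0: "x0 \<in> X"
    and refl: "\<And>x. x \<in> X \<Longrightarrow> le x x"
    and trans: "\<And>x y z. x \<in> X \<Longrightarrow> y \<in> X \<Longrightarrow> z \<in> X \<Longrightarrow> le x y \<Longrightarrow> le y z \<Longrightarrow> le x z"
    and mono: "\<And>x y. x \<in> X \<Longrightarrow> y \<in> X \<Longrightarrow> le x y \<Longrightarrow> f x \<le> f y"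
    and bdd: "\<And>x. x \<in> X \<Longrightarrow> f x \<le> B"
    and chain: "\<And>u. (\<And>n. u n \<in> X) \<Longrightarrow> (\<And>n. le (u n) (u (Suc n))) \<Longrightarrow> \<exists>y\<in>X. \<forall>n. le (u n) y"
  shows "\<exists>y\<in>X. \<forall>z\<in>X. le y z \<longrightarrow> f z \<le> f y"
proof -
  define up where "up x = {z \<in> X. le x z}" for x
  have bdd_up: "bdd_above (f ` up x)" for x by (rule bdd_aboveI2[of _ _ B]) (simp add: up_def bdd)
  have step: "\<exists>y. y \<in> X \<and> le x y \<and> (\<forall>z\<in>up x. f z \<le> f y + 1 / real (Suc n))" if x: "x \<in> X" for x n
  proof -
    have "f ` up x \<noteq> {}" using x refl by (auto simp: up_def)
    moreover have "Sup (f ` up x) - 1 / real (Suc n) < Sup (f ` up x)" by simp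
    ultimately obtain y where y: "y \<in> up x" "Sup (f ` up x) - 1 / real (Suc n) < f y"
      using less_cSup_iff[OF _ bdd_up] by (metis (no_types, lifting) imageE)
    have "f z \<le> f y + 1 / real (Suc n)" if "z \<in> up x" for z
      using cSUP_upper[OF that bdd_up] y(2) by linarith
    then show ?thesis using y(1) by (auto simp: up_def)
  qed
  have "\<exists>u. \<forall>n. u n \<in> X \<and> (le (u n) (u (Suc n)) \<and> (\<forall>z\<in>up (u n). f z \<le> f (u (Suc n)) + 1 / real (Suc n)))"
    by (rule dependent_nat_choice[where P = "\<lambda>_ x. x \<in> X"
          and Q = "\<lambda>n x y. le x y \<and> (\<forall>z\<in>up x. f z \<le> f y + 1 / real (Suc n))"])
      (use x0 step in auto)
  then obtain u where u: "\<And>n. u n \<in> X" "\<And>n. le (u n) (u (Suc n))"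
    and close: "\<And>n z. z \<in> up (u n) \<Longrightarrow> f z \<le> f (u (Suc n)) + 1 / real (Suc n)" by blast
  obtain y where y: "y \<in> X" "\<And>n. le (u n) y" using chain[of u, OF u] by blast
  have "f z \<le> f y" if "z \<in> X" "le y z" for z
  proof (rule LIMSEQ_le_const[of "\<lambda>n. f y + 1 / real (Suc n)"])
    have "(\<lambda>n. f y + 1 / real (Suc n)) \<longlonglongrightarrow> f y + 0"
      by (intro tendsto_intros LIMSEQ_Suc[OF lim_1_over_n])
    then show "(\<lambda>n. f y + 1 / real (Suc n)) \<longlonglongrightarrow> f y" by simp
    have "f z \<le> f y + 1 / real (Suc n)" for n
    proof -
      have "z \<in> up (u n)" using trans[OF u(1) y(1) that(1) y(2) that(2)] that by (simp add: up_def)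
      from close[OF this] mono[OF u(1) y(1) y(2), of "Suc n"] show ?thesis by linarith
    qed
    then show "\<exists>N. \<forall>n\<ge>N. f z \<le> f y + 1 / real (Suc n)" by blast
  qed
  with y(1) show ?thesis by blast
qed

section \<open>Partial isometries and their extension order\<close>

lemma partial_isometry_right:
  assumes "is_projection (adj V o\<^sub>L V)"
  shows "V o\<^sub>L (adj V o\<^sub>L V) = V"
proof -
  define P where "P = adj V o\<^sub>L V"
  have P: "adj P = P" "P o\<^sub>L P = P" using assms by (simp_all add: P_def is_projection_def)
  have VV: "adj V o\<^sub>L (V o\<^sub>L X) = P o\<^sub>L X" for X :: "'a \<Rightarrow>\<^sub>L 'a" by (simp add: P_def compose_assoc)
  have "adj ((V o\<^sub>L P) - V) o\<^sub>L ((V o\<^sub>L P) - V) = (P o\<^sub>L (P o\<^sub>L P)) - (P o\<^sub>L P) - ((P o\<^sub>L P) - P)"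
    by (simp add: adj_diff adj_compose compose_distribs compose_assoc P VV P_def[symmetric])
  also have "\<dots> = 0" by (simp add: P)
  finally show ?thesis by (simp add: adj_compose_self_eq_0 P_def)
qed

lemma partial_isometry_adj:
  assumes "is_projection (adj V o\<^sub>L V)"
  shows "is_projection (V o\<^sub>L adj V)"
  using partial_isometry_right[OF assms]
  by (simp add: is_projection_def adj_compose) (metis compose_assoc)

lemma partial_isometryI:
  assumes "V o\<^sub>L (adj V o\<^sub>L V) = V"
  shows "is_projection (adj V o\<^sub>L V)"
  using assms by (simp add: is_projection_def adj_compose compose_assoc)

lemma partial_isometry_left:
  assumes "is_projection (adj V o\<^sub>L V)"
  shows "adj V o\<^sub>L (V o\<^sub>L adj V) = adj V"
  using arg_cong[OF partial_isometry_right[OF assms], of adj] by (simp add: adj_compose compose_assoc)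

lemma norm_partial_isometry_le:
  assumes "is_projection (adj V o\<^sub>L V)"
  shows "norm V \<le> 1"
proof (rule norm_blinfun_bound)
  fix x
  have "(norm (V x))\<^sup>2 = inner x ((adj V o\<^sub>L V) x)" by (simp add: inner_adj power2_norm_eq_inner)
  also have "\<dots> \<le> norm x * norm ((adj V o\<^sub>L V) x)" by (rule norm_cauchy_schwarz)
  also have "\<dots> \<le> norm x * norm x" by (intro mult_left_mono norm_is_projection_le assms) simp
  finally show "norm (V x) \<le> 1 * norm x" by (simp add: power2_eq_square[symmetric] power2_le_iff_abs_le)
qed simp

text \<open>\<open>W\<close> extends \<open>V\<close>: the difference \<open>W - V\<close> has initial and final space orthogonal to those of \<open>V\<close>.\<close>

definition extends :: "('h::{real_inner,complete_space} \<Rightarrow>\<^sub>L 'h) \<Rightarrow> ('h \<Rightarrow>\<^sub>L 'h) \<Rightarrow> bool" where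
  "extends V W \<longleftrightarrow> W o\<^sub>L adj V = V o\<^sub>L adj V \<and> adj W o\<^sub>L V = adj V o\<^sub>L V"

lemma extends_refl: "extends V V"
  by (simp add: extends_def)

lemma extends_adj: "extends V W \<Longrightarrow> extends (adj V) (adj W)"
  by (simp add: extends_def)

lemma extends_adj_compose:
  assumes "extends V W"
  shows "adj V o\<^sub>L W = adj V o\<^sub>L V" "V o\<^sub>L adj W = V o\<^sub>L adj V"
  using assms arg_cong[of _ _ adj] unfolding extends_def by (metis adj_adj adj_compose)+

lemma extends_trans:
  assumes "is_projection (adj V o\<^sub>L V)" "extends V W" "extends W Y"
  shows "extends V Y"
proof -
  have *: "Y o\<^sub>L adj V = V o\<^sub>L adj V"
    if V: "is_projection (adj V o\<^sub>L V)" and VW: "extends V W" and WY: "extends W Y" for V W Y :: "'a \<Rightarrow>\<^sub>L 'a"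
  proof -
    have "adj V = adj W o\<^sub>L (V o\<^sub>L adj V)"
      using partial_isometry_left[OF V] VW unfolding extends_def by (metis compose_assoc)
    then have "Y o\<^sub>L adj V = (Y o\<^sub>L adj W) o\<^sub>L (V o\<^sub>L adj V)" by (metis compose_assoc)
    also have "\<dots> = (W o\<^sub>L adj W) o\<^sub>L (V o\<^sub>L adj V)" using WY by (simp add: extends_def)
    also have "\<dots> = W o\<^sub>L ((adj W o\<^sub>L V) o\<^sub>L adj V)" by (simp add: compose_assoc)
    also have "\<dots> = W o\<^sub>L adj V"
      using VW partial_isometry_left[OF V] by (simp add: extends_def compose_assoc)
    finally show ?thesis using VW by (simp add: extends_def)
  qed
  show ?thesis
    unfolding extends_def
    using *[OF assms] *[of "adj V" "adj W" "adj Y"] assms partial_isometry_adj[OF assms(1)]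
    by (simp add: extends_adj)
qed

text \<open>Both cross terms reduce to \<open>adj V o\<^sub>L V\<close>. The left side being
  positive makes the trace of the initial projection monotone along \<open>extends\<close>;
  evaluated at a vector, the identity makes increasing chains strongly Cauchy.\<close>

lemma adj_diff_compose_extends:
  assumes "extends V W"
  shows "adj (W - V) o\<^sub>L (W - V) = (adj W o\<^sub>L W) - (adj V o\<^sub>L V)"
  using assms extends_adj_compose[OF assms] by (simp add: extends_def adj_diff compose_distribs)

lemma norm_extends_diff:
  assumes "extends V W"
  shows "(norm (W x - V x))\<^sup>2 = (norm (W x))\<^sup>2 - (norm (V x))\<^sup>2"
proof -
  have *: "(norm (T x))\<^sup>2 = inner x ((adj T o\<^sub>L T) x)" for T :: "'a \<Rightarrow>\<^sub>L 'a"
    by (simp add: inner_adj power2_norm_eq_inner)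
  have "(norm (W x - V x))\<^sup>2 = (norm ((W - V) x))\<^sup>2" by (simp add: blinfun.diff_left)
  also have "\<dots> = inner x ((adj W o\<^sub>L W) x) - inner x ((adj V o\<^sub>L V) x)"
    unfolding * adj_diff_compose_extends[OF assms] by (simp add: blinfun.diff_left inner_diff_right)
  finally show ?thesis by (simp only: *[symmetric])
qed

lemma extends_chain:
  assumes V: "\<And>n. is_projection (adj (V n) o\<^sub>L V n)" and ext: "\<And>n. extends (V n) (V (Suc n))"
    and "m \<le> n"
  shows "extends (V m) (V n)"
  using \<open>m \<le> n\<close>
proof (induction n rule: dec_induct)
  case (step n)
  then show ?case using extends_trans[OF V] ext by blast
qed (rule extends_refl)

lemma extends_chain_strong_lim:
  assumes V: "\<And>n. is_projection (adj (V n) o\<^sub>L V n)" and ext: "\<And>n. extends (V n) (V (Suc n))"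
  shows "\<exists>W. strong_lim V W"
proof -
  have "\<exists>W. strong_lim V W \<and> norm W \<le> 1"
  proof (rule strong_lim_exists)
    show "norm (V n) \<le> 1" for n by (rule norm_partial_isometry_le[OF V])
    fix x
    define a where "a n = (norm (V n x))\<^sup>2" for n
    have diff: "(norm (V n x - V m x))\<^sup>2 = a n - a m" if "m \<le> n" for m n
      unfolding a_def by (rule norm_extends_diff[OF extends_chain[of V, OF V ext that]])
    have "incseq a" using diff by (intro incseq_SucI) (metis diff_ge_0_iff_ge le_SucI order_refl zero_le_power2)
    moreover have "a n \<le> (norm x)\<^sup>2" for n
      unfolding a_def using norm_apply_le[OF norm_partial_isometry_le[OF V]] by (simp add: power_mono)
    ultimately have "convergent a" using incseq_convergent[of a] convergentI by metis
    then have C: "Cauchy a" by (rule convergent_Cauchy)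
    show "Cauchy (\<lambda>n. V n x)"
    proof (rule metric_CauchyI)
      fix e :: real assume e: "e > 0"
      then obtain N where N: "\<And>m n. m \<ge> N \<Longrightarrow> n \<ge> N \<Longrightarrow> dist (a m) (a n) < e\<^sup>2"
        using metric_CauchyD[OF C, of "e\<^sup>2"] by auto
      have *: "norm (V n x - V m x) < e" if "m \<ge> N" "m \<le> n" for m n
      proof -
        have "(norm (V n x - V m x))\<^sup>2 < e\<^sup>2"
          using diff[OF that(2)] N[of n m] that by (simp add: dist_real_def abs_less_iff)
        then show ?thesis using e by (simp add: power2_less_imp_less)
      qed
      have "dist (V m x) (V n x) < e" if "m \<ge> N" "n \<ge> N" for m n
        using *[of m n] *[of n m] that by (cases "m \<le> n") (auto simp: dist_norm norm_minus_commute)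
      then show "\<exists>N. \<forall>m\<ge>N. \<forall>n\<ge>N. dist (V m x) (V n x) < e" by blast
    qed
  qed
  then show ?thesis by blast
qed

text \<open>The adjoints form a chain as well, so they converge too, and their limit is the adjoint
  of \<open>W\<close>. With both limits available the partial isometry identity survives the passage
  to the limit.\<close>

lemma extends_chain_upper_bound:
  assumes V: "\<And>n. is_projection (adj (V n) o\<^sub>L V n)" and ext: "\<And>n. extends (V n) (V (Suc n))"
  shows "\<exists>W. strong_lim V W \<and> is_projection (adj W o\<^sub>L W) \<and> (\<forall>n. extends (V n) W)"
proof -
  obtain W where W: "strong_lim V W" using extends_chain_strong_lim[of V, OF V ext] by blast
  have "\<exists>W'. strong_lim (\<lambda>n. adj (V n)) W'"
    by (rule extends_chain_strong_lim) (simp_all add: partial_isometry_adj[OF V] extends_adj[OF ext])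
  then have W': "strong_lim (\<lambda>n. adj (V n)) (adj W)"
    using strong_lim_adj_eq[OF W] by metis
  \<comment> \<open>From index n on, composing with the n-th member or its adjoint gives a constant
    sequence, so the extension identities can be read off in the limit.\<close>
  have ev: "L = R" if "strong_lim X L" "\<And>m. m \<ge> n \<Longrightarrow> X m = R" for X :: "nat \<Rightarrow> 'a \<Rightarrow>\<^sub>L 'a" and L R n
  proof (rule blinfun_eqI)
    fix x
    have "(\<lambda>m. R x) \<longlonglongrightarrow> L x"
      by (rule Lim_transform_eventually[OF strong_limD[OF that(1)]])
        (use that(2) in \<open>auto simp: eventually_sequentially\<close>)
    then show "L x = R x" by (simp add: LIMSEQ_const_iff)
  qed
  have "extends (V n) W" for n
    unfolding extends_def
  proof
    show "W o\<^sub>L adj (V n) = V n o\<^sub>L adj (V n)"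
      by (rule ev[OF strong_lim_compose[OF W strong_lim_const], of n])
        (use extends_chain[of V, OF V ext] in \<open>unfold extends_def, blast\<close>)
    show "adj W o\<^sub>L V n = adj (V n) o\<^sub>L V n"
      by (rule ev[OF strong_lim_compose[OF W' strong_lim_const], of n])
        (use extends_chain[of V, OF V ext] in \<open>unfold extends_def, blast\<close>)
  qed
  moreover have "W o\<^sub>L (adj W o\<^sub>L W) = W"
  proof (rule strong_lim_unique[OF _ W])
    have "strong_lim (\<lambda>n. V n o\<^sub>L (adj (V n) o\<^sub>L V n)) (W o\<^sub>L (adj W o\<^sub>L W))"
      by (intro strong_lim_compose W W')
    then show "strong_lim V (W o\<^sub>L (adj W o\<^sub>L W))" by (simp add: partial_isometry_right[OF V])
  qed
  ultimately show ?thesis using W partial_isometryI by blast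
qed

section \<open>Algebra and trace of a finite factor\<close>

locale finite_factor =
  fixes J :: "'h::{real_inner,complete_space} \<Rightarrow>\<^sub>L 'h" and M :: "('h \<Rightarrow>\<^sub>L 'h) set"
    and \<tau> :: "('h \<Rightarrow>\<^sub>L 'h) \<Rightarrow> complex"
  assumes finite_factor: "finite_factor_with_trace J M \<tau>"
begin

lemma von_neumann: "von_neumann_algebra J M"
  and center: "M \<inter> commutant J M = {cscale J c id_blinfun | c. True}"
  and trace: "faithful_normal_tracial_state J M \<tau>"
  using finite_factor by (auto simp: finite_factor_with_trace_def factor_def)

lemma J_square: "J o\<^sub>L J = - id_blinfun" and J_isometry: "inner (J x) (J y) = inner x y"
  and M_cops: "M \<subseteq> cops J" and adj_M: "A \<in> M \<Longrightarrow> adj A \<in> M"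
  and bicommutant: "commutant J (commutant J M) = M"
  using von_neumann by (auto simp: von_neumann_algebra_def complex_structure_def)

lemma J_commute: "A \<in> M \<Longrightarrow> A o\<^sub>L J = J o\<^sub>L A"
  using M_cops by (auto simp: cops_def)

lemma spa_commutant: "strong_pair_algebra {(X, Y :: 'h \<Rightarrow>\<^sub>L 'h). X \<in> commutant J S}"
proof -
  \<comment> \<open>Complex linearity is commutation with \<open>J\<close>, so the commutant is cut
    out by commutation relations only.\<close>
  have eq: "X \<in> commutant J S \<longleftrightarrow> (\<forall>A\<in>insert J S. X o\<^sub>L A = A o\<^sub>L X)" for X :: "'h \<Rightarrow>\<^sub>L 'h"
    by (auto simp: commutant_def cops_def)
  let ?C = "\<lambda>A :: 'h \<Rightarrow>\<^sub>L 'h. {(X, Y :: 'h \<Rightarrow>\<^sub>L 'h). X o\<^sub>L A = A o\<^sub>L X}"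
  note C = strong_pair_algebra_commute
  show ?thesis
    unfolding strong_pair_algebra_def mem_Collect_eq prod.case eq
  proof (intro conjI allI impI ballI)
    fix X L :: "nat \<Rightarrow> 'h \<Rightarrow>\<^sub>L 'h" and Y L' :: "'h \<Rightarrow>\<^sub>L 'h" and A
    assume *: "\<forall>n. \<forall>A\<in>insert J S. X n o\<^sub>L A = A o\<^sub>L X n" "A \<in> insert J S" "strong_lim X Y"
    have "X n o\<^sub>L A = A o\<^sub>L X n" for n using *(1,2) by blast
    then have "\<And>n. (X n, X n) \<in> ?C A" by simp
    from spa_lim[OF C this *(3,3)] show "Y o\<^sub>L A = A o\<^sub>L Y" by simp
  qed (auto simp: compose_distribs, (metis compose_assoc)+)
qed

lemma spa_M: "strong_pair_algebra {(X, Y :: 'h \<Rightarrow>\<^sub>L 'h). X \<in> M}"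
  using spa_commutant[of "commutant J M"] by (simp add: bicommutant)

lemma id_M: "id_blinfun \<in> M" using spa_id[OF spa_M] by simp
lemma zero_M: "0 \<in> M" using spa_zero[OF spa_M] by simp
lemma add_M: "A \<in> M \<Longrightarrow> B \<in> M \<Longrightarrow> A + B \<in> M" using spa_add[OF spa_M, of A A B B] by simp
lemma diff_M: "A \<in> M \<Longrightarrow> B \<in> M \<Longrightarrow> A - B \<in> M" using spa_diff[OF spa_M, of A A B B] by simp
lemma compose_M: "A \<in> M \<Longrightarrow> B \<in> M \<Longrightarrow> A o\<^sub>L B \<in> M" using spa_compose[OF spa_M, of A A B B] by simp
lemma scaleR_M: "A \<in> M \<Longrightarrow> c *\<^sub>R A \<in> M" using spa_scaleR[OF spa_M, of A A c] by simp
lemma opow_M: "A \<in> M \<Longrightarrow> opow A n \<in> M" using spa_opow[OF spa_M, of A A n] by simp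
lemma sum_M: "(\<And>i. i \<in> I \<Longrightarrow> X i \<in> M) \<Longrightarrow> sum X I \<in> M" using spa_sum[OF spa_M, of I X X] by simp
lemma strong_lim_M: "(\<And>n. X n \<in> M) \<Longrightarrow> strong_lim X L \<Longrightarrow> L \<in> M"
  using spa_lim[OF spa_M, of X X L L] by simp

lemma trace_add: "A \<in> M \<Longrightarrow> B \<in> M \<Longrightarrow> \<tau> (A + B) = \<tau> A + \<tau> B"
  and trace_cscale: "A \<in> M \<Longrightarrow> \<tau> (cscale J c A) = c * \<tau> A"
  and trace_nonneg: "A \<in> M \<Longrightarrow> Im (\<tau> (adj A o\<^sub>L A)) = 0" "A \<in> M \<Longrightarrow> Re (\<tau> (adj A o\<^sub>L A)) \<ge> 0"
  and trace_id: "\<tau> id_blinfun = 1"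
  and trace_commute: "A \<in> M \<Longrightarrow> B \<in> M \<Longrightarrow> \<tau> (A o\<^sub>L B) = \<tau> (B o\<^sub>L A)"
  and trace_faithful: "A \<in> M \<Longrightarrow> \<tau> (adj A o\<^sub>L A) = 0 \<Longrightarrow> A = 0"
  and trace_continuous: "continuous_map (subtopology strong_operator_topology {A \<in> M. norm A \<le> 1}) euclidean \<tau>"
  using trace by (simp_all add: faithful_normal_tracial_state_def)

lemma trace_scaleR: "A \<in> M \<Longrightarrow> \<tau> (c *\<^sub>R A) = of_real c * \<tau> A"
  using trace_cscale[of A "of_real c"] by (simp add: cscale_def)

lemma trace_zero: "\<tau> 0 = 0"
  using trace_scaleR[OF zero_M, of 0] by simp

lemma trace_diff: "A \<in> M \<Longrightarrow> B \<in> M \<Longrightarrow> \<tau> (A - B) = \<tau> A - \<tau> B"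
  using trace_add[of A "- B"] trace_scaleR[of B "-1"] scaleR_M[of B "-1"] by simp

lemma trace_sum: "(\<And>i. i \<in> I \<Longrightarrow> X i \<in> M) \<Longrightarrow> \<tau> (sum X I) = (\<Sum>i\<in>I. \<tau> (X i))"
  by (induction I rule: infinite_finite_induct) (simp_all add: trace_zero trace_add sum_M)

lemma trace_projection:
  assumes "P \<in> M" "is_projection P"
  shows "Im (\<tau> P) = 0" "Re (\<tau> P) \<ge> 0" "\<tau> P = 0 \<Longrightarrow> P = 0"
  using trace_nonneg[OF assms(1)] trace_faithful[OF assms(1)] assms(2) by (simp_all add: is_projection_def)

lemma trace_strong_lim:
  assumes X: "\<And>n. X n \<in> M" and L: "strong_lim X L"
  shows "(\<lambda>n. \<tau> (X n)) \<longlonglongrightarrow> \<tau> L"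
proof -
  obtain K where K: "\<And>n. norm (X n) \<le> K" using L unfolding strong_lim_def by blast
  \<comment> \<open>Normality is assumed on the unit ball, so the sequence is scaled into it; the
    maximum with 1 keeps the divisor positive.\<close>
  define c where "c = max K 1"
  have c: "c > 0" "\<And>n. norm (X n) \<le> c" using K by (auto simp: c_def le_max_iff_disj)
  have LM: "L \<in> M" using strong_lim_M X L by blast
  have "norm L \<le> c" using strong_lim_norm_le[OF L c(2)] .
  then have "limitin (subtopology strong_operator_topology {A \<in> M. norm A \<le> 1})
      (\<lambda>n. (1/c) *\<^sub>R X n) ((1/c) *\<^sub>R L) sequentially"
    unfolding limitin_subtopology limitin_strong_operator_topology
    using c X LM strong_limD[OF strong_lim_scaleR[OF L, of "1/c"]]
    by (auto simp: scaleR_M)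
  from limitin_canonical_iff[THEN iffD1, OF continuous_map_limit[OF trace_continuous this]]
  have "(\<lambda>n. of_real (1/c) * \<tau> (X n)) \<longlonglongrightarrow> of_real (1/c) * \<tau> L"
    by (simp add: o_def trace_scaleR X LM)
  then have "(\<lambda>n. of_real c * (of_real (1/c) * \<tau> (X n))) \<longlonglongrightarrow> of_real c * (of_real (1/c) * \<tau> L)"
    by (rule tendsto_mult_left)
  then show ?thesis using c(1) by simp
qed

lemma trace_tendsto: "(\<And>n. X n \<in> M) \<Longrightarrow> X \<longlonglongrightarrow> L \<Longrightarrow> (\<lambda>n. \<tau> (X n)) \<longlonglongrightarrow> \<tau> L"
  by (intro trace_strong_lim tendsto_imp_strong_lim)

text \<open>Without a bound, rescaling would give elements of norm 1/(n+1) whose traces stay above 1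
  in modulus, against continuity along norm limits. The bound is what gives the moments geometric
  growth.\<close>

lemma trace_bounded: "\<exists>C>0. \<forall>X\<in>M. cmod (\<tau> X) \<le> C * norm X"
proof (rule ccontr)
  assume neg: "\<not> ?thesis"
  have "\<exists>X. X \<in> M \<and> norm X = 1 / real (Suc n) \<and> cmod (\<tau> X) > 1" for n
  proof -
    obtain X where X: "X \<in> M" "cmod (\<tau> X) > real (Suc n) * norm X"
      using neg by (metis not_le of_nat_0_less_iff zero_less_Suc)
    then have "norm X > 0" by (auto simp: trace_zero)
    then show ?thesis using X
      by (intro exI[of _ "(1 / (real (Suc n) * norm X)) *\<^sub>R X"])
        (auto simp: scaleR_M trace_scaleR norm_mult norm_divide pos_less_divide_eq simp del: of_nat_Suc)
  qed
  then obtain X where X: "\<And>n. X n \<in> M" "\<And>n. norm (X n) = 1 / real (Suc n)" "\<And>n. cmod (\<tau> (X n)) > 1" by metis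
  have "X \<longlonglongrightarrow> 0"
    by (rule tendsto_norm_zero_cancel) (simp add: X(2) LIMSEQ_Suc[OF lim_1_over_n] del: of_nat_Suc)
  from tendsto_norm[OF trace_tendsto[OF X(1) this]] have "(\<lambda>n. cmod (\<tau> (X n))) \<longlonglongrightarrow> 0" by (simp add: trace_zero)
  then have "1 \<le> (0::real)" by (rule LIMSEQ_le_const) (use X(3) less_imp_le in blast)
  then show False by simp
qed

end

section \<open>Factoriality and equivalence of projections\<close>

context finite_factor
begin

lemma adj_J: "adj J = - J"
proof (rule adj_eqI)
  fix x y
  have "J (J x) = - x" by (metis J_square blinfun_apply_blinfun_compose id_blinfun.rep_eq uminus_blinfun.rep_eq)
  then show "inner (J x) y = inner x ((- J) y)"
    using J_isometry[of "J x" y] by (simp add: uminus_blinfun.rep_eq)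
qed

lemma inner_J_self: "inner (J x) x = 0"
  using inner_adj[of J x x] by (simp add: adj_J uminus_blinfun.rep_eq inner_commute)

lemma adj_commutant:
  assumes "S \<in> commutant J M"
  shows "adj S \<in> commutant J M"
proof -
  have S: "S o\<^sub>L J = J o\<^sub>L S" "\<And>A. A \<in> M \<Longrightarrow> S o\<^sub>L A = A o\<^sub>L S"
    using assms by (auto simp: commutant_def cops_def)
  have "adj S o\<^sub>L A = A o\<^sub>L adj S" if "A \<in> M" for A
    using arg_cong[OF S(2)[OF adj_M[OF that]], of adj] by (simp add: adj_compose)
  moreover have "- (adj S o\<^sub>L J) = - (J o\<^sub>L adj S)"
    using arg_cong[OF S(1), of adj] by (simp add: adj_compose adj_J blinfun_eq_iff uminus_blinfun.rep_eq blinfun.minus_right)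
  ultimately show ?thesis by (simp add: commutant_def cops_def)
qed

text \<open>The set \<open>K\<close> below is the orthogonal complement of the closed span of \<open>M P H\<close>; the projection onto it
  is central, hence scalar.\<close>

lemma exists_nonzero_between:
  assumes P: "P \<in> M" "is_projection P" "P \<noteq> 0" and Q: "Q \<in> M" "is_projection Q" "Q \<noteq> 0"
  shows "\<exists>T\<in>M. Q o\<^sub>L (T o\<^sub>L P) \<noteq> 0"
proof (rule ccontr)
  assume "\<not> ?thesis"
  then have zero: "Q o\<^sub>L (T o\<^sub>L P) = 0" if "T \<in> M" for T using that by blast
  have zero': "P (T (Q x)) = 0" if "T \<in> M" for T x
  proof -
    have "adj (Q o\<^sub>L (adj T o\<^sub>L P)) = 0" using zero[OF adj_M[OF that]] by simp
    then have "(P o\<^sub>L T) o\<^sub>L Q = 0" using P Q by (simp add: adj_compose is_projection_def compose_assoc)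
    then show ?thesis by (metis blinfun_apply_blinfun_compose zero_blinfun.rep_eq)
  qed
  define K where "K = {y. \<forall>T\<in>M. P (T y) = 0}"
  have sub: "subspace K" by (auto simp: subspace_def K_def blinfun.bilinear_simps)
  have "K = (\<Inter>T\<in>M. {y. P (blinfun_apply T y) = 0})" by (auto simp: K_def)
  moreover have "closed {y. P (T y) = 0}" for T :: "'h \<Rightarrow>\<^sub>L 'h"
    by (intro closed_Collect_eq continuous_intros)
  ultimately have clo: "closed K" by auto
  obtain Z :: "'h \<Rightarrow>\<^sub>L 'h" where ZK: "\<And>x. Z x \<in> K" and Zfix: "\<And>x. x \<in> K \<Longrightarrow> Z x = x"
    and Zorth: "\<And>x y. y \<in> K \<Longrightarrow> inner (x - blinfun_apply Z x) y = 0"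
    using orthogonal_projection_exists[OF sub clo] by metis
  have adjZ: "adj Z = Z"
  proof (rule adj_eqI)
    fix x y
    have "inner (x - Z x) (Z y) = 0" "inner (y - Z y) (Z x) = 0" by (rule Zorth[OF ZK])+
    then show "inner (Z x) y = inner x (Z y)" by (simp add: inner_diff_left) (metis inner_commute)
  qed
  \<comment> \<open>Invariance of \<open>K\<close> under \<open>S\<close> gives Z S Z = S Z; the
    adjoint of the same relation for \<open>adj S\<close> gives Z S Z = Z S.\<close>
  have comm: "Z o\<^sub>L S = S o\<^sub>L Z" if "\<And>y. y \<in> K \<Longrightarrow> S y \<in> K" "\<And>y. y \<in> K \<Longrightarrow> adj S y \<in> K" for S :: "'h \<Rightarrow>\<^sub>L 'h"
  proof -
    have "Z o\<^sub>L (S o\<^sub>L Z) = S o\<^sub>L Z" "Z o\<^sub>L (adj S o\<^sub>L Z) = adj S o\<^sub>L Z"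
      by (rule blinfun_eqI, simp add: Zfix that ZK)+
    then show ?thesis using arg_cong[of "Z o\<^sub>L (adj S o\<^sub>L Z)" _ adj]
      by (simp add: adj_compose adjZ compose_assoc)
  qed
  have invM: "S y \<in> K" if "S \<in> M" "y \<in> K" for S :: "'h \<Rightarrow>\<^sub>L 'h" and y
  proof -
    have "P ((T o\<^sub>L S) y) = 0" if "T \<in> M" for T
      using \<open>y \<in> K\<close> compose_M[OF that \<open>S \<in> M\<close>] unfolding K_def by blast
    then show ?thesis by (simp add: K_def)
  qed
  have inv: "S y \<in> K" if S: "\<And>T. T \<in> M \<Longrightarrow> T o\<^sub>L S = S o\<^sub>L T" and "y \<in> K" for S :: "'h \<Rightarrow>\<^sub>L 'h" and y
  proof -
    have "T (S x) = S (T x)" if "T \<in> M" for T x using S[OF that] by (metis blinfun_apply_blinfun_compose)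
    then have "P (T (S y)) = S (P (T y))" if "T \<in> M" for T using that P(1) by simp
    then show ?thesis using \<open>y \<in> K\<close> by (simp add: K_def)
  qed
  \<comment> \<open>The adjoint of \<open>J\<close> is its negative, so invariance of the subspace
    under \<open>J\<close> covers the adjoint too.\<close>
  have "adj J y = J (- y)" for y by (simp add: adj_J uminus_blinfun.rep_eq blinfun.minus_right)
  then have ZJ: "Z o\<^sub>L J = J o\<^sub>L Z"
    using inv[of J] J_commute sub by (intro comm) (auto simp: subspace_neg)
  have "Z o\<^sub>L S = S o\<^sub>L Z" if "S \<in> M" for S using comm invM adj_M that by blast
  then have "Z \<in> commutant J M" using ZJ by (simp add: commutant_def cops_def)
  moreover have "Z o\<^sub>L S = S o\<^sub>L Z" if "S \<in> commutant J M" for S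
  proof (rule comm)
    have "T o\<^sub>L S' = S' o\<^sub>L T" if "S' \<in> commutant J M" "T \<in> M" for S' T using that by (simp add: commutant_def)
    then show "\<And>y. y \<in> K \<Longrightarrow> S y \<in> K" "\<And>y. y \<in> K \<Longrightarrow> adj S y \<in> K"
      using inv that adj_commutant by blast+
  qed
  then have "Z \<in> M" using ZJ bicommutant by (auto simp: commutant_def cops_def)
  ultimately obtain c where c: "Z = cscale J c id_blinfun" using center by blast
  obtain x where "Q x \<noteq> 0" using Q(3) blinfun_eqI[of Q 0] by auto
  define v where "v = Q x"
  have v: "v \<noteq> 0" "v \<in> K" using \<open>Q x \<noteq> 0\<close> zero' by (auto simp: v_def K_def)
  have Zv: "v = Re c *\<^sub>R v + Im c *\<^sub>R J v"
    using Zfix[OF v(2)] unfolding c by (simp add: cscale_def blinfun.bilinear_simps)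
  have "inner v v = inner (Re c *\<^sub>R v + Im c *\<^sub>R J v) v" using Zv by simp
  \<comment> \<open>\<open>J v\<close> is orthogonal to \<open>v\<close> in the real inner product,
    so pairing with \<open>v\<close> isolates the real part of \<open>c\<close>; the imaginary part
    then vanishes because \<open>J v\<close> is nonzero.\<close>
  also have "\<dots> = Re c * inner v v" by (simp add: inner_add_left inner_J_self)
  finally have "Re c = 1" using v by simp
  then have "Im c *\<^sub>R J v = 0" using Zv by simp
  moreover have "J v \<noteq> 0" using J_isometry[of v v] v by auto
  ultimately have "Z = id_blinfun" using \<open>Re c = 1\<close> c by (simp add: cscale_def)
  then have "x \<in> K" for x using ZK[of x] by simp
  then have "P x = 0" for x using id_M unfolding K_def by force
  then show False using P(3) blinfun_eqI[of P 0] by simp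
qed

text \<open>Polar decomposition of a normalised nonzero Q S P. The range condition passes to the
  strong limit; the condition on the initial space follows because \<open>W\<close> and
  \<open>T\<close> have the same kernel.\<close>

lemma exists_partial_isometry_between:
  assumes P: "P \<in> M" "is_projection P" "P \<noteq> 0" and Q: "Q \<in> M" "is_projection Q" "Q \<noteq> 0"
  shows "\<exists>W\<in>M. W \<noteq> 0 \<and> is_projection (adj W o\<^sub>L W) \<and> W o\<^sub>L P = W \<and> Q o\<^sub>L W = W"
proof -
  obtain S where S: "S \<in> M" "Q o\<^sub>L (S o\<^sub>L P) \<noteq> 0" using exists_nonzero_between[OF assms] by blast
  define T where "T = (1 / norm (Q o\<^sub>L (S o\<^sub>L P))) *\<^sub>R (Q o\<^sub>L (S o\<^sub>L P))"
  have T: "T \<in> M" "T \<noteq> 0" "norm T \<le> 1" using S P Q by (simp_all add: T_def scaleR_M compose_M)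
  have QT: "Q o\<^sub>L T = T" and TP: "T o\<^sub>L P = T"
    using P(2) Q(2) by (simp_all add: T_def compose_distribs is_projection_def compose_assoc)
      (metis compose_assoc)
  obtain W k where W: "strong_lim (\<lambda>n. T o\<^sub>L k n) W" and proj: "is_projection (adj W o\<^sub>L W)"
    and k: "\<And>G. strong_pair_algebra G \<Longrightarrow> (adj T o\<^sub>L T, adj T o\<^sub>L T) \<in> G \<Longrightarrow> (\<forall>n. (k n, k n) \<in> G)"
    and ker: "\<And>x. (adj W o\<^sub>L W) x = 0 \<longleftrightarrow> T x = 0"
    using polar_decomposition[OF T(3)] by blast
  have kM: "k n \<in> M" for n using k[OF spa_M] T(1) by (simp add: compose_M adj_M)
  have "W \<in> M" by (rule strong_lim_M[OF _ W]) (intro compose_M T(1) kM)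
  moreover have "W \<noteq> 0" using ker T(2) blinfun_eqI[of T 0] by force
  moreover have "Q o\<^sub>L W = W"
  proof (rule strong_lim_unique[OF _ W])
    have "strong_lim (\<lambda>n. Q o\<^sub>L (T o\<^sub>L k n)) (Q o\<^sub>L W)" by (intro strong_lim_compose strong_lim_const W)
    moreover have "Q o\<^sub>L (T o\<^sub>L k n) = T o\<^sub>L k n" for n using QT by (metis compose_assoc)
    ultimately show "strong_lim (\<lambda>n. T o\<^sub>L k n) (Q o\<^sub>L W)" by simp
  qed
  moreover have "W o\<^sub>L P = W"
  proof (rule blinfun_eqI)
    fix x
    have "T (P x) = T x" using TP by (metis blinfun_apply_blinfun_compose)
    then have "(adj W o\<^sub>L W) (x - P x) = 0" unfolding ker by (simp add: blinfun.diff_right)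
    then have "inner (x - P x) (adj W (W (x - P x))) = 0" by simp
    then have "W (x - P x) = 0" by (simp only: inner_adj[symmetric] inner_eq_zero_iff)
    then show "(W o\<^sub>L P) x = W x" by (simp add: blinfun.diff_right)
  qed
  ultimately show ?thesis using proj by blast
qed

lemma is_projection_diff:
  assumes "is_projection P" "is_projection R" "P o\<^sub>L R = R"
  shows "is_projection (P - R)"
proof -
  have "R o\<^sub>L P = R" using arg_cong[OF assms(3), of adj] assms(1,2) by (simp add: adj_compose is_projection_def)
  with assms show ?thesis by (simp add: is_projection_def adj_diff compose_distribs)
qed

theorem equal_trace_imp_equivalent:
  assumes P: "P \<in> M" "is_projection P" and Q: "Q \<in> M" "is_projection Q" and tr: "\<tau> P = \<tau> Q"
  shows "\<exists>V\<in>M. adj V o\<^sub>L V = P \<and> V o\<^sub>L adj V = Q"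
proof -
  define X where "X = {V \<in> M. is_projection (adj V o\<^sub>L V) \<and> V o\<^sub>L P = V \<and> Q o\<^sub>L V = V}"
  define f where "f V = Re (\<tau> (adj V o\<^sub>L V))" for V
  have XD: "V \<in> M" "is_projection (adj V o\<^sub>L V)" "V o\<^sub>L P = V" "Q o\<^sub>L V = V" if "V \<in> X" for V
    using that by (auto simp: X_def)
  have ini: "adj V o\<^sub>L V \<in> M" if "V \<in> X" for V using XD(1)[OF that] by (simp add: compose_M adj_M)
  have "\<exists>V\<in>X. \<forall>W\<in>X. extends V W \<longrightarrow> f W \<le> f V"
  proof (rule ordering_principle[of 0 X extends f 1])
    show "0 \<in> X" by (simp add: X_def zero_M is_projection_def)
    show "extends V V" for V by (rule extends_refl)
    show "extends V Y" if "V \<in> X" "extends V W" "extends W Y" for V W Y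
      by (rule extends_trans[OF XD(2)[OF that(1)] that(2,3)])
    show "f V \<le> f W" if "V \<in> X" "W \<in> X" "extends V W" for V W
    proof -
      have "0 \<le> Re (\<tau> (adj (W - V) o\<^sub>L (W - V)))" using that XD(1) by (intro trace_nonneg diff_M)
      then show ?thesis
        unfolding adj_diff_compose_extends[OF that(3)] f_def using that ini by (simp add: trace_diff)
    qed
    show "f V \<le> 1" if "V \<in> X" for V
    proof -
      have "0 \<le> Re (\<tau> (id_blinfun - (adj V o\<^sub>L V)))"
        using that ini id_M XD(2) by (intro trace_projection diff_M is_projection_complement)
      then show ?thesis unfolding f_def using ini[OF that] id_M by (simp add: trace_diff trace_id)
    qed
    show "\<exists>W\<in>X. \<forall>n. extends (V n) W" if V: "\<And>n. V n \<in> X" and ext: "\<And>n. extends (V n) (V (Suc n))" for V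
    proof -
      obtain W where W: "strong_lim V W" "is_projection (adj W o\<^sub>L W)" "\<forall>n. extends (V n) W"
        using extends_chain_upper_bound[of V, OF XD(2)[OF V] ext] by blast
      have "W \<in> M" by (rule strong_lim_M[OF XD(1)[OF V] W(1)])
      moreover have "W o\<^sub>L P = W"
        using strong_lim_compose[OF W(1) strong_lim_const[of P]]
        by (intro strong_lim_unique[OF _ W(1)]) (simp add: XD(3)[OF V])
      moreover have "Q o\<^sub>L W = W"
        using strong_lim_compose[OF strong_lim_const[of Q] W(1)]
        by (intro strong_lim_unique[OF _ W(1)]) (simp add: XD(4)[OF V])
      ultimately show ?thesis using W unfolding X_def by blast
    qed
  qed
  then obtain V where V: "V \<in> X" and max: "\<And>W. W \<in> X \<Longrightarrow> extends V W \<Longrightarrow> f W \<le> f V" by blast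
  define P' where "P' = P - (adj V o\<^sub>L V)"
  define Q' where "Q' = Q - (V o\<^sub>L adj V)"
  have VM: "V \<in> M" "adj V \<in> M" using XD(1)[OF V] adj_M by auto
  have PV: "P o\<^sub>L adj V = adj V" "adj V o\<^sub>L Q = adj V"
    using arg_cong[OF XD(3)[OF V], of adj] arg_cong[OF XD(4)[OF V], of adj] P Q
    by (simp_all add: adj_compose is_projection_def)
  have projP': "is_projection P'" unfolding P'_def
    by (rule is_projection_diff[OF P(2) XD(2)[OF V]]) (metis PV(1) compose_assoc)
  have projQ': "is_projection Q'" unfolding Q'_def
    by (rule is_projection_diff[OF Q(2) partial_isometry_adj[OF XD(2)[OF V]]]) (metis XD(4)[OF V] compose_assoc)
  have M': "P' \<in> M" "Q' \<in> M" unfolding P'_def Q'_def using P Q VM by (simp_all add: diff_M compose_M)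
  have tr': "\<tau> P' = \<tau> Q'"
    unfolding P'_def Q'_def using P Q VM tr by (simp add: trace_diff compose_M trace_commute[of V "adj V"])
  have zero: "V o\<^sub>L P' = 0" "P' o\<^sub>L adj V = 0" "adj V o\<^sub>L Q' = 0"
    unfolding P'_def Q'_def using partial_isometry_right[OF XD(2)[OF V]] partial_isometry_left[OF XD(2)[OF V]] XD(3)[OF V] PV
    by (simp_all add: compose_distribs compose_assoc)
  have "P' = 0 \<and> Q' = 0"
  proof (rule ccontr)
    assume "\<not> ?thesis"
    then have "P' \<noteq> 0" "Q' \<noteq> 0"
      using tr' trace_projection(3)[OF M'(1) projP'] trace_projection(3)[OF M'(2) projQ'] trace_zero by auto
    then obtain W where W: "W \<in> M" "W \<noteq> 0" "is_projection (adj W o\<^sub>L W)" "W o\<^sub>L P' = W" "Q' o\<^sub>L W = W"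
      using exists_partial_isometry_between M' projP' projQ' by blast
    have WV: "W o\<^sub>L adj V = 0" using W(4) zero(2) by (metis compose_assoc blinfun_compose_zero(2))
    have VW: "adj V o\<^sub>L W = 0" using W(5) zero(3) by (metis compose_assoc blinfun_compose_zero(1))
    have WV': "adj W o\<^sub>L V = 0" using arg_cong[OF VW, of adj] by (simp add: adj_compose)
    have VW': "V o\<^sub>L adj W = 0" using arg_cong[OF WV, of adj] by (simp add: adj_compose)
    have ext: "extends V (V + W)" by (simp add: extends_def adj_add compose_distribs WV WV')
    have ini': "adj (V + W) o\<^sub>L (V + W) = (adj V o\<^sub>L V) + (adj W o\<^sub>L W)"
      by (simp add: adj_add compose_distribs WV' VW)
    have zz: "(adj V o\<^sub>L V) o\<^sub>L (adj W o\<^sub>L W) = 0" "(adj W o\<^sub>L W) o\<^sub>L (adj V o\<^sub>L V) = 0"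
      using VW' WV by (metis compose_assoc blinfun_compose_zero)+
    have "is_projection (adj (V + W) o\<^sub>L (V + W))"
      unfolding ini' using XD(2)[OF V] W(3) zz by (simp add: is_projection_def adj_add compose_distribs)
    moreover have "W o\<^sub>L P = W"
    proof -
      have "P' o\<^sub>L P = P'"
        unfolding P'_def using P(2) XD(3)[OF V] by (simp add: compose_distribs is_projection_def compose_assoc)
      then show ?thesis using W(4) by (metis compose_assoc)
    qed
    moreover have "Q o\<^sub>L W = W"
    proof -
      have "Q o\<^sub>L Q' = Q'"
        unfolding Q'_def using Q(2) XD(4)[OF V] by (simp add: compose_distribs is_projection_def) (metis compose_assoc)
      then show ?thesis using W(5) by (metis compose_assoc)
    qed
    ultimately have "V + W \<in> X" using XD[OF V] W by (simp add: X_def add_M compose_distribs)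
    from max[OF this ext] have "f W \<le> 0"
      unfolding f_def ini' using ini[OF V] W(1) by (simp add: trace_add compose_M adj_M)
    then have "\<tau> (adj W o\<^sub>L W) = 0"
      using trace_nonneg[OF W(1)] by (simp add: f_def complex_eq_iff)
    then show False using trace_faithful W by blast
  qed
  then show ?thesis using VM by (intro bexI[of _ V]) (simp_all add: P'_def Q'_def)
qed

text \<open>Partial isometries from \<open>P j\<close> to \<open>Q j\<close> have mutually
  orthogonal initial spaces and mutually orthogonal final spaces. Their sum is unitary because both
  families exhaust the identity.\<close>

lemma unitary_intertwining_partitions:
  assumes P: "projection_partition k P" "\<And>j. j < k \<Longrightarrow> P j \<in> M"
    and Q: "projection_partition k Q" "\<And>j. j < k \<Longrightarrow> Q j \<in> M"
    and tr: "\<And>j. j < k \<Longrightarrow> \<tau> (P j) = \<tau> (Q j)"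
  shows "\<exists>U\<in>M. unitary_op U \<and> (\<forall>j<k. U o\<^sub>L P j = Q j o\<^sub>L U)"
proof -
  have proj: "is_projection (P j)" "is_projection (Q j)" if "j < k" for j
    using P Q that by (auto simp: projection_partition_def)
  have "\<exists>V. j < k \<longrightarrow> V \<in> M \<and> adj V o\<^sub>L V = P j \<and> V o\<^sub>L adj V = Q j" for j
    using equal_trace_imp_equivalent[of "P j" "Q j"] P(2) Q(2) tr proj by blast
  then obtain V where V: "\<And>j. j < k \<Longrightarrow> V j \<in> M" "\<And>j. j < k \<Longrightarrow> adj (V j) o\<^sub>L V j = P j"
    "\<And>j. j < k \<Longrightarrow> V j o\<^sub>L adj (V j) = Q j" by metis
  have VP: "V j o\<^sub>L P j = V j" if "j < k" for j
    using partial_isometry_right[of "V j"] V(2) proj that by simp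
  have QV: "Q j o\<^sub>L V j = V j" if "j < k" for j
    using VP[OF that] V(2,3)[OF that] by (metis compose_assoc)
  define U where "U = (\<Sum>j<k. V j)"
  have UP: "U o\<^sub>L P j = V j" if j: "j < k" for j
  proof -
    have "U o\<^sub>L P j = (\<Sum>i<k. V i o\<^sub>L (P i o\<^sub>L P j))"
      unfolding U_def compose_sum_left by (intro sum.cong refl) (metis VP compose_assoc lessThan_iff)
    also have "\<dots> = (\<Sum>i<k. if i = j then V i else 0)"
      by (intro sum.cong refl) (use projection_partition_compose[OF P(1)] VP j in auto)
    finally show ?thesis using j by simp
  qed
  have QU: "Q j o\<^sub>L U = V j" if j: "j < k" for j
  proof -
    have "Q j o\<^sub>L U = (\<Sum>i<k. (Q j o\<^sub>L Q i) o\<^sub>L V i)"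
      unfolding U_def compose_sum_right by (intro sum.cong refl) (metis QV compose_assoc lessThan_iff)
    also have "\<dots> = (\<Sum>i<k. if i = j then V i else 0)"
      by (intro sum.cong refl) (use projection_partition_compose[OF Q(1)] QV j in auto)
    finally show ?thesis using j by simp
  qed
  have "adj U o\<^sub>L U = (\<Sum>j<k. adj U o\<^sub>L V j)" unfolding compose_sum_right[symmetric] by (simp add: U_def)
  also have "\<dots> = (\<Sum>j<k. P j)"
  proof (rule sum.cong[OF refl])
    fix j assume "j \<in> {..<k}"
    then have j: "j < k" by simp
    have "adj U o\<^sub>L V j = adj (Q j o\<^sub>L U) o\<^sub>L V j"
      using QV[OF j] proj(2)[OF j] by (simp add: adj_compose is_projection_def compose_assoc)
    then show "adj U o\<^sub>L V j = P j" by (simp add: QU j V(2))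
  qed
  finally have 1: "adj U o\<^sub>L U = id_blinfun" using P(1) by (simp add: projection_partition_def)
  have "U o\<^sub>L adj U = (\<Sum>j<k. U o\<^sub>L adj (V j))"
    unfolding compose_sum_right[symmetric] adj_sum[symmetric] by (simp add: U_def)
  also have "\<dots> = (\<Sum>j<k. Q j)"
  proof (rule sum.cong[OF refl])
    fix j assume "j \<in> {..<k}"
    then have j: "j < k" by simp
    have "adj (V j) = P j o\<^sub>L adj (V j)"
      using arg_cong[OF VP[OF j], of adj] proj(1)[OF j] by (simp add: adj_compose is_projection_def)
    then have "U o\<^sub>L adj (V j) = (U o\<^sub>L P j) o\<^sub>L adj (V j)" by (metis compose_assoc)
    then show "U o\<^sub>L adj (V j) = Q j" by (simp add: UP j V(3))
  qed
  finally have 2: "U o\<^sub>L adj U = id_blinfun" using Q(1) by (simp add: projection_partition_def)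
  have "U \<in> M" unfolding U_def by (rule sum_M) (simp add: V)
  then show ?thesis using 1 2 UP QU by (auto simp: unitary_op_def)
qed

section \<open>Approximate unitary equivalence\<close>

lemma norm_unitary_le:
  assumes "unitary_op U"
  shows "norm U \<le> 1" "norm (adj U) \<le> 1"
  using norm_partial_isometry_le[of U] assms is_projection_id by (simp_all add: unitary_op_def norm_adj)

lemma norm_unitary_conj_le:
  assumes "unitary_op U"
  shows "norm (U o\<^sub>L (X o\<^sub>L adj U)) \<le> norm X"
proof -
  have "norm (U o\<^sub>L (X o\<^sub>L adj U)) \<le> norm U * (norm X * norm (adj U))"
    by (intro order.trans[OF norm_blinfun_compose] mult_left_mono norm_blinfun_compose norm_ge_zero)
  also have "\<dots> \<le> 1 * (norm X * 1)"
    by (intro mult_mono norm_unitary_le assms) auto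
  finally show ?thesis by simp
qed

text \<open>The extra factor \<open>opow A n\<close> strengthens the claim so that the
  multiplication case becomes the induction hypothesis at \<open>Suc n\<close>. The base case is
  equality of moments, and the instance \<open>n = 0\<close> is the one applied to
  projections.\<close>

lemma trace_joint_calculus:
  assumes AB: "A \<in> M" "B \<in> M" and mom: "\<And>n. \<tau> (opow A n) = \<tau> (opow B n)"
  shows "(X, Y) \<in> joint_calculus A B \<Longrightarrow> \<tau> (opow A n o\<^sub>L X) = \<tau> (opow B n o\<^sub>L Y)"
proof (induction arbitrary: n rule: joint_calculus.induct)
  case id
  then show ?case by (simp add: mom)
next
  case (mult X Y)
  have "opow C n o\<^sub>L (C o\<^sub>L Z) = opow C (Suc n) o\<^sub>L Z" for C Z :: "'h \<Rightarrow>\<^sub>L 'h"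
    using opow_add[of C n 1] opow_add[of C 1 n] by (simp add: compose_assoc[symmetric])
  then show ?case using mult.IH[of "Suc n"] by simp
next
  case (add X Y X' Y')
  then have "X \<in> M" "X' \<in> M" "Y \<in> M" "Y' \<in> M"
    using joint_calculus_fst[OF _ spa_M] joint_calculus_swap AB by blast+
  then show ?case by (simp add: compose_distribs trace_add compose_M opow_M AB add.IH)
next
  case (scaleR X Y c)
  then have "X \<in> M" "Y \<in> M"
    using joint_calculus_fst[OF _ spa_M] joint_calculus_swap AB by blast+
  then show ?case by (simp add: compose_distribs trace_scaleR compose_M opow_M AB scaleR.IH)
next
  case (lim X Y L L')
  then have XY: "X m \<in> M" "Y m \<in> M" for m
    using joint_calculus_fst[OF _ spa_M] joint_calculus_swap AB by blast+
  have "(\<lambda>m. \<tau> (opow A n o\<^sub>L X m)) \<longlonglongrightarrow> \<tau> (opow A n o\<^sub>L L)"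
    by (intro trace_strong_lim compose_M opow_M AB XY strong_lim_compose strong_lim_const lim)
  moreover have "(\<lambda>m. \<tau> (opow B n o\<^sub>L Y m)) \<longlonglongrightarrow> \<tau> (opow B n o\<^sub>L L')"
    by (intro trace_strong_lim compose_M opow_M AB XY strong_lim_compose strong_lim_const lim)
  ultimately show ?case unfolding lim.IH by (rule LIMSEQ_unique)
qed

theorem equal_moments_imp_approx_unitarily_equivalent:
  assumes A: "A \<in> M" "adj A = A" and B: "B \<in> M" "adj B = B"
    and mom: "\<And>n. \<tau> (opow A n) = \<tau> (opow B n)" and e: "\<epsilon> > 0"
  shows "\<exists>U\<in>M. unitary_op U \<and> norm ((U o\<^sub>L A o\<^sub>L adj U) - B) < \<epsilon>"
proof -
  define R where "R = max (norm A) (norm B)"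
  have R: "norm A \<le> R" "norm B \<le> R" by (simp_all add: R_def)
  \<comment> \<open>The error is incurred once for \<open>A\<close> and once for \<open>B\<close>; a
    third each leaves the final inequality strict.\<close>
  have e3: "\<epsilon> / 3 > 0" using e by simp
  obtain k t P Q where G: "\<And>j. j < k \<Longrightarrow> (P j, Q j) \<in> joint_calculus A B"
    and part: "projection_partition k P" "projection_partition k Q"
    and close: "norm (A - (\<Sum>j<k. t j *\<^sub>R P j)) \<le> \<epsilon> / 3" "norm (B - (\<Sum>j<k. t j *\<^sub>R Q j)) \<le> \<epsilon> / 3"
    using joint_spectral_step_approx[OF strong_pair_algebra_joint_calculus joint_calculus_base A(2) R(1) B(2) R(2) e3]
    by blast
  have PM: "P j \<in> M" if "j < k" for j using joint_calculus_fst[OF G[OF that] spa_M A(1)] .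
  have QM: "Q j \<in> M" if "j < k" for j
    using joint_calculus_fst[OF joint_calculus_swap[OF G[OF that]] spa_M B(1)] .
  have tr: "\<tau> (P j) = \<tau> (Q j)" if "j < k" for j
    using trace_joint_calculus[OF A(1) B(1) mom G[OF that], of 0] by simp
  obtain U where U: "U \<in> M" "unitary_op U" "\<And>j. j < k \<Longrightarrow> U o\<^sub>L P j = Q j o\<^sub>L U"
    using unitary_intertwining_partitions[OF part(1) PM part(2) QM tr] by blast
  define SA where "SA = (\<Sum>j<k. t j *\<^sub>R P j)"
  define SB where "SB = (\<Sum>j<k. t j *\<^sub>R Q j)"
  have "U o\<^sub>L SA = SB o\<^sub>L U"
    unfolding SA_def SB_def compose_sum_left compose_sum_right
    by (intro sum.cong refl) (simp add: compose_distribs U(3))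
  then have SB: "U o\<^sub>L (SA o\<^sub>L adj U) = SB"
    using U(2) by (metis compose_assoc compose_id_right unitary_op_def)
  have eq: "(U o\<^sub>L A o\<^sub>L adj U) - B = (U o\<^sub>L ((A - SA) o\<^sub>L adj U)) - (B - SB)"
    by (simp add: compose_distribs SB compose_assoc)
  have "norm ((U o\<^sub>L A o\<^sub>L adj U) - B) \<le> norm (A - SA) + norm (B - SB)"
    unfolding eq
    by (rule order.trans[OF norm_triangle_ineq4]) (intro add_right_mono norm_unitary_conj_le U(2))
  also have "\<dots> < \<epsilon>" using close e unfolding SA_def SB_def by linarith
  finally show ?thesis using U by blast
qed

lemma opow_unitary_conj:
  fixes A U :: "'h \<Rightarrow>\<^sub>L 'h"
  assumes "unitary_op U"
  shows "opow (U o\<^sub>L A o\<^sub>L adj U) n = U o\<^sub>L opow A n o\<^sub>L adj U"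
proof (induction n)
  case (Suc n)
  have "adj U o\<^sub>L (U o\<^sub>L X) = X" for X :: "'h \<Rightarrow>\<^sub>L 'h"
    using assms by (metis compose_assoc compose_id_left unitary_op_def)
  then show ?case unfolding opow_Suc Suc.IH by (simp add: compose_assoc)
qed (use assms in \<open>simp add: unitary_op_def\<close>)

lemma strong_lim_opow: "strong_lim X L \<Longrightarrow> strong_lim (\<lambda>m. opow (X m) n) (opow L n)"
  by (induction n) (simp_all add: strong_lim_const strong_lim_compose)

lemma closure_unitary_orbitI:
  assumes A: "A \<in> M" "adj A = A" and B: "B \<in> M" "adj B = B" "\<And>n. \<tau> (opow B n) = \<tau> (opow A n)"
  shows "B \<in> closure (unitary_orbit M A)"
  unfolding closure_approachable
proof (intro allI impI)
  fix e :: real assume "e > 0"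
  then obtain U where "U \<in> M" "unitary_op U" "norm ((U o\<^sub>L A o\<^sub>L adj U) - B) < e"
    using equal_moments_imp_approx_unitarily_equivalent[OF A B(1,2) B(3)[symmetric]] by blast
  then show "\<exists>y\<in>unitary_orbit M A. dist y B < e"
    by (intro bexI[of _ "U o\<^sub>L A o\<^sub>L adj U"]) (auto simp: dist_norm unitary_orbit_def)
qed

text \<open>The norm bound follows from equality of moments, as the two inclusions together show. It
  is recorded because it makes the right-hand side a bounded set, on which the moments are strongly
  continuous.\<close>

lemma closure_unitary_orbit:
  assumes A: "A \<in> M" "adj A = A"
  shows "closure (unitary_orbit M A) =
    {B \<in> M. adj B = B \<and> norm B \<le> norm A \<and> (\<forall>n. \<tau> (opow B n) = \<tau> (opow A n))}"
proof (intro subset_antisym subsetI)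
  fix B assume "B \<in> closure (unitary_orbit M A)"
  then obtain X where X: "\<And>m. X m \<in> unitary_orbit M A" "X \<longlonglongrightarrow> B" by (auto simp: closure_sequential)
  have XM: "X m \<in> M" and Xsa: "adj (X m) = X m" and Xn: "norm (X m) \<le> norm A"
    and Xmom: "\<tau> (opow (X m) n) = \<tau> (opow A n)" for m n
  proof -
    obtain U where U: "X m = U o\<^sub>L A o\<^sub>L adj U" "U \<in> M" "unitary_op U"
      using X(1)[of m] by (auto simp: unitary_orbit_def)
    show "X m \<in> M" using U A by (simp add: compose_M adj_M)
    show "adj (X m) = X m" using A by (simp add: U adj_compose compose_assoc)
    show "norm (X m) \<le> norm A" using norm_unitary_conj_le[OF U(3), of A] by (simp add: U compose_assoc)
    have "\<tau> (opow (X m) n) = \<tau> (U o\<^sub>L (opow A n o\<^sub>L adj U))"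
      by (simp only: U(1) opow_unitary_conj[OF U(3)]) (simp only: compose_assoc)
    also have "\<dots> = \<tau> ((opow A n o\<^sub>L adj U) o\<^sub>L U)"
      using U A by (intro trace_commute compose_M opow_M adj_M)
    also have "\<dots> = \<tau> (opow A n)" using U(3) by (simp add: compose_assoc unitary_op_def)
    finally show "\<tau> (opow (X m) n) = \<tau> (opow A n)" .
  qed
  note L = tendsto_imp_strong_lim[OF X(2)]
  have "\<tau> (opow B n) = \<tau> (opow A n)" for n
    using trace_strong_lim[OF opow_M[OF XM] strong_lim_opow[OF L], of n] by (simp add: Xmom LIMSEQ_const_iff)
  then show "B \<in> {B \<in> M. adj B = B \<and> norm B \<le> norm A \<and> (\<forall>n. \<tau> (opow B n) = \<tau> (opow A n))}"
    using strong_lim_M[OF XM L] strong_lim_selfadjoint[OF L Xsa] strong_lim_norm_le[OF L Xn] by simp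
next
  fix B assume "B \<in> {B \<in> M. adj B = B \<and> norm B \<le> norm A \<and> (\<forall>n. \<tau> (opow B n) = \<tau> (opow A n))}"
  then show "B \<in> closure (unitary_orbit M A)" by (intro closure_unitary_orbitI A) auto
qed

section \<open>Closedness in the strong operator topology\<close>

lemma closedin_sot_eval:
  assumes "\<And>x. x \<in> I \<Longrightarrow> continuous_map strong_operator_topology euclideanreal (g x)"
  shows "closedin strong_operator_topology {B :: 'h \<Rightarrow>\<^sub>L 'h. \<forall>x\<in>I. g x B \<le> 0}"
proof (cases "I = {}")
  case True
  then show ?thesis using closedin_topspace[of "strong_operator_topology :: ('h \<Rightarrow>\<^sub>L 'h) topology"]
    by (simp add: strong_operator_topology_topspace)
next
  case False
  have "closedin strong_operator_topology {B :: 'h \<Rightarrow>\<^sub>L 'h. g x B \<le> 0}" if "x \<in> I" for x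
    using closedin_continuous_map_preimage[OF assms[OF that], of "{..0}"]
    by (simp add: strong_operator_topology_topspace)
  then have "closedin strong_operator_topology (\<Inter>x\<in>I. {B :: 'h \<Rightarrow>\<^sub>L 'h. g x B \<le> 0})"
    using False by (intro closedin_INT) auto
  moreover have "(\<Inter>x\<in>I. {B :: 'h \<Rightarrow>\<^sub>L 'h. g x B \<le> 0}) = {B. \<forall>x\<in>I. g x B \<le> 0}" by auto
  ultimately show ?thesis by simp
qed

text \<open>Every condition is expressed by continuous functions of evaluations: \<open>M\<close> as
  a bicommutant by commutation at vectors, self-adjointness by inner products instead of the
  discontinuous adjoint, and the norm ball by its pointwise bounds.\<close>

lemma closedin_sot_bounded_selfadjoint:
  "closedin strong_operator_topology {B \<in> M. adj B = B \<and> norm B \<le> r}"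
proof (cases "r \<ge> 0")
  case False
  then have "{B \<in> M. adj B = B \<and> norm B \<le> r} = {}" using norm_ge_zero order.trans by blast
  then show ?thesis by (metis closedin_empty)
next
  case True
  have ev: "continuous_map strong_operator_topology euclideanreal (\<lambda>B. g (blinfun_apply B x) (blinfun_apply B y))"
    if "continuous_on UNIV (\<lambda>(u, v). g u v)" for g :: "'h \<Rightarrow> 'h \<Rightarrow> real" and x y :: 'h
  proof -
    have "continuous_map strong_operator_topology euclidean (\<lambda>B. (blinfun_apply B x, blinfun_apply B y))"
      unfolding prod_topology_euclidean[symmetric] continuous_map_pairwise o_def
      by (simp add: strong_operator_topology_continuous_evaluation)
    from continuous_map_compose[OF this, of euclideanreal "\<lambda>(u, v). g u v"] that
    show ?thesis by (simp add: o_def)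
  qed
  have "continuous_map strong_operator_topology euclideanreal (\<lambda>B :: 'h \<Rightarrow>\<^sub>L 'h. norm (blinfun_apply B (S x) - S (blinfun_apply B x)))"
    for S :: "'h \<Rightarrow>\<^sub>L 'h" and x
    using ev[of "\<lambda>u v. norm (u - blinfun_apply S v)" "S x" x]
    by (simp add: case_prod_unfold continuous_intros)
  then have "closedin strong_operator_topology
      {B :: 'h \<Rightarrow>\<^sub>L 'h. \<forall>p\<in>insert J (commutant J M) \<times> UNIV. norm (B (blinfun_apply (fst p) (snd p)) - blinfun_apply (fst p) (B (snd p))) \<le> 0}"
    by (intro closedin_sot_eval)
  also have "{B :: 'h \<Rightarrow>\<^sub>L 'h. \<forall>p\<in>insert J (commutant J M) \<times> UNIV. norm (B (blinfun_apply (fst p) (snd p)) - blinfun_apply (fst p) (B (snd p))) \<le> 0} = M"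
    by (subst bicommutant[symmetric]) (auto simp: commutant_def[of J "commutant J M"] cops_def blinfun_eq_iff)
  finally have 1: "closedin strong_operator_topology M" .
  have "continuous_map strong_operator_topology euclideanreal (\<lambda>B :: 'h \<Rightarrow>\<^sub>L 'h. \<bar>inner (blinfun_apply B x) y - inner x (blinfun_apply B y)\<bar>)" for x y :: 'h
    using ev[of "\<lambda>u v. \<bar>inner u y - inner x v\<bar>" x y] by (simp add: case_prod_unfold continuous_intros)
  then have "closedin strong_operator_topology
      {B :: 'h \<Rightarrow>\<^sub>L 'h. \<forall>p\<in>UNIV. \<bar>inner (B (fst p)) (snd p) - inner (fst p) (B (snd p))\<bar> \<le> 0}"
    by (intro closedin_sot_eval)
  also have "{B :: 'h \<Rightarrow>\<^sub>L 'h. \<forall>p\<in>UNIV. \<bar>inner (B (fst p)) (snd p) - inner (fst p) (B (snd p))\<bar> \<le> 0} = {B. adj B = B}"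
    unfolding selfadjoint_op_iff[symmetric] selfadjoint_op_def by auto
  finally have 2: "closedin strong_operator_topology {B :: 'h \<Rightarrow>\<^sub>L 'h. adj B = B}" .
  have "continuous_map strong_operator_topology euclideanreal (\<lambda>B :: 'h \<Rightarrow>\<^sub>L 'h. norm (blinfun_apply B x) - r * norm x)" for x :: 'h
    using ev[of "\<lambda>u v. norm u - r * norm x" x x] by (simp add: case_prod_unfold continuous_intros)
  then have "closedin strong_operator_topology {B :: 'h \<Rightarrow>\<^sub>L 'h. \<forall>x\<in>UNIV. norm (B x) - r * norm x \<le> 0}"
    by (intro closedin_sot_eval)
  also have "{B :: 'h \<Rightarrow>\<^sub>L 'h. \<forall>x\<in>UNIV. norm (B x) - r * norm x \<le> 0} = {B. norm B \<le> r}"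
  proof safe
    fix B :: "'h \<Rightarrow>\<^sub>L 'h"
    assume "\<forall>x\<in>UNIV. norm (B x) - r * norm x \<le> 0"
    then show "norm B \<le> r" using True by (intro norm_blinfun_bound) auto
  next
    fix B :: "'h \<Rightarrow>\<^sub>L 'h" and x
    assume "norm B \<le> r"
    then show "norm (B x) - r * norm x \<le> 0"
      using norm_blinfun[of B x] mult_right_mono[of "norm B" r "norm x"] by simp
  qed
  finally have 3: "closedin strong_operator_topology {B :: 'h \<Rightarrow>\<^sub>L 'h. norm B \<le> r}" .
  have "{B \<in> M. adj B = B \<and> norm B \<le> r} = M \<inter> ({B. adj B = B} \<inter> {B. norm B \<le> r})" by auto
  then show ?thesis using closedin_Int[OF 1 closedin_Int[OF 2 3]] by simp
qed

text \<open>In the induction step both the operator and the vector it acts on vary, which is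
  harmless only while the operators stay in a ball. The filter \<open>atin\<close> is used because
  sequences need not detect continuity in this topology.\<close>

lemma continuous_map_opow_apply:
  "continuous_map (subtopology strong_operator_topology {B :: 'h \<Rightarrow>\<^sub>L 'h. norm B \<le> r}) euclidean (\<lambda>B. opow B n x)"
proof (induction n)
  case (Suc n)
  let ?T = "subtopology strong_operator_topology {B :: 'h \<Rightarrow>\<^sub>L 'h. norm B \<le> r}"
  show ?case
    unfolding continuous_map_atin
  proof
    fix C assume C: "C \<in> topspace ?T"
    have "limitin ?T (\<lambda>B. B) C (atin ?T C)" using continuous_map_id[of ?T] C unfolding continuous_map_atin id_def by blast
    then have "\<forall>\<^sub>F B in atin ?T C. norm B \<le> r" "\<And>x. ((\<lambda>B. blinfun_apply B x) \<longlongrightarrow> blinfun_apply C x) (atin ?T C)"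
      by (auto simp: limitin_subtopology limitin_strong_operator_topology)
    moreover have "((\<lambda>B. opow B n x) \<longlongrightarrow> opow C n x) (atin ?T C)"
      using Suc C unfolding continuous_map_atin by simp
    ultimately have "((\<lambda>B. B (opow B n x)) \<longlongrightarrow> C (opow C n x)) (atin ?T C)"
      by (rule bounded_strong_tendsto_apply)
    then show "limitin euclidean (\<lambda>B. opow B (Suc n) x) (opow C (Suc n) x) (atin ?T C)" by simp
  qed
qed simp

lemma closedin_sot_moments:
  "closedin strong_operator_topology {B \<in> M. adj B = B \<and> norm B \<le> r \<and> (\<forall>n. \<tau> (opow B n) = a n)}"
proof -
  define C where "C = {B \<in> M. adj B = B \<and> norm B \<le> r}"
  let ?T = "subtopology strong_operator_topology C"
  have C: "closedin strong_operator_topology C" unfolding C_def by (rule closedin_sot_bounded_selfadjoint)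
  have "closedin ?T {B \<in> C. \<tau> (opow B n) = a n}" for n
  proof -
    \<comment> \<open>Bounds the n-th powers on \<open>C\<close>, so that dividing by it moves them
      into the unit ball, where the trace is continuous; the maximum with 1 makes it
      positive.\<close>
    define c where "c = max 1 r ^ n"
    have c: "c > 0" by (simp add: c_def)
    have "norm (opow B n) \<le> c" if "B \<in> C" for B
      unfolding c_def using that by (intro norm_opow_le) (auto simp: C_def le_max_iff_disj)
    then have img: "(1/c) *\<^sub>R opow B n \<in> {A \<in> M. norm A \<le> 1}" if "B \<in> C" for B
      using that c by (simp add: C_def scaleR_M opow_M)
    have "continuous_map ?T euclidean (\<lambda>B. opow B n x)" for x
      by (rule continuous_map_from_subtopology_mono[OF continuous_map_opow_apply[of r n x]]) (auto simp: C_def)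
    then have "continuous_map ?T euclidean (\<lambda>B. ((1/c) *\<^sub>R opow B n) x)" for x
      using continuous_map_compose[of ?T euclidean "\<lambda>B. opow B n x" euclidean "\<lambda>y. (1/c) *\<^sub>R y"]
      by (simp add: o_def blinfun.scaleR_left continuous_on_scaleR continuous_on_const continuous_on_id)
    then have "continuous_map ?T (subtopology strong_operator_topology {A \<in> M. norm A \<le> 1}) (\<lambda>B. (1/c) *\<^sub>R opow B n)"
      using img by (auto simp: continuous_map_in_subtopology continuous_on_strong_operator_topo_iff_coordinatewise)
    from continuous_map_compose[OF this trace_continuous]
    have "closedin ?T {B \<in> topspace ?T. (\<tau> \<circ> (\<lambda>B. (1/c) *\<^sub>R opow B n)) B \<in> {of_real (1/c) * a n}}"
      by (rule closedin_continuous_map_preimage) simp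
    also have "{B \<in> topspace ?T. (\<tau> \<circ> (\<lambda>B. (1/c) *\<^sub>R opow B n)) B \<in> {of_real (1/c) * a n}} = {B \<in> C. \<tau> (opow B n) = a n}"
      using c by (auto simp: strong_operator_topology_topspace C_def trace_scaleR opow_M)
    finally show ?thesis .
  qed
  then have "closedin strong_operator_topology {B \<in> C. \<tau> (opow B n) = a n}" for n
    using C closedin_trans_full by blast
  then have "closedin strong_operator_topology (\<Inter>n. {B \<in> C. \<tau> (opow B n) = a n})"
    by (intro closedin_INT) auto
  also have "(\<Inter>n. {B \<in> C. \<tau> (opow B n) = a n}) = {B \<in> M. adj B = B \<and> norm B \<le> r \<and> (\<forall>n. \<tau> (opow B n) = a n)}"
    by (auto simp: C_def)
  finally show ?thesis .
qed

end

section \<open>The spectral distribution\<close>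

text \<open>Both characteristic functions are compared with one common Taylor sum. Its order is even
  so that the absolute moment in the remainder is an ordinary moment and the growth bound applies;
  the factorial then wins.\<close>

lemma real_distribution_eq_if_moments_eq:
  fixes m1 m2 :: "real measure"
  assumes m1: "real_distribution m1" and m2: "real_distribution m2"
    and i1: "\<And>n. integrable m1 (\<lambda>x. x ^ n)" and i2: "\<And>n. integrable m2 (\<lambda>x. x ^ n)"
    and eq: "\<And>n. (\<integral>x. x ^ n \<partial>m1) = (\<integral>x. x ^ n \<partial>m2)"
    and bound: "\<And>n. \<bar>\<integral>x. x ^ n \<partial>m1\<bar> \<le> C * R ^ n"
  shows "m1 = m2"
proof (rule Levy_uniqueness[OF m1 m2], rule ext)
  fix t :: real
  define S where "S n = (\<Sum>k\<le>n. (\<i> * t) ^ k / fact k * (\<integral>x. x ^ k \<partial>m1))" for n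
  have bnd: "cmod (char m t - S (2 * n)) \<le> 2 * C * ((\<bar>t\<bar> * R) ^ (2 * n) / fact (2 * n))"
    if m: "real_distribution m" and i: "\<And>n. integrable m (\<lambda>x. x ^ n)"
      and e: "\<And>n. (\<integral>x. x ^ n \<partial>m) = (\<integral>x. x ^ n \<partial>m1)" for m n
  proof -
    have "cmod (char m t - S (2 * n)) \<le> (2 * \<bar>t\<bar> ^ (2 * n) / fact (2 * n)) * (\<integral>x. \<bar>x\<bar> ^ (2 * n) \<partial>m)"
      unfolding S_def e[symmetric] by (rule real_distribution.char_approx1[OF m i])
    also have "(\<integral>x. \<bar>x\<bar> ^ (2 * n) \<partial>m) = (\<integral>x. x ^ (2 * n) \<partial>m1)" by (simp add: power_even_abs e)
    also have "(2 * \<bar>t\<bar> ^ (2 * n) / fact (2 * n)) * (\<integral>x. x ^ (2 * n) \<partial>m1)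
        \<le> (2 * \<bar>t\<bar> ^ (2 * n) / fact (2 * n)) * (C * R ^ (2 * n))"
      using bound[of "2 * n"] by (intro mult_left_mono) auto
    also have "\<dots> = 2 * C * ((\<bar>t\<bar> * R) ^ (2 * n) / fact (2 * n))" by (simp add: power_mult_distrib)
    finally show ?thesis .
  qed
  have "(\<lambda>n. (\<bar>t\<bar> * R) ^ n / fact n) \<longlonglongrightarrow> 0"
    using summable_LIMSEQ_zero[OF summable_exp[of "\<bar>t\<bar> * R"]] by (simp add: field_simps)
  from LIMSEQ_subseq_LIMSEQ[OF this, of "\<lambda>n. 2 * n"]
  have "(\<lambda>n. (\<bar>t\<bar> * R) ^ (2 * n) / fact (2 * n)) \<longlonglongrightarrow> 0" by (simp add: o_def strict_mono_def)
  from tendsto_mult_right_zero[OF this, of "4 * C"]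
  have lim: "(\<lambda>n. 4 * C * ((\<bar>t\<bar> * R) ^ (2 * n) / fact (2 * n))) \<longlonglongrightarrow> 0" .
  have "cmod (char m1 t - char m2 t) \<le> 4 * C * ((\<bar>t\<bar> * R) ^ (2 * n) / fact (2 * n))" for n
    using norm_triangle_ineq4[of "char m1 t - S (2 * n)" "char m2 t - S (2 * n)"]
      bnd[OF m1 i1 refl, of n] bnd[OF m2 i2 eq[symmetric], of n] by simp
  then have "cmod (char m1 t - char m2 t) \<le> 0" by (intro LIMSEQ_le_const[OF lim]) blast
  then show "char m1 t = char m2 t" by simp
qed

lemma finite_discrete_distribution:
  fixes t w :: "nat \<Rightarrow> real"
  assumes w: "\<And>j. j < k \<Longrightarrow> w j \<ge> 0" "(\<Sum>j<k. w j) = 1" and t: "\<And>j. j < k \<Longrightarrow> \<bar>t j\<bar> \<le> b"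
  shows "\<exists>\<mu>. real_distribution \<mu> \<and> (AE x in \<mu>. \<bar>x\<bar> \<le> b) \<and>
    (\<forall>f :: real \<Rightarrow> real. f \<in> borel_measurable borel \<longrightarrow> integral\<^sup>L \<mu> f = (\<Sum>j<k. w j * f (t j)))"
proof -
  \<comment> \<open>Weights are placed on the indices, with zero beyond \<open>k\<close>, and then
    pushed forward along \<open>t\<close>; in this way coinciding values of \<open>t\<close> cause
    no trouble.\<close>
  define v where "v j = (if j < k then w j else 0)" for j
  define p where "p = embed_pmf v"
  have nn: "\<And>j. 0 \<le> v j" by (simp add: v_def w)
  have "(\<integral>\<^sup>+ j. ennreal (v j) \<partial>count_space UNIV) = (\<Sum>j<k. ennreal (v j))"
    by (rule nn_integral_count_space') (auto simp: v_def)
  also have "\<dots> = 1" using w by (subst sum_ennreal) (auto simp: v_def)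
  finally have int1: "(\<integral>\<^sup>+ j. ennreal (v j) \<partial>count_space UNIV) = 1" .
  have p: "pmf p j = v j" for j unfolding p_def by (rule pmf_embed_pmf[OF nn int1])
  have supp: "set_pmf p \<subseteq> {..<k}"
    unfolding p_def set_embed_pmf[OF nn int1] by (auto simp: v_def split: if_splits)
  define \<mu> where "\<mu> = distr (measure_pmf p) borel t"
  have "real_distribution \<mu>"
    unfolding \<mu>_def by (rule real_distribution.intro) (auto intro!: measure_pmf.prob_space_distr simp: real_distribution_axioms_def)
  moreover have "AE x in \<mu>. \<bar>x\<bar> \<le> b"
    unfolding \<mu>_def using supp t by (subst AE_distr_iff) (auto simp: AE_measure_pmf_iff)
  moreover have "integral\<^sup>L \<mu> f = (\<Sum>j<k. w j * f (t j))" if "f \<in> borel_measurable borel" for f :: "real \<Rightarrow> real"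
  proof -
    have "integral\<^sup>L \<mu> f = (\<integral>j. f (t j) \<partial>measure_pmf p)" unfolding \<mu>_def by (rule integral_distr) (use that in auto)
    also have "\<dots> = (\<Sum>j<k. f (t j) * pmf p j)" by (rule integral_measure_pmf_real) (use supp in auto)
    also have "\<dots> = (\<Sum>j<k. w j * f (t j))" by (intro sum.cong) (auto simp: p v_def)
    finally show ?thesis .
  qed
  ultimately show ?thesis by blast
qed

text \<open>Tightness yields a weak limit along a subsequence, but weak convergence tests only
  bounded continuous functions. Since all supports lie in one interval, powers may be truncated
  outside it without changing an integral, provided the limit lives there too.\<close>

lemma moments_of_limit_distribution:
  fixes \<mu> :: "nat \<Rightarrow> real measure"
  assumes \<mu>: "\<And>i. real_distribution (\<mu> i)" and supp: "\<And>i. AE x in \<mu> i. \<bar>x\<bar> \<le> b"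
    and lim: "\<And>n. (\<lambda>i. \<integral>x. x ^ n \<partial>\<mu> i) \<longlonglongrightarrow> a n"
  shows "\<exists>m. real_distribution m \<and> (\<forall>n. integrable m (\<lambda>x. x ^ n) \<and> (\<integral>x. x ^ n \<partial>m) = a n)"
proof -
  have "tight \<mu>"
    unfolding tight_def
  proof (intro conjI allI impI \<mu>)
    fix \<epsilon> :: real assume "\<epsilon> > 0"
    \<comment> \<open>The margin 1 keeps the excluded left endpoint of the half-open interval away
      from the support.\<close>
    have "measure (\<mu> i) {- (\<bar>b\<bar> + 1)<..\<bar>b\<bar> + 1} = 1" for i
    proof -
      interpret real_distribution "\<mu> i" by (rule \<mu>)
      have "AE x in \<mu> i. x \<in> {- (\<bar>b\<bar> + 1)<..\<bar>b\<bar> + 1}" using supp[of i] by eventually_elim auto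
      then show ?thesis by (subst (asm) AE_in_set_eq_1) auto
    qed
    then show "\<exists>a b. a < b \<and> (\<forall>n. 1 - \<epsilon> < measure (\<mu> n) {a<..b})"
      using \<open>\<epsilon> > 0\<close> by (intro exI[of _ "- (\<bar>b\<bar> + 1)"] exI[of _ "\<bar>b\<bar> + 1"]) auto
  qed
  from tight_imp_convergent_subsubsequence[OF this strict_mono_id]
  obtain r m where r: "strict_mono r" and m: "real_distribution m" and wc: "weak_conv_m (\<mu> \<circ> r) m"
    by (auto simp: id_def o_def)
  interpret m: real_distribution m by (rule m)
  have conv: "(\<lambda>i. integral\<^sup>L (\<mu> (r i)) f) \<longlonglongrightarrow> integral\<^sup>L m f"
    if "\<And>x. isCont f x" "\<And>x. norm (f x) \<le> B" for f :: "real \<Rightarrow> real" and B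
    using weak_conv_imp_integral_bdd_continuous_conv[OF \<mu> m wc[unfolded o_def] that] .
  \<comment> \<open>A bounded continuous function vanishing exactly where
    \<open>\<bar>x\<bar> \<le> b\<close>; its integral stays zero in the limit, so the limit has no
    mass outside.\<close>
  define g where "g x = max 0 (min 1 (\<bar>x\<bar> - b))" for x :: real
  have g0: "g x = 0 \<longleftrightarrow> \<bar>x\<bar> \<le> b" "0 \<le> g x" "g x \<le> 1" for x by (auto simp: g_def)
  have gc: "isCont g x" for x unfolding g_def by (intro continuous_intros)
  have gm: "g \<in> borel_measurable borel" unfolding g_def by measurable
  have "integral\<^sup>L (\<mu> (r i)) g = 0" for i
    using supp[of "r i"] g0 by (intro integral_eq_zero_AE) (auto elim: eventually_mono)
  with conv[of g 1] gc g0 have "integral\<^sup>L m g = 0" by (simp add: LIMSEQ_const_iff)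
  moreover have "integrable m g"
    by (rule m.integrable_const_bound[where B = 1]) (use g0 gm in auto)
  ultimately have "AE x in m. g x = 0" using integral_nonneg_eq_0_iff_AE[of m g] g0 by auto
  then have ms: "AE x in m. \<bar>x\<bar> \<le> b" by (simp add: g0)
  have "integrable m (\<lambda>x. x ^ n) \<and> (\<integral>x. x ^ n \<partial>m) = a n" for n
  proof -
    define f where "f x = (max (- b) (min b x)) ^ n" for x :: real
    have fx: "f x = x ^ n" if "\<bar>x\<bar> \<le> b" for x using that by (simp add: f_def abs_le_iff min_absorb2 max_absorb2)
    have fc: "isCont f x" for x unfolding f_def by (intro continuous_intros)
    have fm: "f \<in> borel_measurable borel" unfolding f_def by measurable
    have fb: "norm (f x) \<le> \<bar>b\<bar> ^ n" for x
      unfolding f_def real_norm_def power_abs by (intro power_mono) auto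
    have eq: "integral\<^sup>L (\<mu> i) f = (\<integral>x. x ^ n \<partial>\<mu> i)" for i
    proof -
      interpret real_distribution "\<mu> i" by (rule \<mu>)
      show ?thesis using supp[of i] fm by (intro integral_cong_AE) (auto elim!: eventually_mono simp: fx)
    qed
    have AEf: "AE x in m. f x = x ^ n" using ms by (auto elim!: eventually_mono simp: fx)
    have "integrable m f" by (rule m.integrable_const_bound[where B = "\<bar>b\<bar> ^ n"]) (use fb fm in auto)
    then have "integrable m (\<lambda>x. x ^ n)" using AEf fm by (subst integrable_cong_AE[symmetric]) auto
    moreover have "integral\<^sup>L m f = (\<integral>x. x ^ n \<partial>m)" using AEf fm by (intro integral_cong_AE) auto
    moreover have "integral\<^sup>L m f = a n"
      using LIMSEQ_unique[OF conv[OF fc fb]] LIMSEQ_subseq_LIMSEQ[OF lim[of n] r] by (simp add: eq o_def)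
    ultimately show ?thesis by simp
  qed
  with m show ?thesis by blast
qed

lemma opow_step:
  assumes P: "projection_partition k P"
  shows "opow (\<Sum>j<k. t j *\<^sub>R P j) n = (\<Sum>j<k. (t j) ^ n *\<^sub>R P j)"
proof (induction n)
  case 0
  then show ?case using P by (simp add: projection_partition_def)
next
  case (Suc n)
  have "P i o\<^sub>L (\<Sum>j<k. (t j) ^ n *\<^sub>R P j) = (t i) ^ n *\<^sub>R P i" if i: "i < k" for i
  proof -
    have "P i o\<^sub>L (\<Sum>j<k. (t j) ^ n *\<^sub>R P j) = (\<Sum>j<k. if j = i then (t i) ^ n *\<^sub>R P i else 0)"
      unfolding compose_sum_right
      by (intro sum.cong refl) (use projection_partition_compose[OF P] i in \<open>auto simp: compose_distribs\<close>)
    then show ?thesis using i by simp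
  qed
  then show ?case
    unfolding opow_Suc Suc.IH compose_sum_left
    by (intro sum.cong refl) (simp add: compose_scaleR_left)
qed

section \<open>Trace moments as moments of a distribution\<close>

context finite_factor
begin

lemma exists_distribution_with_trace_moments:
  assumes A: "A \<in> M" "adj A = A"
  shows "\<exists>m. real_distribution m \<and>
    (\<forall>n. integrable m (\<lambda>x. x ^ n) \<and> complex_of_real (\<integral>x. x ^ n \<partial>m) = \<tau> (opow A n))"
proof -
  let ?G = "{(X, Y :: 'h \<Rightarrow>\<^sub>L 'h). X \<in> M}"
  \<comment> \<open>The step values at accuracy 1/(i+1) are at most \<open>norm A\<close> plus
    2/(i+1) in modulus, so this bounds the supports for all i at once.\<close>
  define b where "b = norm A + 2"
  have "\<exists>\<mu> S. S \<in> M \<and> norm (A - S) \<le> 1 / real (Suc i) \<and> real_distribution \<mu> \<and> (AE x in \<mu>. \<bar>x\<bar> \<le> b) \<and>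
    (\<forall>n. \<tau> (opow S n) = complex_of_real (\<integral>x. x ^ n \<partial>\<mu>))" for i
  proof -
    have AG: "(A, A) \<in> ?G" "1 / real (Suc i) > 0" using A by simp_all
    obtain k t P where t: "\<forall>j<k. \<bar>t j\<bar> \<le> norm A + 2 * (1 / real (Suc i))" and PM: "\<forall>j<k. P j \<in> M"
      and part: "projection_partition k P" and close: "norm (A - (\<Sum>j<k. t j *\<^sub>R P j)) \<le> 1 / real (Suc i)"
      using joint_spectral_step_approx[OF spa_M AG(1) A(2) order_refl A(2) order_refl AG(2)] by auto
    have proj: "is_projection (P j)" if "j < k" for j using part that by (simp add: projection_partition_def)
    define w where "w j = Re (\<tau> (P j))" for j
    have \<tau>P: "\<tau> (P j) = complex_of_real (w j)" if "j < k" for j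
      using trace_projection(1)[of "P j"] PM proj that by (simp add: w_def complex_eq_iff)
    have \<tau>S: "\<tau> (opow (\<Sum>j<k. t j *\<^sub>R P j) n) = complex_of_real (\<Sum>j<k. w j * (t j) ^ n)" for n
      unfolding opow_step[OF part] using PM
      by (subst trace_sum) (auto simp: scaleR_M trace_scaleR \<tau>P intro!: sum.cong)
    have "w j \<ge> 0" if "j < k" for j using trace_projection(2)[of "P j"] PM proj that by (simp add: w_def)
    moreover have "(\<Sum>j<k. w j) = 1"
      using \<tau>S[of 0] by (simp add: trace_id) (metis of_real_eq_1_iff of_real_sum)
    moreover have "\<bar>t j\<bar> \<le> b" if "j < k" for j
    proof -
      have "1 / real (Suc i) \<le> 1" by simp
      then show ?thesis using t that unfolding b_def by (smt (verit))
    qed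
    ultimately obtain \<mu> where \<mu>: "real_distribution \<mu>" "AE x in \<mu>. \<bar>x\<bar> \<le> b"
      and int: "\<And>f :: real \<Rightarrow> real. f \<in> borel_measurable borel \<Longrightarrow> integral\<^sup>L \<mu> f = (\<Sum>j<k. w j * f (t j))"
      using finite_discrete_distribution[of k w t b] by blast
    have "(\<Sum>j<k. t j *\<^sub>R P j) \<in> M" using PM by (intro sum_M scaleR_M) auto
    then show ?thesis using close \<mu> \<tau>S int[of "\<lambda>x. x ^ _"]
      by (intro exI[of _ \<mu>] exI[of _ "\<Sum>j<k. t j *\<^sub>R P j"]) auto
  qed
  then obtain \<mu> S where S: "\<And>i. S i \<in> M" "\<And>i. norm (A - S i) \<le> 1 / real (Suc i)"
    and \<mu>: "\<And>i. real_distribution (\<mu> i)" "\<And>i. AE x in \<mu> i. \<bar>x\<bar> \<le> b"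
    and mom: "\<And>i n. \<tau> (opow (S i) n) = complex_of_real (\<integral>x. x ^ n \<partial>\<mu> i)"
    by metis
  have "S \<longlonglongrightarrow> A"
  proof (rule LIM_zero_cancel, rule Lim_null_comparison)
    show "\<forall>\<^sub>F i in sequentially. norm (S i - A) \<le> 1 / real (Suc i)"
      using S(2) by (simp add: norm_minus_commute)
    show "(\<lambda>i. 1 / real (Suc i)) \<longlonglongrightarrow> 0" by (rule LIMSEQ_Suc[OF lim_1_over_n])
  qed
  then have lim: "(\<lambda>i. \<tau> (opow (S i) n)) \<longlonglongrightarrow> \<tau> (opow A n)" for n
    by (intro trace_strong_lim opow_M S strong_lim_opow tendsto_imp_strong_lim)
  have "(\<lambda>i. \<integral>x. x ^ n \<partial>\<mu> i) \<longlonglongrightarrow> Re (\<tau> (opow A n))" for n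
    using tendsto_Re[OF lim[of n]] by (simp add: mom)
  from moments_of_limit_distribution[OF \<mu> this]
  obtain m where m: "real_distribution m"
    "\<And>n. integrable m (\<lambda>x. x ^ n)" "\<And>n. (\<integral>x. x ^ n \<partial>m) = Re (\<tau> (opow A n))" by blast
  \<comment> \<open>The approximating moments are real, hence so are their limits, and nothing is
    lost by matching real parts.\<close>
  have "Im (\<tau> (opow A n)) = 0" for n
    using tendsto_Im[OF lim[of n]] by (simp add: mom LIMSEQ_const_iff)
  then show ?thesis using m by (intro exI[of _ m]) (simp add: complex_eq_iff)
qed

lemma spectral_distribution_moments:
  assumes A: "A \<in> M" "adj A = A"
  shows "complex_of_real (\<integral>x. x ^ n \<partial>spectral_distribution \<tau> A) = \<tau> (opow A n)"
proof -
  let ?p = "\<lambda>m. sets m = sets borel \<and> prob_space m \<and> (\<forall>n. integrable m (\<lambda>x. x ^ n) \<and>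
    complex_of_real (integral\<^sup>L m (\<lambda>x. x ^ n)) = \<tau> (opow A n))"
  have rd: "real_distribution m" if "?p m" for m :: "real measure"
    using that by (simp add: real_distribution_def real_distribution_axioms_def)
  obtain m where m: "real_distribution m"
    "\<forall>n. integrable m (\<lambda>x. x ^ n) \<and> complex_of_real (\<integral>x. x ^ n \<partial>m) = \<tau> (opow A n)"
    using exists_distribution_with_trace_moments[OF A] by blast
  then have pm: "?p m" by (simp add: real_distribution_def real_distribution_axioms_def)
  obtain C where C: "C > 0" "\<And>X. X \<in> M \<Longrightarrow> cmod (\<tau> X) \<le> C * norm X" using trace_bounded by blast
  have "m' = m" if m': "?p m'" for m'
  proof (rule real_distribution_eq_if_moments_eq[OF rd[OF m'] m(1)])
    show "integrable m' (\<lambda>x. x ^ n)" "integrable m (\<lambda>x. x ^ n)" for n using m' m by blast+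
    show "(\<integral>x. x ^ n \<partial>m') = (\<integral>x. x ^ n \<partial>m)" for n using m' m(2) by (metis of_real_eq_iff)
    fix n
    have "\<bar>\<integral>x. x ^ n \<partial>m'\<bar> = cmod (\<tau> (opow A n))" using m' by (metis norm_of_real)
    also have "\<dots> \<le> C * norm (opow A n)" using C A by (simp add: opow_M)
    also have "\<dots> \<le> C * norm A ^ n" using C(1) by (intro mult_left_mono norm_opow_le) auto
    finally show "\<bar>\<integral>x. x ^ n \<partial>m'\<bar> \<le> C * norm A ^ n" .
  qed
  then have "spectral_distribution \<tau> A = m" unfolding spectral_distribution_def by (intro the_equality pm)
  then show ?thesis using m(2) by simp
qed

text \<open>The operator enters the definition only through its moments, so equal moments give the
  same defining predicate. Reading the moments back off the measure relies on existence and
  uniqueness.\<close>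

lemma spectral_distribution_eq_iff:
  assumes "A \<in> M" "adj A = A" "B \<in> M" "adj B = B"
  shows "spectral_distribution \<tau> B = spectral_distribution \<tau> A \<longleftrightarrow> (\<forall>n. \<tau> (opow B n) = \<tau> (opow A n))"
proof
  assume "spectral_distribution \<tau> B = spectral_distribution \<tau> A"
  then show "\<forall>n. \<tau> (opow B n) = \<tau> (opow A n)"
    using spectral_distribution_moments[OF assms(1,2)] spectral_distribution_moments[OF assms(3,4)] by metis
qed (simp add: spectral_distribution_def)

end

theorem theorem5p4:
  fixes J :: "'h::{real_inner,complete_space} \<Rightarrow>\<^sub>L 'h"
    and M :: "('h \<Rightarrow>\<^sub>L 'h) set"
    and \<tau> :: "('h \<Rightarrow>\<^sub>L 'h) \<Rightarrow> complex"
    and A :: "'h \<Rightarrow>\<^sub>L 'h"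
  assumes "finite_factor_with_trace J M \<tau>"
    and "A \<in> M" and "selfadjoint_op A"
  shows "closedin strong_operator_topology (closure (unitary_orbit M A))
    \<and> closure (unitary_orbit M A) =
        {B \<in> M. selfadjoint_op B \<and> spectral_distribution \<tau> B = spectral_distribution \<tau> A}"
proof
  interpret finite_factor J M \<tau> by standard (rule assms(1))
  have A: "A \<in> M" "adj A = A" using assms(2,3) by (simp_all add: selfadjoint_op_iff)
  show "closedin strong_operator_topology (closure (unitary_orbit M A))"
    unfolding closure_unitary_orbit[OF A] by (rule closedin_sot_moments)
  show "closure (unitary_orbit M A) =
      {B \<in> M. selfadjoint_op B \<and> spectral_distribution \<tau> B = spectral_distribution \<tau> A}"
  proof (intro subset_antisym subsetI)
    fix B assume "B \<in> closure (unitary_orbit M A)"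
    then show "B \<in> {B \<in> M. selfadjoint_op B \<and> spectral_distribution \<tau> B = spectral_distribution \<tau> A}"
      unfolding closure_unitary_orbit[OF A] by (simp add: selfadjoint_op_iff spectral_distribution_eq_iff A)
  next
    fix B assume "B \<in> {B \<in> M. selfadjoint_op B \<and> spectral_distribution \<tau> B = spectral_distribution \<tau> A}"
    then have B: "B \<in> M" "adj B = B" "\<And>n. \<tau> (opow B n) = \<tau> (opow A n)"
      by (auto simp: selfadjoint_op_iff spectral_distribution_eq_iff A)
    then show "B \<in> closure (unitary_orbit M A)" by (intro closure_unitary_orbitI A)
  qed
qed

end
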